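(* Assume Conditions (B1), (B2'), (B3'), (B4') stated in the context, $d\le 4$, that the bandwidth $h$ lies in the range between the orders $n^{-1/5}$ and $n^{-1/(4+d)}$ (i.e. $c\,n^{-1/5}\le h\le C\,n^{-1/(4+d)}$ for constants $0<c,C<\infty$), and that the regression function is additive: $$r^{\mathrm{true}}(\underline{\mathbf x})=r^{\mathrm{true}}_{\mathrm{add},0}+r^{\mathrm{true}}_{\mathrm{add},1}(x_1)+\dots+r^{\mathrm{true}}_{\mathrm{add},d}(x_d).$$ Then, for penalties $R=R_n>0$, as $n\to\infty$, $$\|\widehat{\underline r}_R-\widehat{\underline r}_{\mathrm{add}}\|_2=O_P\Big(\frac{1}{R\sqrt{nh^d}}\Big).$$
   Context: **Data and kernel.** $(\underline{\mathbf X}_i,\varepsilon_i)$, $i=1,\dots,n$, are i.i.d., $\underline{\mathbf X}_i\in[0,1]^d$ with density $f$; $\varepsilon_i$ has mean $0$, variance $\sigma^2$ and is independent of $\underline{\mathbf X}_i$; $Y_i=r^{\mathrm{true}}(\underline{\mathbf X}_i)+\varepsilon_i$. Bandwidths $h_1,\dots,h_d>0$ (depending on $n$) are of the same order (their ratios stay bounded away from $0$ and $\infty$), and $h=(h_1\cdots h_d)^{1/d}$. From a univariate kernel $K\ge 0$ one forms the product kernel, rescaled at the boundary so that $\int_{[0,1]^d}K_h(\underline{\mathbf X}_i,\underline{\mathbf x})\,d\underline{\mathbf x}=1$ for all $\underline{\mathbf X}_i\in[0,1]^d$: $$K_h(\underline{\mathbf X}_i,\underline{\mathbf x})=\prod_{k=1}^d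 \frac{K((X_{i,k}-x_k)/h_k)}{\int_0^1K((X_{i,k}-t)/h_k)\,dt}.$$ **Spaces.** $\mathcal F_{\mathrm{full}}$ is the space of $\underline r=(r^0,\dots,r^d)$ with $r^\ell:[0,1]^d\to\mathbb R$ square integrable, $\|\underline r\|_2^2=\sum_{\ell=0}^d\int r^\ell(\underline{\mathbf x})^2d\underline{\mathbf x}$. $\mathcal F_{\mathrm{add}}\subset\mathcal F_{\mathrm{full}}$ consists of those $\underline r$ for which $r^0$ is additive (a sum of functions of single coordinates) and, for $k=1,\dots,d$, $r^k(\underline{\mathbf x})$ depends only on $x_k$. $\mathcal P_{\mathrm{add}}$ is the $\|\cdot\|_2$-orthogonal projection of $\mathcal F_{\mathrm{full}}$ onto $\mathcal F_{\mathrm{add}}$; $\mathcal I$ is the identity. **Estimators.** For $\underline r\in\mathcal F_{\mathrm{full}}$ put $$Q(\underline r)=\int_{[0,1]^d}\frac1n\sum_{i=1}^n\Big[Y_i-r^0(\underline{\mathbf x})-\sum_{k=1}^dr^k(\underline{\mathbf x})\tfrac{X_{i,k}-x_k}{h_k}\Big]^2K_h(\underline{\mathbf X}_i,\underline{\mathbf x})\,d\underline{\mathbf x}.$$ $\widehat{\underline r}_{\mathrm{add}}$ is the minimizer of $Q$ over $\mathcal F_{\mathrm{add}}$, and for $R>0$, $\widehat{\underline r}_R$ is the minimizer over $\mathcal F_{\mathrm{full}}$ of $Q(\underline r)+R\|(\mathcal I-\mathcal P_{\mathrm{add}})\underline r\|_2^2$. (Under the conditions below these are well defined with probability tending to $1$.)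 **Conditions.** (B1) $K$ is bounded, nonnegative, has compact support $[-C_1,C_1]$, is symmetric about zero and Lipschitz continuous. (B2') $f$ has support $[0,1]^d$ and is bounded away from zero and infinity on $[0,1]^d$. (B3') $\mathbb E[|Y|^\theta]<\infty$ for some $\theta>5/2$. (B4') $r^{\mathrm{true}}$ is twice continuously differentiable and $f$ is once continuously differentiable on $[0,1]^d$. *)

theory Defs
  imports "HOL-Probability.Probability"
begin

text \<open>
  The dimension is \<open>d = CARD('d)\<close> and the design space \<open>[0,1]\<^sup>d\<close> is \<open>cbox 0 1\<close> in \<open>real ^ 'd\<close>.
  A tuple \<open>(r\<^sup>0, \<dots>, r\<^sup>d)\<close> is indexed by \<open>'d option\<close>: \<open>None\<close> stands for the index \<open>0\<close> and
  \<open>Some k\<close> for a coordinate \<open>k\<close>. Only the values on \<open>cbox 0 1\<close> are ever used.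
\<close>

type_synonym 'd field = "'d option \<Rightarrow> real ^ 'd \<Rightarrow> real"

subsection \<open>Function spaces and the projection\<close>

definition F_full :: "'d::finite field set" where
  "F_full = {r. \<forall>l. set_borel_measurable lborel (cbox 0 1) (r l) \<and>
                    set_integrable lborel (cbox 0 1) (\<lambda>x. (r l x)\<^sup>2)}"

definition F_add :: "'d::finite field set" where
  "F_add = {r \<in> F_full.
      (\<exists>m :: 'd \<Rightarrow> real \<Rightarrow> real. \<forall>x \<in> cbox 0 1. r None x = (\<Sum>k\<in>UNIV. m k (x $ k))) \<and>
      (\<forall>k. \<exists>g :: real \<Rightarrow> real. \<forall>x \<in> cbox 0 1. r (Some k) x = g (x $ k))}"

definition inner_F :: "'d::finite field \<Rightarrow> 'd field \<Rightarrow> real" where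
  "inner_F r s = (\<Sum>l\<in>UNIV. LINT x:cbox 0 1|lborel. r l x * s l x)"

definition norm_F :: "'d::finite field \<Rightarrow> real" where
  "norm_F r = sqrt (\<Sum>l\<in>UNIV. LINT x:cbox 0 1|lborel. (r l x)\<^sup>2)"

definition diff_F :: "'d::finite field \<Rightarrow> 'd field \<Rightarrow> 'd field" where
  "diff_F r s = (\<lambda>l x. r l x - s l x)"

text \<open>
  Elements of \<open>F_full\<close> are functions, not classes modulo null sets. The orthogonal projection is
  therefore unique only up to null sets, which neither \<open>inner_F\<close> nor \<open>norm_F\<close> can see.
\<close>

definition P_add :: "'d::finite field \<Rightarrow> 'd field" where
  "P_add r = (SOME p. p \<in> F_add \<and> (\<forall>q \<in> F_add. inner_F (diff_F r p) q = 0))"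

subsection \<open>Kernel and criteria\<close>

definition K_h :: "(real \<Rightarrow> real) \<Rightarrow> real ^ 'd::finite \<Rightarrow> real ^ 'd \<Rightarrow> real ^ 'd \<Rightarrow> real" where
  "K_h K h X x = (\<Prod>k\<in>UNIV. K ((X $ k - x $ k) / h $ k) /
                            (LBINT t:{0..1}. K ((X $ k - t) / h $ k)))"

definition Q ::
  "(real \<Rightarrow> real) \<Rightarrow> real ^ 'd::finite \<Rightarrow> nat \<Rightarrow> (nat \<Rightarrow> real ^ 'd) \<Rightarrow> (nat \<Rightarrow> real) \<Rightarrow> 'd field \<Rightarrow> real"
where
  "Q K h n X Y r = (LINT x:cbox 0 1|lborel.
     1 / real n * (\<Sum>i<n. (Y i - r None x - (\<Sum>k\<in>UNIV. r (Some k) x * ((X i $ k - x $ k) / h $ k)))\<^sup>2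
                           * K_h K h (X i) x))"

definition Q_pen ::
  "(real \<Rightarrow> real) \<Rightarrow> real ^ 'd::finite \<Rightarrow> nat \<Rightarrow> (nat \<Rightarrow> real ^ 'd) \<Rightarrow> (nat \<Rightarrow> real) \<Rightarrow> real \<Rightarrow> 'd field \<Rightarrow> real"
where
  "Q_pen K h n X Y R r = Q K h n X Y r + R * (norm_F (diff_F r (P_add r)))\<^sup>2"

definition mean_bw :: "real ^ 'd::finite \<Rightarrow> real" where
  "mean_bw h = (\<Prod>k\<in>UNIV. h $ k) powr (1 / real CARD('d))"

subsection \<open>Smoothness on a closed set\<close>

text \<open>Derivatives are taken within \<open>S\<close>, i.e. they are one-sided at the boundary of the cube.\<close>

definition C1_on :: "(real ^ 'd::finite) set \<Rightarrow> (real ^ 'd \<Rightarrow> real) \<Rightarrow> bool" where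
  "C1_on S f \<longleftrightarrow> (\<exists>g :: real ^ 'd \<Rightarrow> real ^ 'd. continuous_on S g \<and>
      (\<forall>x \<in> S. (f has_derivative (\<lambda>v. g x \<bullet> v)) (at x within S)))"

definition C2_on :: "(real ^ 'd::finite) set \<Rightarrow> (real ^ 'd \<Rightarrow> real) \<Rightarrow> bool" where
  "C2_on S f \<longleftrightarrow> (\<exists>(g :: real ^ 'd \<Rightarrow> real ^ 'd) (H :: real ^ 'd \<Rightarrow> real ^ 'd ^ 'd).
      continuous_on S H \<and>
      (\<forall>x \<in> S. (f has_derivative (\<lambda>v. g x \<bullet> v)) (at x within S)) \<and>
      (\<forall>x \<in> S. (g has_derivative (\<lambda>v. H x *v v)) (at x within S)))"

subsection \<open>Stochastic boundedness\<close>

text \<open>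
  \<open>Z\<^sub>n = O\<^sub>P(a\<^sub>n)\<close>: for each \<open>e > 0\<close> there is \<open>C\<close> with \<open>P(\<bar>Z\<^sub>n\<bar> > C a\<^sub>n) \<le> e\<close> for all large \<open>n\<close>.
  The \<open>Z\<^sub>n\<close> need not be known to be measurable, and HOL's \<open>measure\<close> is \<open>0\<close> on non-measurable
  sets; hence the complementary event is required to contain a measurable set of probability
  at least \<open>1 - e\<close>.
\<close>

definition (in prob_space) bigO_P :: "(nat \<Rightarrow> 'a \<Rightarrow> real) \<Rightarrow> (nat \<Rightarrow> real) \<Rightarrow> bool" where
  "bigO_P Z a \<longleftrightarrow> (\<forall>e>0. \<exists>C. \<forall>\<^sub>F n in sequentially.
      \<exists>A \<in> events. prob A \<ge> 1 - e \<and> (\<forall>\<omega> \<in> A. \<bar>Z n \<omega>\<bar> \<le> C * a n))"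

end

theory Submission
  imports Defs
begin

text \<open>
  Both estimators minimize quadratic functionals on a Hilbert space, so they satisfy normal
  equations. Let \<open>a\<close> be the empirical Gram form of the local linear fit and let \<open>g\<close> be the
  linear functional (criterion gradient) at \<open>r\<^sub>a\<close>, the additive estimator; \<open>g\<close> vanishes on
  \<open>F_add\<close>. The difference \<open>\<delta>\<close> of the two estimators satisfies
  \<open>a(\<delta>, s) + R \<langle>(I - P) \<delta>, (I - P) s\<rangle> = g(s)\<close>, and if \<open>a\<close> is elliptic and bounded this forces
  \<open>\<parallel>\<delta>\<parallel> \<le> C \<parallel>g\<parallel> / R\<close>. For an additive truth the local linear oracle (the truth and its scaled partial
  derivatives) lies in \<open>F_add\<close>, so \<open>\<parallel>g\<parallel>\<close> is controlled by the score at the oracle: a noise part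
  with second moment \<open>O(1 / (n h\<^sup>d))\<close> and a bias part \<open>O(h\<^sup>2)\<close>, which is of no larger order since
  \<open>h = O(n powr (-1/(4+d)))\<close>.

  Ellipticity is obtained without limits of the design matrices: with probability tending to one
  each cell of a grid of mesh of order \<open>h\<close> contains a number of design points of order \<open>n h\<^sup>d\<close>
  (Chernoff bound and union bound, using \<open>d \<le> 4\<close> and \<open>h \<ge> c n powr (-1/5)\<close>), and
  \<open>d + 1\<close> well placed cells near each point already determine an affine function.
\<close>

subsection \<open>Square-integrable tuples\<close>

text \<open>The estimators are known to be minimizers only if minimizers exist, so existence has to
  be proved on the good event. This is why completeness and closedness of \<open>F_add\<close> are
  worked out; the obstacle is that additivity is demanded at every point of the cube whereas limits
  exist only almost everywhere. \<open>R\<close> is any positive number and may enter only as 1 / R: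
  the comparison rests on the bounds of the Gram form, since the upper bound of the penalized form
  grows with \<open>R\<close>. The error is an L2 norm, so the noise needs a second moment at each
  x, integrated by Fubini, and no supremum. The Gram bounds must hold at all x simultaneously;
  counts in the finitely many cells of a grid achieve that. There are about h^(-d) cells, at most of
  order n^(4/5) by d <= 4 and the lower bound on h, so each expects at least order n^(1/5) points
  and the union bound n^(4/5) exp(-k n^(1/5)) vanishes. Close to the boundary of the cube the cells
  are placed, coordinate by coordinate, on the side facing the interior.\<close>

definition unit_cube :: "(real ^ 'd::finite) measure" where
  "unit_cube = restrict_space lborel (cbox 0 1)"

lemma space_unit_cube [simp]: "space unit_cube = cbox 0 1"
  by (simp add: unit_cube_def space_restrict_space)

lemma sets_unit_cube: "sets unit_cube = sets (restrict_space borel (cbox 0 1))"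
  by (simp add: unit_cube_def sets_restrict_space)

lemma emeasure_lborel_unit_cube: "emeasure lborel (cbox 0 (1 :: real ^ 'd::finite)) = 1"
proof -
  have "emeasure lborel (cbox 0 (1 :: real ^ 'd)) = ennreal (\<Prod>b\<in>Basis. ((1 :: real ^ 'd) - 0) \<bullet> b)"
    by (rule emeasure_lborel_cbox) (auto simp: Basis_vec_def inner_axis)
  also have "(\<Prod>b\<in>Basis. ((1 :: real ^ 'd) - 0) \<bullet> b) = 1"
    by (rule prod.neutral) (auto simp: Basis_vec_def inner_axis)
  finally show ?thesis by simp
qed

lemma prob_space_unit_cube: "prob_space (unit_cube :: (real ^ 'd::finite) measure)"
  by (rule prob_spaceI) (simp add: unit_cube_def emeasure_restrict_space space_restrict_space emeasure_lborel_unit_cube)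

interpretation unit_cube: prob_space "unit_cube :: (real ^ 'd::finite) measure"
  by (rule prob_space_unit_cube)

lemma borel_measurable_unit_cubeI [intro]:
  "f \<in> borel_measurable borel \<Longrightarrow> f \<in> borel_measurable unit_cube"
  unfolding unit_cube_def by (rule measurable_restrict_space1) simp

lemma F_full_iff:
  "r \<in> F_full \<longleftrightarrow> (\<forall>l. r l \<in> borel_measurable unit_cube \<and> integrable unit_cube (\<lambda>x. (r l x)\<^sup>2))"
  unfolding F_full_def unit_cube_def set_borel_measurable_def set_integrable_def
  by (simp add: integrable_restrict_space borel_measurable_restrict_space_iff)

lemma set_lebesgue_integral_unit_cube:
  "(LINT x:cbox 0 1|lborel. f x :: real) = (LINT x|unit_cube. f x)"
  unfolding set_lebesgue_integral_def unit_cube_def by (simp add: integral_restrict_space)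

lemma inner_F_eq: "inner_F r s = (\<Sum>l\<in>UNIV. LINT x|unit_cube. r l x * s l x)"
  by (simp add: inner_F_def set_lebesgue_integral_unit_cube)

lemma norm_F_eq: "norm_F r = sqrt (inner_F r r)"
  by (simp add: inner_F_def norm_F_def power2_eq_square)

definition axpy_F :: "real \<Rightarrow> 'd::finite field \<Rightarrow> 'd field \<Rightarrow> 'd field" where
  "axpy_F t s r = (\<lambda>l x. r l x + t * s l x)"

lemma diff_F_eq_axpy: "diff_F r s = axpy_F (- 1) s r"
  by (simp add: diff_F_def axpy_F_def)

lemma integrable_mult_of_square_integrable:
  fixes f g :: "'a \<Rightarrow> real"
  assumes "f \<in> borel_measurable M" "g \<in> borel_measurable M"
    and "integrable M (\<lambda>x. (f x)\<^sup>2)" "integrable M (\<lambda>x. (g x)\<^sup>2)"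
  shows "integrable M (\<lambda>x. f x * g x)"
proof (rule Bochner_Integration.integrable_bound)
  show "integrable M (\<lambda>x. (f x)\<^sup>2 + (g x)\<^sup>2)" using assms by simp
  have "\<bar>a * b\<bar> \<le> a\<^sup>2 + b\<^sup>2" for a b :: real
    using sum_squares_bound[of "\<bar>a\<bar>" "\<bar>b\<bar>"] zero_le_power2[of a] zero_le_power2[of b]
    unfolding abs_mult power2_abs by linarith
  then show "AE x in M. norm (f x * g x) \<le> norm ((f x)\<^sup>2 + (g x)\<^sup>2)" by simp
qed (use assms in simp)

lemma integrable_mult_F_full:
  "r \<in> F_full \<Longrightarrow> s \<in> F_full \<Longrightarrow> integrable unit_cube (\<lambda>x. r l x * s l' x)"
  by (rule integrable_mult_of_square_integrable) (auto simp: F_full_iff)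

lemma axpy_F_full: assumes "r \<in> F_full" "s \<in> F_full" shows "axpy_F t s r \<in> F_full"
proof -
  have "integrable unit_cube (\<lambda>x. (r l x + t * s l x)\<^sup>2)" for l
  proof -
    have "integrable unit_cube (\<lambda>x. (r l x)\<^sup>2 + (2 * t) * (r l x * s l x) + t\<^sup>2 * (s l x)\<^sup>2)"
      using assms integrable_mult_F_full[OF assms, of l l] by (simp add: F_full_iff)
    then show ?thesis by (simp add: power2_sum algebra_simps power_mult_distrib)
  qed
  moreover have "axpy_F t s r l \<in> borel_measurable unit_cube" for l
    using assms unfolding F_full_iff axpy_F_def
    by (intro borel_measurable_add borel_measurable_times) auto
  ultimately show ?thesis by (auto simp: F_full_iff axpy_F_def)
qed

lemma F_add_subset: "r \<in> F_add \<Longrightarrow> r \<in> F_full"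
  by (simp add: F_add_def)

lemma axpy_F_add: assumes "r \<in> F_add" "s \<in> F_add" shows "axpy_F t s r \<in> F_add"
proof -
  obtain m m' where "\<forall>x \<in> cbox 0 1. r None x = (\<Sum>k\<in>UNIV. m k (x $ k))"
    "\<forall>x \<in> cbox 0 1. s None x = (\<Sum>k\<in>UNIV. m' k (x $ k))"
    using assms unfolding F_add_def by auto
  then have "\<forall>x \<in> cbox 0 1. axpy_F t s r None x = (\<Sum>k\<in>UNIV. (\<lambda>k u. m k u + t * m' k u) k (x $ k))"
    by (simp add: axpy_F_def sum.distrib sum_distrib_left)
  moreover have "\<exists>g. \<forall>x \<in> cbox 0 1. axpy_F t s r (Some k) x = g (x $ k)" for k
  proof -
    obtain g g' where "\<forall>x \<in> cbox 0 1. r (Some k) x = g (x $ k)" "\<forall>x \<in> cbox 0 1. s (Some k) x = g' (x $ k)"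
      using assms unfolding F_add_def by blast
    then show ?thesis by (intro exI[of _ "\<lambda>u. g u + t * g' u"]) (simp add: axpy_F_def)
  qed
  moreover have "axpy_F t s r \<in> F_full"
    using assms by (simp add: axpy_F_full F_add_subset)
  ultimately show ?thesis
    unfolding F_add_def by (intro CollectI conjI allI exI[of _ "\<lambda>k u. m k u + t * m' k u"]) auto
qed

lemma zero_F_add: "(\<lambda>_ _. 0) \<in> F_add"
  unfolding F_add_def by (auto simp: F_full_iff intro!: exI[of _ "\<lambda>_. 0"] exI[of _ "\<lambda>_ _. 0"])

lemma inner_F_commute: "inner_F r s = inner_F s r"
  by (simp add: inner_F_eq mult.commute)

lemma inner_F_axpy:
  assumes "r \<in> F_full" "s \<in> F_full" "q \<in> F_full"
  shows "inner_F (axpy_F t s r) q = inner_F r q + t * inner_F s q"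
  using integrable_mult_F_full[OF assms(1,3)] integrable_mult_F_full[OF assms(2,3)]
  by (simp add: inner_F_eq axpy_F_def distrib_right mult.assoc sum.distrib sum_distrib_left)

lemma inner_F_nonneg: "0 \<le> inner_F r r"
  by (simp add: inner_F_eq sum_nonneg)

lemma norm_F_nonneg [simp]: "0 \<le> norm_F r"
  by (simp add: norm_F_eq inner_F_nonneg)

lemma norm_F_square: "(norm_F r)\<^sup>2 = inner_F r r"
  by (simp add: norm_F_eq inner_F_nonneg)

subsection \<open>Bounded symmetric forms\<close>

text \<open>Only semidefiniteness is required: tuples supported on a null set have norm zero, and
  the penalty form vanishes on all of \<open>F_add\<close>. The same facts thus serve the inner
  product, the Gram form, the penalty and their combination.\<close>

locale form_F =
  fixes V :: "'d::finite field set" and B :: "'d field \<Rightarrow> 'd field \<Rightarrow> real"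
  assumes closed: "r \<in> V \<Longrightarrow> s \<in> V \<Longrightarrow> axpy_F t s r \<in> V"
    and commute: "B r s = B s r"
    and axpy: "r \<in> V \<Longrightarrow> s \<in> V \<Longrightarrow> q \<in> V \<Longrightarrow> B (axpy_F t s r) q = B r q + t * B s q"
    and nonneg: "r \<in> V \<Longrightarrow> 0 \<le> B r r"
begin

lemma axpy_right: "r \<in> V \<Longrightarrow> s \<in> V \<Longrightarrow> q \<in> V \<Longrightarrow> B q (axpy_F t s r) = B q r + t * B q s"
  by (metis axpy commute)

lemma quadratic_axpy:
  assumes "r \<in> V" "s \<in> V"
  shows "B (axpy_F t s r) (axpy_F t s r) = B r r + 2 * t * B r s + t\<^sup>2 * B s s"
proof -
  have "B (axpy_F t s r) (axpy_F t s r) = B r (axpy_F t s r) + t * B s (axpy_F t s r)"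
    by (rule axpy) (use assms closed in auto)
  also have "\<dots> = B r r + t * B r s + t * (B s r + t * B s s)"
    using assms by (simp add: axpy_right)
  finally show ?thesis
    by (simp add: commute[of s r] power2_eq_square algebra_simps)
qed

lemma Cauchy_Schwarz:
  assumes "r \<in> V" "s \<in> V"
  shows "(B r s)\<^sup>2 \<le> B r r * B s s"
proof -
  have *: "0 \<le> B r r + 2 * t * B r s + t\<^sup>2 * B s s" for t
    using nonneg[OF closed[OF assms]] quadratic_axpy[OF assms] by metis
  show ?thesis
  proof (cases "B s s = 0")
    case True
    have "B r s = 0"
    proof (rule ccontr)
      assume "B r s \<noteq> 0"
      \<comment> \<open>With \<open>B s s = 0\<close> the quadratic in t is affine; this t gives it
        the value -1, against nonnegativity.\<close>
      then have "2 * (- (B r r + 1) / (2 * B r s)) * B r s = - (B r r + 1)" by simp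
      then show False using *[of "- (B r r + 1) / (2 * B r s)"] True by simp
    qed
    then show ?thesis using True by simp
  next
    case False
    then have pos: "B s s > 0" using nonneg[OF assms(2)] by simp
    have "0 \<le> (B r r + 2 * (- B r s / B s s) * B r s + (- B r s / B s s)\<^sup>2 * B s s) * B s s"
      using *[of "- B r s / B s s"] pos by (intro mult_nonneg_nonneg) auto
    also have "\<dots> = B r r * B s s - (B r s)\<^sup>2"
      using pos by (simp add: field_simps power2_eq_square)
    finally show ?thesis by simp
  qed
qed

lemma abs_le_sqrt:
  assumes "r \<in> V" "s \<in> V"
  shows "\<bar>B r s\<bar> \<le> sqrt (B r r) * sqrt (B s s)"
  using real_sqrt_le_mono[OF Cauchy_Schwarz[OF assms]] by (simp add: real_sqrt_mult)

lemma sqrt_axpy_le: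
  assumes "r \<in> V" "s \<in> V"
  shows "sqrt (B (axpy_F t s r) (axpy_F t s r)) \<le> sqrt (B r r) + \<bar>t\<bar> * sqrt (B s s)"
proof (rule real_le_lsqrt)
  show "0 \<le> sqrt (B r r) + \<bar>t\<bar> * sqrt (B s s)" by (simp add: assms nonneg)
  have "t * B r s \<le> \<bar>t\<bar> * (sqrt (B r r) * sqrt (B s s))"
    using mult_left_mono[OF abs_le_sqrt[OF assms], of "\<bar>t\<bar>"] abs_ge_self[of "t * B r s"]
    unfolding abs_mult by linarith
  then have "t * B r s \<le> sqrt (B r r) * (\<bar>t\<bar> * sqrt (B s s))"
    by (simp add: mult.left_commute)
  then show "B (axpy_F t s r) (axpy_F t s r) \<le> (sqrt (B r r) + \<bar>t\<bar> * sqrt (B s s))\<^sup>2"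
    by (simp add: quadratic_axpy[OF assms] power2_sum power_mult_distrib nonneg assms)
qed

end

interpretation inner_F: form_F "F_full :: 'd::finite field set" inner_F
  by unfold_locales (auto simp: axpy_F_full inner_F_axpy inner_F_nonneg intro: inner_F_commute)

lemma inner_F_le_norm: "r \<in> F_full \<Longrightarrow> s \<in> F_full \<Longrightarrow> \<bar>inner_F r s\<bar> \<le> norm_F r * norm_F s"
  unfolding norm_F_eq by (rule inner_F.abs_le_sqrt)

lemma norm_F_axpy_le:
  "r \<in> F_full \<Longrightarrow> s \<in> F_full \<Longrightarrow> norm_F (axpy_F t s r) \<le> norm_F r + \<bar>t\<bar> * norm_F s"
  unfolding norm_F_eq by (rule inner_F.sqrt_axpy_le)

subsection \<open>Completeness\<close>

text \<open>L1 is dominated by L2 because the cube has measure one: the variance of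
  \<open>\<bar>r l x\<bar>\<close> is nonnegative.\<close>

lemma integral_le_norm_F:
  assumes "r \<in> F_full"
  shows "(LINT x|unit_cube. \<bar>r l x\<bar>) \<le> norm_F r"
    and "(LINT x|unit_cube. (r l x)\<^sup>2) \<le> (norm_F r)\<^sup>2"
proof -
  have "(LINT x|unit_cube. (r l x)\<^sup>2) \<le> (\<Sum>l\<in>UNIV. LINT x|unit_cube. (r l x)\<^sup>2)"
    by (rule member_le_sum) auto
  then show *: "(LINT x|unit_cube. (r l x)\<^sup>2) \<le> (norm_F r)\<^sup>2"
    unfolding norm_F_square inner_F_eq by (simp add: power2_eq_square)
  have i: "integrable unit_cube (\<lambda>x. \<bar>r l x\<bar>)"
    using integrable_mult_of_square_integrable[of "r l" unit_cube "\<lambda>_. 1"] assms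
    by (simp add: F_full_iff)
  have "0 \<le> unit_cube.variance (\<lambda>x. \<bar>r l x\<bar>)"
    by (rule unit_cube.variance_positive)
  also have "\<dots> = (LINT x|unit_cube. \<bar>r l x\<bar>\<^sup>2) - (LINT x|unit_cube. \<bar>r l x\<bar>)\<^sup>2"
    by (rule unit_cube.variance_eq) (use i assms in \<open>auto simp: F_full_iff\<close>)
  finally have "(LINT x|unit_cube. \<bar>r l x\<bar>)\<^sup>2 \<le> (norm_F r)\<^sup>2"
    using * by (simp only: power2_abs)
  then show "(LINT x|unit_cube. \<bar>r l x\<bar>) \<le> norm_F r"
    by (rule power2_le_imp_le) simp
qed

lemma integrable_F_full: "r \<in> F_full \<Longrightarrow> integrable unit_cube (r l)"
  using integrable_mult_of_square_integrable[of "r l" unit_cube "\<lambda>_. 1"] by (simp add: F_full_iff)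

lemma diff_F_full: "r \<in> F_full \<Longrightarrow> s \<in> F_full \<Longrightarrow> diff_F r s \<in> F_full"
  by (simp add: diff_F_eq_axpy axpy_F_full)

text \<open>One subsequence has to work for all d + 1 components. Packing them into a vector-valued
  function reduces this to a single L1-Cauchy sequence.\<close>

lemma Cauchy_F_converges_AE_subseq:
  fixes r :: "nat \<Rightarrow> 'd::finite field"
  assumes r: "\<And>i. r i \<in> F_full"
    and Cauchy: "\<And>e. e > 0 \<Longrightarrow> \<exists>N. \<forall>i\<ge>N. \<forall>j\<ge>N. norm_F (diff_F (r i) (r j)) < e"
  obtains \<phi> where "strict_mono (\<phi> :: nat \<Rightarrow> nat)"
    "\<And>l. AE x in unit_cube. convergent (\<lambda>i. r (\<phi> i) l x)"
proof -
  define s where "s i x = (\<Sum>l\<in>UNIV. r i l x *\<^sub>R axis l (1 :: real))" for i x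
  have s_nth: "s i x $ l = r i l x" for i x l
    by (simp add: s_def axis_def if_distrib[of "\<lambda>u. _ * u"] cong: if_cong)
  have s_int: "integrable unit_cube (s i)" for i
    unfolding s_def by (intro Bochner_Integration.integrable_sum integrable_scaleR_left integrable_F_full r)
  have bound: "(LINT x|unit_cube. norm (s i x - s j x)) \<le> real CARD('d option) * norm_F (diff_F (r i) (r j))" for i j
  proof -
    have d: "diff_F (r i) (r j) \<in> F_full" by (simp add: diff_F_full r)
    have "(LINT x|unit_cube. norm (s i x - s j x)) \<le> (LINT x|unit_cube. (\<Sum>l\<in>UNIV. \<bar>diff_F (r i) (r j) l x\<bar>))"
    proof (rule integral_mono)
      show "integrable unit_cube (\<lambda>x. norm (s i x - s j x))" using s_int by simp
      show "integrable unit_cube (\<lambda>x. \<Sum>l\<in>UNIV. \<bar>diff_F (r i) (r j) l x\<bar>)"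
        using integrable_F_full[OF d] by simp
      show "norm (s i x - s j x) \<le> (\<Sum>l\<in>UNIV. \<bar>diff_F (r i) (r j) l x\<bar>)" for x
        using norm_le_l1_cart[of "s i x - s j x"] by (simp add: s_nth diff_F_def)
    qed
    also have "\<dots> = (\<Sum>l\<in>UNIV. LINT x|unit_cube. \<bar>diff_F (r i) (r j) l x\<bar>)"
      using integrable_F_full[OF d] by simp
    also have "\<dots> \<le> (\<Sum>l\<in>(UNIV :: 'd option set). norm_F (diff_F (r i) (r j)))"
      by (intro sum_mono integral_le_norm_F d)
    finally show ?thesis by simp
  qed
  have "\<exists>N. \<forall>i\<ge>N. \<forall>j\<ge>N. (LINT x|unit_cube. norm (s i x - s j x)) < e" if "e > 0" for e
  proof -
    have pos: "real CARD('d option) > 0" by simp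
    obtain N where N: "\<forall>i\<ge>N. \<forall>j\<ge>N. norm_F (diff_F (r i) (r j)) < e / real CARD('d option)"
      using Cauchy[of "e / real CARD('d option)"] \<open>e > 0\<close> pos by (meson divide_pos_pos)
    have "(LINT x|unit_cube. norm (s i x - s j x)) < e" if "i \<ge> N" "j \<ge> N" for i j
    proof -
      have "norm_F (diff_F (r i) (r j)) < e / real CARD('d option)" using N that by blast
      then have "real CARD('d option) * norm_F (diff_F (r i) (r j)) < e"
        using pos by (metis mult.commute pos_less_divide_eq)
      then show ?thesis using bound[of i j] by linarith
    qed
    then show ?thesis by blast
  qed
  from cauchy_L1_AE_cauchy_subseq[OF s_int this]
  obtain \<phi> where \<phi>: "strict_mono (\<phi> :: nat \<Rightarrow> nat)" "AE x in unit_cube. Cauchy (\<lambda>i. s (\<phi> i) x)"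
    by metis
  have "AE x in unit_cube. convergent (\<lambda>i. r (\<phi> i) l x)" for l
    using \<phi>(2)
  proof (rule AE_mp, intro AE_I2 impI)
    fix x assume "Cauchy (\<lambda>i. s (\<phi> i) x)"
    then obtain L where "(\<lambda>i. s (\<phi> i) x) \<longlonglongrightarrow> L"
      using Cauchy_convergent_iff convergent_def by blast
    from tendsto_vec_nth[OF this, of l] show "convergent (\<lambda>i. r (\<phi> i) l x)"
      unfolding s_nth convergent_def by blast
  qed
  with \<phi>(1) show ?thesis by (rule that)
qed

text \<open>Riesz-Fischer. The almost everywhere convergent subsequence is part of the conclusion
  because additivity of a limit is recovered pointwise, not from norm convergence.\<close>

lemma F_full_complete:
  fixes r :: "nat \<Rightarrow> 'd::finite field"
  assumes r: "\<And>i. r i \<in> F_full"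
    and Cauchy: "\<And>e. e > 0 \<Longrightarrow> \<exists>N. \<forall>i\<ge>N. \<forall>j\<ge>N. norm_F (diff_F (r i) (r j)) < e"
  obtains q \<phi> where "q \<in> F_full" "(\<lambda>i. norm_F (diff_F (r i) q)) \<longlonglongrightarrow> 0"
    "strict_mono (\<phi> :: nat \<Rightarrow> nat)" "\<And>l. AE x in unit_cube. (\<lambda>i. r (\<phi> i) l x) \<longlonglongrightarrow> q l x"
proof -
  obtain \<phi> where \<phi>: "strict_mono (\<phi> :: nat \<Rightarrow> nat)"
    and conv: "\<And>l. AE x in unit_cube. convergent (\<lambda>i. r (\<phi> i) l x)"
    using Cauchy_F_converges_AE_subseq[OF r Cauchy] by blast
  define q where "q l x = lim (\<lambda>i. r (\<phi> i) l x)" for l x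
  have lim: "AE x in unit_cube. (\<lambda>i. r (\<phi> i) l x) \<longlonglongrightarrow> q l x" for l
    using conv[of l] by (rule AE_mp) (simp add: q_def convergent_LIMSEQ_iff)
  have meas_r [measurable]: "r i l \<in> borel_measurable unit_cube" for i l
    using r by (simp add: F_full_iff)
  have meas_q [measurable]: "q l \<in> borel_measurable unit_cube" for l
    unfolding q_def by (rule borel_measurable_lim_metric) simp
  have small: "integrable unit_cube (\<lambda>x. (r i l x - q l x)\<^sup>2) \<and> (LINT x|unit_cube. (r i l x - q l x)\<^sup>2) \<le> e\<^sup>2"
    if "i \<ge> N" and N: "\<forall>i\<ge>N. \<forall>j\<ge>N. norm_F (diff_F (r i) (r j)) < e" and "e > 0" for N i l e
  proof -
    have "(\<integral>\<^sup>+x. ennreal ((r i l x - q l x)\<^sup>2) \<partial>unit_cube) =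
        (\<integral>\<^sup>+x. liminf (\<lambda>k. ennreal ((r i l x - r (\<phi> k) l x)\<^sup>2)) \<partial>unit_cube)"
    proof (rule nn_integral_cong_AE, rule AE_mp[OF lim[of l]], intro AE_I2 impI)
      fix x assume "(\<lambda>i. r (\<phi> i) l x) \<longlonglongrightarrow> q l x"
      then have "(\<lambda>k. ennreal ((r i l x - r (\<phi> k) l x)\<^sup>2)) \<longlonglongrightarrow> ennreal ((r i l x - q l x)\<^sup>2)"
        by (intro tendsto_ennrealI tendsto_intros)
      then show "ennreal ((r i l x - q l x)\<^sup>2) = liminf (\<lambda>k. ennreal ((r i l x - r (\<phi> k) l x)\<^sup>2))"
        by (metis lim_imp_Liminf trivial_limit_sequentially)
    qed
    \<comment> \<open>Fatou's lemma turns the Cauchy estimate between \<open>r i\<close> and later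
      members of the subsequence into an estimate against the limit.\<close>
    also have "\<dots> \<le> liminf (\<lambda>k. \<integral>\<^sup>+x. ennreal ((r i l x - r (\<phi> k) l x)\<^sup>2) \<partial>unit_cube)"
      by (rule nn_integral_liminf) measurable
    also have "\<dots> \<le> ennreal (e\<^sup>2)"
    proof (rule Liminf_le)
      show "sequentially \<noteq> bot" by simp
      have "(\<integral>\<^sup>+x. ennreal ((r i l x - r (\<phi> k) l x)\<^sup>2) \<partial>unit_cube) \<le> ennreal (e\<^sup>2)" if "k \<ge> N" for k
      proof -
        have d: "diff_F (r i) (r (\<phi> k)) \<in> F_full" by (simp add: diff_F_full r)
        have "\<phi> k \<ge> N" using seq_suble[OF \<phi>, of k] that by linarith
        then have "norm_F (diff_F (r i) (r (\<phi> k))) < e" using N \<open>i \<ge> N\<close> by blast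
        then have le: "(norm_F (diff_F (r i) (r (\<phi> k))))\<^sup>2 \<le> e\<^sup>2"
          by (intro power_mono) auto
        have "(\<integral>\<^sup>+x. ennreal ((r i l x - r (\<phi> k) l x)\<^sup>2) \<partial>unit_cube) =
            ennreal (LINT x|unit_cube. (diff_F (r i) (r (\<phi> k)) l x)\<^sup>2)"
          using d by (subst nn_integral_eq_integral) (auto simp: F_full_iff diff_F_def)
        also have "\<dots> \<le> ennreal (e\<^sup>2)"
          using integral_le_norm_F(2)[OF d, of l] le by (intro ennreal_leI) linarith
        finally show ?thesis .
      qed
      then show "\<forall>\<^sub>F k in sequentially. (\<integral>\<^sup>+x. ennreal ((r i l x - r (\<phi> k) l x)\<^sup>2) \<partial>unit_cube) \<le> ennreal (e\<^sup>2)"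
        by (rule eventually_sequentiallyI)
    qed
    finally have fin: "(\<integral>\<^sup>+x. ennreal ((r i l x - q l x)\<^sup>2) \<partial>unit_cube) \<le> ennreal (e\<^sup>2)" .
    have int: "integrable unit_cube (\<lambda>x. (r i l x - q l x)\<^sup>2)"
      by (rule integrableI_nonneg) (use fin in \<open>auto simp: le_less_trans\<close>)
    moreover have "(LINT x|unit_cube. (r i l x - q l x)\<^sup>2) \<le> e\<^sup>2"
      using fin int by (simp add: nn_integral_eq_integral)
    ultimately show ?thesis ..
  qed
  obtain N0 where N0: "\<forall>i\<ge>N0. \<forall>j\<ge>N0. norm_F (diff_F (r i) (r j)) < 1"
    using Cauchy[of 1] by auto
  \<comment> \<open>Square integrability of \<open>q\<close> comes from writing it as
    \<open>r N0\<close> minus this difference.\<close>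
  have "diff_F (r N0) q \<in> F_full"
    using small[OF order_refl N0] by (auto simp: F_full_iff diff_F_def)
  then have "diff_F (r N0) (diff_F (r N0) q) \<in> F_full" by (rule diff_F_full[OF r])
  then have q: "q \<in> F_full" by (simp add: diff_F_def)
  have "(\<lambda>i. norm_F (diff_F (r i) q)) \<longlonglongrightarrow> 0"
  proof (rule LIMSEQ_I)
    fix e :: real assume "e > 0"
    define c where "c = real CARD('d option)"
    have c: "c \<ge> 1" unfolding c_def by simp
    \<comment> \<open>Each of the \<open>c\<close> components contributes at most the square of
      \<open>e'\<close>, and c <= c^2 since c >= 1; the extra factor 2 gives the strict
      inequality.\<close>
    define e' where "e' = e / (2 * c)"
    have e': "e' > 0" using \<open>e > 0\<close> c by (simp add: e'_def)
    obtain N where N: "\<forall>i\<ge>N. \<forall>j\<ge>N. norm_F (diff_F (r i) (r j)) < e'"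
      using Cauchy[OF e'] by auto
    have "norm (norm_F (diff_F (r i) q) - 0) < e" if "i \<ge> N" for i
    proof -
      have "(norm_F (diff_F (r i) q))\<^sup>2 = (\<Sum>l\<in>UNIV. LINT x|unit_cube. (r i l x - q l x)\<^sup>2)"
        unfolding norm_F_square inner_F_eq by (simp add: diff_F_def power2_eq_square)
      also have "\<dots> \<le> (\<Sum>l\<in>(UNIV :: 'd option set). e'\<^sup>2)"
        by (intro sum_mono) (use small[OF that N e'] in blast)
      also have "\<dots> = c * e'\<^sup>2" by (simp add: c_def)
      also have "\<dots> \<le> (c * e')\<^sup>2"
        using mult_right_mono[of 1 c "c * e'\<^sup>2"] c
        by (simp add: power2_eq_square algebra_simps)
      finally have "norm_F (diff_F (r i) q) \<le> c * e'"
        using c e' by (intro power2_le_imp_le[of "norm_F (diff_F (r i) q)" "c * e'"]) auto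
      also have "\<dots> < e" using c \<open>e > 0\<close> by (simp add: e'_def)
      finally show ?thesis by simp
    qed
    then show "\<exists>no. \<forall>n\<ge>no. norm (norm_F (diff_F (r n) q) - 0) < e" by blast
  qed
  with q \<phi> lim show ?thesis by (intro that)
qed

subsection \<open>Additive functions are closed under limits\<close>

definition subst_coord :: "'d::finite \<Rightarrow> real ^ 'd \<Rightarrow> real \<Rightarrow> real ^ 'd" where
  "subst_coord k y t = (\<chi> j. if j = k then t else y $ j)"

lemma subst_coord_nth [simp]: "subst_coord k y t $ j = (if j = k then t else y $ j)"
  by (simp add: subst_coord_def)

lemma mem_unit_cbox_cart: "x \<in> cbox 0 (1 :: real ^ 'd::finite) \<longleftrightarrow> (\<forall>k. 0 \<le> x $ k \<and> x $ k \<le> 1)"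
  by (simp add: mem_box_cart)

lemma subst_coord_unit_cube: "x \<in> cbox 0 1 \<Longrightarrow> y \<in> cbox 0 1 \<Longrightarrow> subst_coord k y (x $ k) \<in> cbox 0 1"
  by (simp add: mem_unit_cbox_cart)

lemma continuous_subst_coord [continuous_intros]:
  assumes "continuous_on S u" "continuous_on S g"
  shows "continuous_on S (\<lambda>p. subst_coord k (u p) (g p))"
  unfolding subst_coord_def
proof (rule continuous_on_vec_lambda)
  show "continuous_on S (\<lambda>p. if j = k then g p else u p $ j)" for j
    using assms by (cases "j = k") (auto intro!: continuous_intros)
qed

text \<open>Exchanging one coordinate of two points is a linear involution of \<open>\<real>\<^sup>d \<times> \<real>\<^sup>d\<close>, hence
  maps null sets to null sets.\<close>

lemma AE_subst_coord:
  fixes P :: "real ^ 'd::finite \<Rightarrow> bool"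
  assumes "AE x in lborel. P x"
  shows "AE y in lborel. AE x in lborel. P (subst_coord k y (x $ k))"
proof -
  define S :: "(real ^ 'd) \<times> (real ^ 'd) \<Rightarrow> (real ^ 'd) \<times> (real ^ 'd)"
    where "S = (\<lambda>p. (subst_coord k (fst p) (snd p $ k), subst_coord k (snd p) (fst p $ k)))"
  have S_S: "S (S p) = p" for p
    by (auto simp: S_def vec_eq_iff prod_eq_iff)
  have lin: "linear S"
    by (rule linearI) (auto simp: S_def prod_eq_iff vec_eq_iff)
  obtain N where N: "N \<in> null_sets lborel" "{x. \<not> P x} \<subseteq> N"
    using assms unfolding eventually_ae_filter by auto
  have "N \<times> UNIV \<in> null_sets (lborel \<Otimes>\<^sub>M lborel :: ((real ^ 'd) \<times> (real ^ 'd)) measure)"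
    using N(1) lborel.emeasure_pair_measure_Times[of N lborel UNIV]
    by (auto simp: null_sets_def)
  then have "negligible (N \<times> (UNIV :: (real ^ 'd) set))"
    by (simp add: negligible_iff_null_sets null_sets_completionI lborel_prod)
  then have "negligible (S ` (N \<times> UNIV))"
    by (rule negligible_differentiable_image_negligible[OF order_refl])
      (use lin in \<open>simp add: linear_imp_differentiable_on\<close>)
  then have "S ` (N \<times> UNIV) \<in> null_sets (completion lborel)"
    by (simp add: negligible_iff_null_sets)
  then have "AE p in completion lborel. p \<notin> S ` (N \<times> UNIV)"
    by (rule AE_not_in)
  then have "AE p in (lborel \<Otimes>\<^sub>M lborel). p \<notin> S ` (N \<times> UNIV)"
    unfolding AE_completion_iff lborel_prod .
  then have "AE p in (lborel \<Otimes>\<^sub>M lborel). P (fst (S p))"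
  proof (rule AE_mp, intro AE_I2, intro impI)
    fix p assume "p \<in> space (lborel \<Otimes>\<^sub>M lborel)" "p \<notin> S ` (N \<times> UNIV)"
    then have "S p \<notin> N \<times> UNIV" using S_S[of p] by (metis imageI)
    then show "P (fst (S p))" using N(2) by (auto simp: mem_Times_iff)
  qed
  then have "AE y in lborel. AE x in lborel. P (fst (S (y, x)))"
    by (rule lborel_pair.AE_pair)
  then show ?thesis by (simp add: S_def)
qed

lemma AE_unit_cube_iff: "(AE x in unit_cube. P x) \<longleftrightarrow> (AE x in lborel. x \<in> cbox 0 1 \<longrightarrow> P x)"
  unfolding unit_cube_def by (rule AE_restrict_space_iff) simp

lemma AE_unit_cube_subst_coord:
  fixes P :: "real ^ 'd::finite \<Rightarrow> bool"
  assumes "AE x in unit_cube. P x"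
  shows "AE y in unit_cube. AE x in unit_cube. P (subst_coord k y (x $ k))"
proof -
  have "AE y in lborel. AE x in lborel. subst_coord k y (x $ k) \<in> cbox 0 1 \<longrightarrow> P (subst_coord k y (x $ k))"
    by (rule AE_subst_coord) (use assms in \<open>simp add: AE_unit_cube_iff\<close>)
  then show ?thesis
    unfolding AE_unit_cube_iff
  proof (rule AE_mp, intro AE_I2, intro impI)
    fix y assume *: "AE x in lborel. subst_coord k y (x $ k) \<in> cbox 0 1 \<longrightarrow> P (subst_coord k y (x $ k))"
      and y: "y \<in> cbox 0 1"
    show "AE x in lborel. x \<in> cbox 0 1 \<longrightarrow> P (subst_coord k y (x $ k))"
      by (rule AE_mp[OF *]) (use y in \<open>auto intro: subst_coord_unit_cube\<close>)
  qed
qed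

lemma subst_coord_measurable_unit_cube:
  assumes "y \<in> cbox 0 1" "u \<in> borel_measurable unit_cube"
  shows "(\<lambda>x. u (subst_coord k y (x $ k))) \<in> borel_measurable unit_cube"
proof -
  have "(\<lambda>x. subst_coord k y (x $ k)) \<in> borel_measurable borel"
    by (intro borel_measurable_continuous_onI continuous_intros)
  then have "(\<lambda>x. subst_coord k y (x $ k)) \<in> measurable unit_cube borel" by (rule borel_measurable_unit_cubeI)
  then have "(\<lambda>x. subst_coord k y (x $ k)) \<in> measurable unit_cube (restrict_space borel (cbox 0 1))"
    using assms(1) by (intro measurable_restrict_space2) (auto intro: subst_coord_unit_cube)
  then have "(\<lambda>x. subst_coord k y (x $ k)) \<in> measurable unit_cube unit_cube"
    by (simp cong: measurable_cong_sets add: sets_unit_cube)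
  from measurable_comp[OF this assms(2)] show ?thesis by (simp add: o_def)
qed

text \<open>Values on the axis-parallel lines through one base point \<open>y\<close> determine an
  additive function: the d line values add up to u(x) + (d - 1) u(y), and the surplus is spread
  evenly over the summands. The components \<open>m\<close> do not occur on the right, so the
  identity survives pointwise limits.\<close>

lemma additive_eq_subst_coord:
  fixes u :: "real ^ 'd::finite \<Rightarrow> real"
  assumes "\<And>x. x \<in> cbox 0 1 \<Longrightarrow> u x = (\<Sum>k\<in>UNIV. m k (x $ k))" "x \<in> cbox 0 1" "y \<in> cbox 0 1"
  shows "u x = (\<Sum>k\<in>UNIV. u (subst_coord k y (x $ k)) - (1 - 1 / real CARD('d)) * u y)"
proof -
  have "u (subst_coord k y (x $ k)) = u y - m k (y $ k) + m k (x $ k)" for k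
  proof -
    have "u (subst_coord k y (x $ k)) = (\<Sum>j\<in>UNIV. m j (subst_coord k y (x $ k) $ j))"
      by (rule assms(1)) (use assms in \<open>simp add: subst_coord_unit_cube\<close>)
    also have "\<dots> = m k (x $ k) + (\<Sum>j\<in>UNIV - {k}. m j (y $ j))"
      by (subst sum.remove[of _ k]) auto
    also have "(\<Sum>j\<in>UNIV - {k}. m j (y $ j)) = u y - m k (y $ k)"
      using assms(1)[OF assms(3)] by (simp add: sum_diff1)
    finally show ?thesis by simp
  qed
  then have "(\<Sum>k\<in>UNIV. u (subst_coord k y (x $ k)) - (1 - 1 / real CARD('d)) * u y)
      = (\<Sum>k\<in>UNIV. m k (x $ k)) - (\<Sum>k\<in>UNIV. m k (y $ k)) + u y"
    by (simp add: sum.distrib sum_subtractf left_diff_distrib right_diff_distrib)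
  then show ?thesis using assms by simp
qed

lemma F_full_cong_AE:
  assumes "q \<in> F_full" "\<And>l. q' l \<in> borel_measurable unit_cube" "\<And>l. AE x in unit_cube. q' l x = q l x"
  shows "q' \<in> F_full" "norm_F (diff_F q' q) = 0"
proof -
  have "integrable unit_cube (\<lambda>x. (q' l x)\<^sup>2)" for l
  proof (subst integrable_cong_AE[where g = "\<lambda>x. (q l x)\<^sup>2"])
    show "AE x in unit_cube. (q' l x)\<^sup>2 = (q l x)\<^sup>2"
      using assms(3)[of l] by (rule AE_mp) simp
  qed (use assms in \<open>auto simp: F_full_iff\<close>)
  then show "q' \<in> F_full" using assms by (simp add: F_full_iff)
  have "(LINT x|unit_cube. (q' l x - q l x) * (q' l x - q l x)) = 0" for l
  proof -
    have "AE x in unit_cube. (q' l x - q l x) * (q' l x - q l x) = 0"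
      using assms(3)[of l] by (rule AE_mp) simp
    then show ?thesis by (rule integral_eq_zero_AE)
  qed
  then show "norm_F (diff_F q' q) = 0"
    by (simp add: norm_F_eq inner_F_eq diff_F_def)
qed

text \<open>An almost everywhere limit need not be additive at every point. The representative
  \<open>q'\<close> is rebuilt from the values of \<open>q\<close> on the coordinate lines through
  one base point \<open>y\<close>, chosen by Fubini such that convergence holds at \<open>y\<close>
  and at almost every point of each line.\<close>

lemma F_add_closed_AE:
  fixes r :: "nat \<Rightarrow> 'd::finite field"
  assumes r: "\<And>i. r i \<in> F_add" and q: "q \<in> F_full"
    and lim: "\<And>l. AE x in unit_cube. (\<lambda>i. r i l x) \<longlonglongrightarrow> q l x"
  obtains q' where "q' \<in> F_add" "norm_F (diff_F q' q) = 0"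
proof -
  define conv where "conv l x \<longleftrightarrow> (\<lambda>i. r i l x) \<longlonglongrightarrow> q l x" for l x
  have "AE y in unit_cube. \<forall>l. conv l y \<and> (\<forall>k. AE x in unit_cube. conv l (subst_coord k y (x $ k)))"
    using lim unfolding conv_def[symmetric]
    by (intro AE_all_countable[THEN iffD2] allI AE_conjI AE_unit_cube_subst_coord) auto
  moreover have "AE y in unit_cube. y \<in> cbox 0 (1 :: real ^ 'd)" by (rule AE_I2) simp
  ultimately have "AE y in unit_cube. y \<in> cbox 0 1 \<and>
      (\<forall>l. conv l y \<and> (\<forall>k. AE x in unit_cube. conv l (subst_coord k y (x $ k))))"
    by (rule AE_conjI[rotated])
  from eventually_happens'[OF unit_cube.ae_filter_bot this]
  obtain y where y: "y \<in> cbox 0 1" and conv_y: "\<And>l. conv l y"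
    and conv_s: "\<And>l k. AE x in unit_cube. conv l (subst_coord k y (x $ k))"
    by (elim exE conjE) (rule that, blast+)
  \<comment> \<open>This has additive form at every point, whatever the values of \<open>q\<close>
    are; agreement with \<open>q\<close> is needed only almost everywhere.\<close>
  define q' where "q' l x = (case l of
      None \<Rightarrow> \<Sum>k\<in>UNIV. q None (subst_coord k y (x $ k)) - (1 - 1 / real CARD('d)) * q None y
    | Some k \<Rightarrow> q (Some k) (subst_coord k y (x $ k)))" for l x
  have r_None: "r i None x = (\<Sum>k\<in>UNIV. r i None (subst_coord k y (x $ k)) - (1 - 1 / real CARD('d)) * r i None y)"
    if x: "x \<in> cbox 0 1" for i x
  proof -
    obtain m where "\<And>x. x \<in> cbox 0 1 \<Longrightarrow> r i None x = (\<Sum>k\<in>UNIV. m k (x $ k))"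
      using r[of i] unfolding F_add_def by blast
    from additive_eq_subst_coord[of "r i None", OF this x y] show ?thesis .
  qed
  have r_Some: "r i (Some k) x = r i (Some k) (subst_coord k y (x $ k))" if x: "x \<in> cbox 0 1" for i k x
  proof -
    obtain g where "\<forall>x \<in> cbox 0 1. r i (Some k) x = g (x $ k)" using r[of i] unfolding F_add_def by blast
    then show ?thesis using x subst_coord_unit_cube[OF x y] by simp
  qed
  have ae: "AE x in unit_cube. q' l x = q l x" for l
  proof (cases l)
    case None
    have "AE x in unit_cube. \<forall>k. conv None (subst_coord k y (x $ k))"
      using conv_s by (intro AE_all_countable[THEN iffD2]) auto
    moreover have "AE x in unit_cube. conv None x" using lim by (simp add: conv_def)
    ultimately show ?thesis
    proof (rule AE_mp[OF AE_conjI], intro AE_I2, intro impI)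
      fix x assume x: "x \<in> space unit_cube"
        and c: "(\<forall>k. conv None (subst_coord k y (x $ k))) \<and> conv None x"
      have "(\<lambda>i. \<Sum>k\<in>UNIV. r i None (subst_coord k y (x $ k)) - (1 - 1 / real CARD('d)) * r i None y)
          \<longlonglongrightarrow> q' None x"
        unfolding q'_def option.case using c conv_y[of None]
        by (intro tendsto_intros) (auto simp: conv_def)
      then have "(\<lambda>i. r i None x) \<longlonglongrightarrow> q' None x"
        using x by (subst r_None) auto
      then show "q' l x = q l x" using c None unfolding conv_def by (auto intro: LIMSEQ_unique)
    qed
  next
    case (Some k)
    have "AE x in unit_cube. conv l x" using lim by (simp add: conv_def)
    with conv_s[of l k] show ?thesis
    proof (rule AE_mp[OF AE_conjI], intro AE_I2, intro impI)
      fix x assume x: "x \<in> space unit_cube"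
        and c: "conv l (subst_coord k y (x $ k)) \<and> conv l x"
      then show "q' l x = q l x"
        using r_Some[of x _ k] Some unfolding conv_def q'_def by (auto intro: LIMSEQ_unique)
    qed
  qed
  have q'_None: "q' None = (\<lambda>x. \<Sum>k\<in>UNIV. q None (subst_coord k y (x $ k)) - (1 - 1 / real CARD('d)) * q None y)"
    and q'_Some: "q' (Some k) = (\<lambda>x. q (Some k) (subst_coord k y (x $ k)))" for k
    by (simp_all add: q'_def fun_eq_iff)
  have meas: "q' l \<in> borel_measurable unit_cube" for l
  proof -
    have *: "(\<lambda>x. q l (subst_coord k y (x $ k))) \<in> borel_measurable unit_cube" for l k
      by (rule subst_coord_measurable_unit_cube[OF y]) (use q in \<open>simp add: F_full_iff\<close>)
    show ?thesis
    proof (cases l)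
      case None
      show ?thesis unfolding None q'_None
        by (rule borel_measurable_sum, rule borel_measurable_diff, rule *, rule borel_measurable_const)
    next
      case (Some k)
      show ?thesis unfolding Some q'_Some by (rule *)
    qed
  qed
  note q' = F_full_cong_AE[OF q meas ae]
  have "q' \<in> F_add"
    unfolding F_add_def
  proof (intro CollectI conjI allI)
    show "\<exists>m. \<forall>x\<in>cbox 0 1. q' None x = (\<Sum>k\<in>UNIV. m k (x $ k))"
      by (rule exI[of _ "\<lambda>k t. q None (subst_coord k y t) - (1 - 1 / real CARD('d)) * q None y"]) (simp add: q'_def)
    show "\<exists>g. \<forall>x\<in>cbox 0 1. q' (Some k) x = g (x $ k)" for k
      by (rule exI[of _ "\<lambda>t. q (Some k) (subst_coord k y t)"]) (simp add: q'_def)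
  qed (rule q')
  then show ?thesis using q'(2) by (rule that)
qed

subsection \<open>Minimizing coercive quadratic functionals\<close>

text \<open>Closedness is phrased through almost everywhere limits, and up to a tuple of norm zero,
  since tuples are functions rather than classes. It covers both domains of minimization.\<close>

definition closed_subspace_F :: "'d::finite field set \<Rightarrow> bool" where
  "closed_subspace_F V \<longleftrightarrow> V \<subseteq> F_full \<and> V \<noteq> {} \<and> (\<forall>r\<in>V. \<forall>s\<in>V. \<forall>t. axpy_F t s r \<in> V) \<and>
     (\<forall>r q. (\<forall>i::nat. r i \<in> V) \<longrightarrow> q \<in> F_full \<longrightarrow> (\<forall>l. AE x in unit_cube. (\<lambda>i. r i l x) \<longlonglongrightarrow> q l x) \<longrightarrow>
        (\<exists>q'\<in>V. norm_F (diff_F q' q) = 0))"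

lemma norm_F_diff_self [simp]: "norm_F (diff_F q q) = 0"
  by (simp add: norm_F_eq inner_F_eq diff_F_def)

lemma closed_subspace_F_full: "closed_subspace_F F_full"
  unfolding closed_subspace_F_def
  using axpy_F_full zero_F_add F_add_subset norm_F_diff_self by blast

lemma closed_subspace_F_add: "closed_subspace_F F_add"
proof -
  have "\<exists>q'\<in>F_add. norm_F (diff_F q' q) = 0"
    if "\<forall>i::nat. r i \<in> F_add" "q \<in> F_full" "\<forall>l. AE x in unit_cube. (\<lambda>i. r i l x) \<longlonglongrightarrow> q l x" for r and q :: "'a field"
    using F_add_closed_AE[of r q] that by blast
  then show ?thesis
    unfolding closed_subspace_F_def
    using axpy_F_add zero_F_add F_add_subset by blast
qed

text \<open>The Lax-Milgram setting: \<open>c\<close> and \<open>C\<close> are the ellipticity and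
  continuity constants of the form, and \<open>G\<close> bounds the linear functional.\<close>

locale quadratic_F = form_F F_full B for B :: "'d::finite field \<Rightarrow> 'd field \<Rightarrow> real" +
  fixes L :: "'d::finite field \<Rightarrow> real" and c C G :: real
  assumes c_pos: "0 < c"
    and coercive: "r \<in> F_full \<Longrightarrow> c * (norm_F r)\<^sup>2 \<le> B r r"
    and bounded: "r \<in> F_full \<Longrightarrow> B r r \<le> C * (norm_F r)\<^sup>2"
    and linear: "r \<in> F_full \<Longrightarrow> s \<in> F_full \<Longrightarrow> L (axpy_F t s r) = L r + t * L s"
    and L_bounded: "r \<in> F_full \<Longrightarrow> \<bar>L r\<bar> \<le> G * norm_F r"
    and C_nonneg: "0 \<le> C"
begin

definition J :: "'d field \<Rightarrow> real" where
  "J r = B r r - 2 * L r"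

lemma J_axpy:
  assumes "r \<in> F_full" "s \<in> F_full"
  shows "J (axpy_F t s r) = J r + 2 * t * (B r s - L s) + t\<^sup>2 * B s s"
  using assms by (simp add: J_def quadratic_axpy linear algebra_simps)

lemma form_bounded:
  assumes "r \<in> F_full" "s \<in> F_full"
  shows "\<bar>B r s\<bar> \<le> C * (norm_F r * norm_F s)"
proof -
  have "sqrt (B r r) \<le> sqrt C * norm_F r" if "r \<in> F_full" for r
    using real_sqrt_le_mono[OF bounded[OF that]] by (simp add: real_sqrt_mult)
  then have "sqrt (B r r) * sqrt (B s s) \<le> (sqrt C * norm_F r) * (sqrt C * norm_F s)"
    using assms C_nonneg by (intro mult_mono) (auto simp: nonneg)
  also have "\<dots> = C * (norm_F r * norm_F s)" using C_nonneg by simp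
  finally show ?thesis using abs_le_sqrt[OF assms] by linarith
qed

lemma J_lower_bound:
  assumes "r \<in> F_full"
  shows "- G\<^sup>2 / c \<le> J r"
proof -
  have "0 \<le> (c * norm_F r - G)\<^sup>2 / c" using c_pos by simp
  also have "\<dots> = c * (norm_F r)\<^sup>2 - 2 * (G * norm_F r) + G\<^sup>2 / c"
    using c_pos by (simp add: power2_diff field_simps power2_eq_square)
  also have "\<dots> \<le> J r + G\<^sup>2 / c"
    using coercive[OF assms] L_bounded[OF assms] unfolding J_def by linarith
  finally show ?thesis by simp
qed

text \<open>The parallelogram identity. It makes minimizing sequences Cauchy: two nearly minimal
  elements of a subspace have their midpoint in the subspace, where \<open>J\<close> cannot be much
  smaller.\<close>

lemma J_midpoint:
  assumes "r \<in> F_full" "s \<in> F_full"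
  shows "B (diff_F s r) (diff_F s r) = 2 * J r + 2 * J s - 4 * J (axpy_F (1/2) (diff_F s r) r)"
proof -
  have d: "diff_F s r \<in> F_full" using assms by (simp add: diff_F_full)
  have s: "s = axpy_F 1 (diff_F s r) r" by (simp add: axpy_F_def diff_F_def)
  have m1: "J s = J r + 2 * (B r (diff_F s r) - L (diff_F s r)) + B (diff_F s r) (diff_F s r)"
    using J_axpy[OF assms(1) d, of 1] s by simp
  have m2: "J (axpy_F (1/2) (diff_F s r) r) =
      J r + (B r (diff_F s r) - L (diff_F s r)) + 1/4 * B (diff_F s r) (diff_F s r)"
    using J_axpy[OF assms(1) d, of "1/2"] by (simp add: power2_eq_square)
  show ?thesis unfolding m1 m2 by (simp add: algebra_simps)
qed

text \<open>If the slope \<open>g\<close> in direction \<open>s\<close> were nonzero, a step of size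
  \<open>g / b\<close> against it would lower \<open>J\<close> by at least g^2 / b. The constant
  \<open>k\<close> allows for criteria that equal \<open>J\<close> up to a term free of the
  argument.\<close>

lemma variational_equation:
  assumes V: "closed_subspace_F V" and min: "is_arg_min (\<lambda>r. k + J r) (\<lambda>r. r \<in> V) r" and s: "s \<in> V"
  shows "B r s = L s"
proof (rule ccontr)
  assume ne: "B r s \<noteq> L s"
  have r: "r \<in> V" using min by (simp add: is_arg_min_def)
  have rs: "r \<in> F_full" "s \<in> F_full" using r s V by (auto simp: closed_subspace_F_def)
  define g where "g = B r s - L s"
  \<comment> \<open>The summand 1 keeps \<open>b\<close> positive in a degenerate direction with
    \<open>B s s = 0\<close>.\<close>
  define b where "b = B s s + 1"
  have b: "b > 0" using nonneg[OF rs(2)] by (simp add: b_def)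
  have "J (axpy_F (- g / b) s r) = J r - 2 * (g / b) * g + (g / b)\<^sup>2 * B s s"
    using J_axpy[OF rs, of "- g / b"] unfolding g_def[symmetric] by simp
  also have "\<dots> \<le> J r - 2 * (g / b) * g + (g / b)\<^sup>2 * b"
    by (simp add: b_def mult_left_mono)
  also have "\<dots> = J r - g\<^sup>2 / b" using b by (simp add: field_simps power2_eq_square)
  also have "\<dots> < J r" using b ne by (simp add: g_def)
  finally have "J (axpy_F (- g / b) s r) < J r" .
  moreover have "axpy_F (- g / b) s r \<in> V" using V r s by (simp add: closed_subspace_F_def)
  ultimately show False using min by (fastforce simp: is_arg_min_def)
qed

lemma minimizer_exists:
  assumes V: "closed_subspace_F V"
  obtains q where "is_arg_min (\<lambda>r. k + J r) (\<lambda>r. r \<in> V) q"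
proof -
  have sub: "r \<in> F_full" if "r \<in> V" for r using that V by (auto simp: closed_subspace_F_def)
  have bdd: "bdd_below (J ` V)" using J_lower_bound sub by (intro bdd_belowI2) auto
  define I where "I = Inf (J ` V)"
  have le: "I \<le> J r" if "r \<in> V" for r unfolding I_def using bdd that by (rule cINF_lower)
  have "\<exists>r\<in>V. J r < I + 1 / real (Suc i)" for i
  proof -
    have "Inf (J ` V) < I + 1 / real (Suc i)" by (simp add: I_def)
    then show ?thesis using V bdd by (subst (asm) cINF_less_iff) (auto simp: closed_subspace_F_def)
  qed
  then obtain r where r: "\<And>i. r i \<in> V" "\<And>i. J (r i) < I + 1 / real (Suc i)" by metis
  note rF = sub[OF r(1)]
  have diff: "c * (norm_F (diff_F (r i) (r j)))\<^sup>2 < 2 / real (Suc i) + 2 / real (Suc j)" for i j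
  proof -
    have "diff_F (r i) (r j) \<in> V" using V r(1) by (simp add: closed_subspace_F_def diff_F_eq_axpy)
    then have "axpy_F (1/2) (diff_F (r i) (r j)) (r j) \<in> V" using V r(1) by (simp add: closed_subspace_F_def)
    from le[OF this] have "B (diff_F (r i) (r j)) (diff_F (r i) (r j)) < 2 / real (Suc i) + 2 / real (Suc j)"
      using J_midpoint[of "r j" "r i", OF rF rF] r(2)[of i] r(2)[of j]
        mult_2[of "1 / real (Suc i)"] mult_2[of "1 / real (Suc j)"] by (simp only: times_divide_eq_right mult_1_right)
    then show ?thesis using coercive[OF diff_F_full[OF rF rF], of i j] by linarith
  qed
  have Cauchy: "\<exists>N. \<forall>i\<ge>N. \<forall>j\<ge>N. norm_F (diff_F (r i) (r j)) < e" if "e > 0" for e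
  proof -
    obtain N where N: "4 / (c * e\<^sup>2) < real N" using reals_Archimedean2 by blast
    have "norm_F (diff_F (r i) (r j)) < e" if "i \<ge> N" "j \<ge> N" for i j
    proof -
      have N0: "real N > 0" using N c_pos \<open>e > 0\<close> by (smt (verit) divide_nonneg_nonneg mult_nonneg_nonneg zero_le_power2)
      have "2 / real (Suc i) \<le> 2 / real N" "2 / real (Suc j) \<le> 2 / real N"
        using that N0 by (auto intro!: divide_left_mono mult_pos_pos)
      then have "c * (norm_F (diff_F (r i) (r j)))\<^sup>2 < 4 / real N"
        using diff[of i j] by simp
      also have "\<dots> < c * e\<^sup>2"
        using N N0 c_pos \<open>e > 0\<close> by (simp add: field_simps)
      finally have "(norm_F (diff_F (r i) (r j)))\<^sup>2 < e\<^sup>2" using c_pos by simp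
      then show ?thesis using \<open>e > 0\<close> by (intro power2_less_imp_less[of _ e]) auto
    qed
    then show ?thesis by blast
  qed
  obtain q \<phi> where q: "q \<in> F_full" "(\<lambda>i. norm_F (diff_F (r i) q)) \<longlonglongrightarrow> 0"
    and \<phi>: "strict_mono (\<phi> :: nat \<Rightarrow> nat)" "\<And>l. AE x in unit_cube. (\<lambda>i. r (\<phi> i) l x) \<longlonglongrightarrow> q l x"
    by (rule F_full_complete[OF rF Cauchy], assumption) (rule that)
  have "\<exists>q'\<in>V. norm_F (diff_F q' q) = 0"
    using V[unfolded closed_subspace_F_def, THEN conjunct2, THEN conjunct2, THEN conjunct2, rule_format, of "\<lambda>i. r (\<phi> i)" q]
      r(1) q(1) \<phi>(2) by blast
  then obtain q' where q': "q' \<in> V" "norm_F (diff_F q' q) = 0" by blast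
  note q'F = sub[OF q'(1)]
  define d where "d i = diff_F q' (r i)" for i
  have dF: "d i \<in> F_full" for i by (simp add: d_def diff_F_full q'F rF)
  have norm_d: "norm_F (d i) \<le> norm_F (diff_F (r i) q)" for i
  proof -
    have "d i = axpy_F (- 1) (diff_F (r i) q) (diff_F q' q)"
      by (simp add: d_def axpy_F_def diff_F_def)
    then show ?thesis
      using norm_F_axpy_le[OF diff_F_full[OF q'F q(1)] diff_F_full[OF rF q(1)], of "- 1" i] q'(2) by simp
  qed
  \<comment> \<open>Expanding \<open>J\<close> at \<open>q'\<close> leaves a nonnegative square that
    is dropped, so only terms linear in the distance remain, and these vanish in the limit.\<close>
  have J_q': "J q' \<le> J (r i) + (2 * C * norm_F q' + 2 * G) * norm_F (d i)" for i
  proof -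
    have "r i = axpy_F (- 1) (d i) q'" by (simp add: d_def axpy_F_def diff_F_def)
    then have "J (r i) = J q' - 2 * (B q' (d i) - L (d i)) + B (d i) (d i)"
      using J_axpy[OF q'F dF, of "- 1" i] by simp
    moreover have "\<bar>B q' (d i)\<bar> \<le> C * (norm_F q' * norm_F (d i))" by (rule form_bounded[OF q'F dF])
    moreover have "\<bar>L (d i)\<bar> \<le> G * norm_F (d i)" by (rule L_bounded[OF dF])
    ultimately show ?thesis using nonneg[OF dF, of i] by (simp add: algebra_simps)
  qed
  have d0: "(\<lambda>i. norm_F (d i)) \<longlonglongrightarrow> 0"
    by (rule tendsto_sandwich[OF _ _ tendsto_const q(2)]) (auto simp: norm_d)
  have "(\<lambda>i. I + 1 / real (Suc i) + (2 * C * norm_F q' + 2 * G) * norm_F (d i)) \<longlonglongrightarrow> I + 0 + (2 * C * norm_F q' + 2 * G) * 0"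
    by (intro tendsto_add tendsto_mult tendsto_const d0 LIMSEQ_Suc[OF lim_1_over_n])
  moreover have "J q' \<le> I + 1 / real (Suc i) + (2 * C * norm_F q' + 2 * G) * norm_F (d i)" for i
    using J_q'[of i] r(2)[of i] by linarith
  ultimately have "J q' \<le> I" by (intro LIMSEQ_le_const) auto
  then have "is_arg_min (\<lambda>r. k + J r) (\<lambda>r. r \<in> V) q'"
    using q'(1) le by (fastforce simp: is_arg_min_def)
  then show ?thesis by (rule that)
qed

end

subsection \<open>The projection and the penalty\<close>

definition is_proj_add :: "'d::finite field \<Rightarrow> 'd field \<Rightarrow> bool" where
  "is_proj_add r p \<longleftrightarrow> p \<in> F_add \<and> (\<forall>q \<in> F_add. inner_F (diff_F r p) q = 0)"

lemma inner_F_diff: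
  assumes "r \<in> F_full" "s \<in> F_full" "q \<in> F_full"
  shows "inner_F (diff_F r s) q = inner_F r q - inner_F s q"
  using inner_F_axpy[OF assms, of "- 1"] by (simp add: diff_F_eq_axpy)

text \<open>Up to a constant, \<open>J\<close> is here the squared distance to \<open>r\<close>, so
  its minimizer over \<open>F_add\<close> is an orthogonal projection. Existence is what makes the
  choice in \<open>P_add\<close> meaningful.\<close>

lemma is_proj_add_P_add:
  assumes r: "r \<in> F_full"
  shows "is_proj_add r (P_add r)"
proof -
  interpret quadratic_F inner_F "inner_F r" 1 1 "norm_F r"
    using r by unfold_locales
      (auto simp: norm_F_square inner_F.axpy_right intro: inner_F_le_norm)
  obtain p where p: "is_arg_min (\<lambda>r. 0 + J r) (\<lambda>r. r \<in> F_add) p"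
    by (rule minimizer_exists[OF closed_subspace_F_add])
  then have "p \<in> F_add" by (simp add: is_arg_min_def)
  moreover have "inner_F (diff_F r p) q = 0" if "q \<in> F_add" for q
    using variational_equation[OF closed_subspace_F_add p that] that \<open>p \<in> F_add\<close> r
    by (simp add: inner_F_diff F_add_subset)
  ultimately have "p \<in> F_add \<and> (\<forall>q \<in> F_add. inner_F (diff_F r p) q = 0)" by blast
  then show ?thesis unfolding is_proj_add_def P_add_def
    by (rule someI[where P = "\<lambda>p. p \<in> F_add \<and> (\<forall>q \<in> F_add. inner_F (diff_F r p) q = 0)"])
qed

lemma P_add_F_add: "r \<in> F_full \<Longrightarrow> P_add r \<in> F_add"
  using is_proj_add_P_add by (auto simp: is_proj_add_def)

definition res_F :: "'d::finite field \<Rightarrow> 'd field" where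
  "res_F r = diff_F r (P_add r)"

lemma res_F_full: "r \<in> F_full \<Longrightarrow> res_F r \<in> F_full"
  by (simp add: res_F_def diff_F_full P_add_F_add F_add_subset)

lemma inner_res_F_add: "r \<in> F_full \<Longrightarrow> q \<in> F_add \<Longrightarrow> inner_F (res_F r) q = 0"
  using is_proj_add_P_add by (auto simp: is_proj_add_def res_F_def)

text \<open>\<open>P_add\<close> picks representatives by choice and is therefore not visibly
  linear. Removing one residual by orthogonality exhibits the penalty form as
  \<open>inner_F r (res_F s)\<close>, which is linear in \<open>r\<close>; symmetry gives the other
  argument.\<close>

lemma inner_res_F_res_F:
  assumes "r \<in> F_full" "s \<in> F_full"
  shows "inner_F (res_F r) (res_F s) = inner_F r (res_F s)"
proof -
  have "inner_F (res_F r) (res_F s) = inner_F r (res_F s) - inner_F (P_add r) (res_F s)"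
    unfolding res_F_def[of r] using assms by (simp add: inner_F_diff res_F_full P_add_F_add F_add_subset)
  also have "inner_F (P_add r) (res_F s) = 0"
    using inner_res_F_add[OF assms(2) P_add_F_add[OF assms(1)]] by (simp add: inner_F_commute)
  finally show ?thesis by simp
qed

lemma inner_res_F_le:
  assumes "r \<in> F_full" shows "inner_F (res_F r) (res_F r) \<le> (norm_F r)\<^sup>2"
proof -
  have "(norm_F (res_F r))\<^sup>2 \<le> norm_F r * norm_F (res_F r)"
    using inner_F_le_norm[OF assms res_F_full[OF assms]] inner_res_F_res_F[OF assms assms]
    by (simp add: norm_F_square)
  then have "norm_F (res_F r) \<le> norm_F r"
    unfolding power2_eq_square
    by (metis mult_le_cancel_right norm_F_nonneg less_eq_real_def not_le)
  then show ?thesis using norm_F_square[of "res_F r"] by (metis norm_F_nonneg power_mono)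
qed

interpretation penalty: form_F "F_full :: 'd::finite field set" "\<lambda>r s. inner_F (res_F r) (res_F s)"
proof
  fix r s q :: "'d field" and t
  assume rs: "r \<in> F_full" "s \<in> F_full"
  then show "axpy_F t s r \<in> F_full" by (rule axpy_F_full)
  assume "q \<in> F_full"
  with rs show "inner_F (res_F (axpy_F t s r)) (res_F q) = inner_F (res_F r) (res_F q) + t * inner_F (res_F s) (res_F q)"
    by (simp add: axpy_F_full inner_res_F_res_F inner_F_axpy res_F_full)
qed (rule inner_F_commute inner_F_nonneg)+

lemma res_F_of_F_add:
  assumes "r \<in> F_add" "s \<in> F_full"
  shows "inner_F (res_F r) (res_F s) = 0"
  using inner_res_F_res_F[of r s] inner_res_F_add[of s r] assms
  by (simp add: F_add_subset inner_F_commute)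

subsection \<open>Comparison of the two minimizers\<close>

text \<open>
  Testing the equation for \<open>\<delta>\<close> with \<open>s = \<delta>\<close> bounds \<open>(I - P) \<delta>\<close>; testing it with \<open>s = P \<delta>\<close>
  then bounds \<open>P \<delta>\<close>.
\<close>

lemma (in quadratic_F) penalized_minimizer_close:
  assumes R: "R > 0" and \<Gamma>: "\<Gamma> \<ge> 0"
    and ra: "ra \<in> F_add" "\<And>s. s \<in> F_add \<Longrightarrow> B ra s = L s"
    and rR: "rR \<in> F_full" "\<And>s. s \<in> F_full \<Longrightarrow> B rR s + R * inner_F (res_F rR) (res_F s) = L s"
    and approx: "r0 \<in> F_add" "\<And>s. s \<in> F_full \<Longrightarrow> \<bar>L s - B r0 s\<bar> \<le> \<Gamma> * norm_F s"
  shows "norm_F (diff_F rR ra) \<le> (1 + C / c)\<^sup>2 * \<Gamma> / R"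
proof -
  have coercive_le: "norm_F r \<le> u / c" if "r \<in> F_full" "B r r \<le> u * norm_F r" "0 \<le> u" for r u
  proof (cases "norm_F r = 0")
    case False
    have "c * norm_F r * norm_F r \<le> u * norm_F r"
      using coercive[OF that(1)] that(2) by (simp add: power2_eq_square mult.assoc)
    then have "c * norm_F r \<le> u" using False norm_F_nonneg[of r] by (auto simp: mult_le_cancel_right)
    then show ?thesis using c_pos by (simp add: field_simps)
  qed (use that c_pos in simp)
  note raF = F_add_subset[OF ra(1)] and r0F = F_add_subset[OF approx(1)]
  \<comment> \<open>The additive estimator is within \<open>\<Gamma> / c\<close> of
    \<open>r0\<close>; this transfers the gradient bound from \<open>r0\<close> to \<open>ra\<close>
    at the price of the first factor 1 + C / c.\<close>
  define e where "e = diff_F ra r0"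
  have eA: "e \<in> F_add" using ra(1) approx(1) by (simp add: e_def diff_F_eq_axpy axpy_F_add)
  note eF = F_add_subset[OF eA]
  have B_e: "B e s = B ra s - B r0 s" if "s \<in> F_full" for s
    using axpy[OF raF r0F that, of "- 1"] by (simp add: e_def diff_F_eq_axpy)
  have "B e e \<le> \<Gamma> * norm_F e" using B_e[OF eF] ra(2)[OF eA] approx(2)[OF eF] by linarith
  then have norm_e: "norm_F e \<le> \<Gamma> / c" using coercive_le[OF eF] \<Gamma> by blast
  define g where "g s = L s - B ra s" for s
  define \<Gamma>' where "\<Gamma>' = (1 + C / c) * \<Gamma>"
  have \<Gamma>': "\<Gamma>' \<ge> 0" using \<Gamma> C_nonneg c_pos by (simp add: \<Gamma>'_def)
  have g_bound: "\<bar>g s\<bar> \<le> \<Gamma>' * norm_F s" if s: "s \<in> F_full" for s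
  proof -
    have "C * (norm_F e * norm_F s) \<le> C * (\<Gamma> / c * norm_F s)"
      using norm_e C_nonneg by (intro mult_left_mono mult_right_mono) auto
    then have "\<bar>B e s\<bar> \<le> C / c * \<Gamma> * norm_F s"
      using form_bounded[OF eF s] by (simp add: mult.assoc)
    then show ?thesis
      using approx(2)[OF s] B_e[OF s] by (simp add: g_def \<Gamma>'_def algebra_simps)
  qed
  define \<delta> where "\<delta> = diff_F rR ra"
  have \<delta>: "\<delta> \<in> F_full" by (simp add: \<delta>_def diff_F_full rR(1) raF)
  have eq: "B \<delta> s + R * inner_F (res_F \<delta>) (res_F s) = g s" if s: "s \<in> F_full" for s
  proof -
    have "B \<delta> s = B rR s - B ra s"
      using axpy[OF rR(1) raF s, of "- 1"] by (simp add: \<delta>_def diff_F_eq_axpy)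
    moreover have "inner_F (res_F \<delta>) (res_F s) = inner_F (res_F rR) (res_F s)"
      using penalty.axpy[OF rR(1) raF s, of "- 1"] res_F_of_F_add[OF ra(1) s] by (simp add: \<delta>_def diff_F_eq_axpy)
    ultimately show ?thesis using rR(2)[OF s] by (simp add: g_def)
  qed
  define w where "w = res_F \<delta>"
  define p where "p = P_add \<delta>"
  have w: "w \<in> F_full" by (simp add: w_def res_F_full \<delta>)
  have pA: "p \<in> F_add" by (simp add: p_def P_add_F_add \<delta>)
  note p = F_add_subset[OF pA]
  have g_p: "g p = 0" using ra(2)[OF pA] by (simp add: g_def)
  have \<delta>_eq: "\<delta> = axpy_F 1 w p" by (simp add: w_def p_def res_F_def axpy_F_def diff_F_def)
  have w_eq: "w = axpy_F (- 1) p \<delta>" by (simp add: w_def p_def res_F_def diff_F_eq_axpy)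
  \<comment> \<open>Since \<open>g\<close> vanishes on \<open>F_add\<close>, only the residual part
    \<open>w\<close> is seen: the right-hand side is linear in the norm of \<open>w\<close>, the
    penalty is quadratic in it, and division yields the factor 1 / R.\<close>
  have "g \<delta> = g p + g w"
    using linear[OF p w, of 1] axpy_right[OF p w raF, of 1] \<delta>_eq by (simp add: g_def)
  then have "R * (norm_F w)\<^sup>2 \<le> \<Gamma>' * norm_F w"
    using eq[OF \<delta>] nonneg[OF \<delta>] g_p g_bound[OF w] by (simp add: norm_F_square w_def)
  then have norm_w: "norm_F w \<le> \<Gamma>' / R"
  proof (cases "norm_F w = 0")
    case False
    assume "R * (norm_F w)\<^sup>2 \<le> \<Gamma>' * norm_F w"
    then have "R * norm_F w * norm_F w \<le> \<Gamma>' * norm_F w" by (simp add: power2_eq_square mult.assoc)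
    then have "R * norm_F w \<le> \<Gamma>'" using False norm_F_nonneg[of w] by (auto simp: mult_le_cancel_right)
    then show ?thesis using R by (simp add: field_simps)
  qed (use \<Gamma>' R in simp)
  have "inner_F (res_F \<delta>) (res_F p) = 0"
    using res_F_of_F_add[OF pA \<delta>] by (simp add: inner_F_commute)
  \<comment> \<open>Penalty and \<open>g\<close> both vanish on \<open>p\<close>, so
    \<open>\<delta>\<close> is \<open>B\<close>-orthogonal to it and \<open>p\<close> is controlled
    by \<open>w\<close>; this costs the second factor 1 + C / c.\<close>
  then have "B \<delta> p = 0" using eq[OF p] g_p by simp
  then have "B p p = - B w p"
    using axpy[OF p w p, of 1] \<delta>_eq by simp
  then have "B p p \<le> C * norm_F w * norm_F p"
    using form_bounded[OF w p] by (simp add: mult.assoc)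
  then have norm_p: "norm_F p \<le> C * norm_F w / c"
    using coercive_le[OF p, of "C * norm_F w"] C_nonneg by simp
  have "norm_F \<delta> \<le> norm_F p + norm_F w"
    using norm_F_axpy_le[OF p w, of 1] \<delta>_eq by simp
  also have "\<dots> \<le> (1 + C / c) * norm_F w" using norm_p by (simp add: algebra_simps)
  also have "\<dots> \<le> (1 + C / c) * (\<Gamma>' / R)"
    using norm_w C_nonneg c_pos by (intro mult_left_mono) auto
  also have "\<dots> = (1 + C / c)\<^sup>2 * \<Gamma> / R" by (simp add: \<Gamma>'_def power2_eq_square)
  finally show ?thesis by (simp add: \<delta>_def)
qed

subsection \<open>The local linear criterion as a quadratic functional\<close>

lemma sum_UNIV_option: "(\<Sum>l\<in>(UNIV :: 'd::finite option set). g l) = g None + (\<Sum>k\<in>UNIV. g (Some k))"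
  by (simp add: UNIV_option_conv sum.reindex o_def)

definition design :: "real ^ 'd::finite \<Rightarrow> real ^ 'd \<Rightarrow> 'd option \<Rightarrow> real ^ 'd \<Rightarrow> real" where
  "design h X l x = (case l of None \<Rightarrow> 1 | Some k \<Rightarrow> (X $ k - x $ k) / h $ k)"

definition local_fit :: "real ^ 'd::finite \<Rightarrow> real ^ 'd \<Rightarrow> 'd field \<Rightarrow> real ^ 'd \<Rightarrow> real" where
  "local_fit h X r x = (\<Sum>l\<in>UNIV. r l x * design h X l x)"

lemma local_fit_eq: "local_fit h X r x = r None x + (\<Sum>k\<in>UNIV. r (Some k) x * ((X $ k - x $ k) / h $ k))"
  by (simp add: local_fit_def design_def sum_UNIV_option)

lemma local_fit_axpy: "local_fit h X (axpy_F t s r) x = local_fit h X r x + t * local_fit h X s x"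
  by (simp add: local_fit_def axpy_F_def distrib_right sum.distrib sum_distrib_left mult.assoc)

section \<open>Square-integrable functions and bounded multipliers\<close>

definition L2 :: "(real ^ 'd::finite \<Rightarrow> real) \<Rightarrow> bool" where
  "L2 u \<longleftrightarrow> u \<in> borel_measurable unit_cube \<and> integrable unit_cube (\<lambda>x. (u x)\<^sup>2)"

lemma F_full_iff_L2: "r \<in> F_full \<longleftrightarrow> (\<forall>l. L2 (r l))"
  by (simp add: F_full_iff L2_def)

lemma L2_add: assumes "L2 u" "L2 v" shows "L2 (\<lambda>x. u x + v x)"
proof -
  have "integrable unit_cube (\<lambda>x. (u x)\<^sup>2 + 2 * (u x * v x) + (v x)\<^sup>2)"
    using assms integrable_mult_of_square_integrable[of u unit_cube v] by (simp add: L2_def)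
  then have "integrable unit_cube (\<lambda>x. (u x + v x)\<^sup>2)" by (simp add: power2_sum algebra_simps)
  moreover have "(\<lambda>x. u x + v x) \<in> borel_measurable unit_cube"
    using assms by (intro borel_measurable_add) (auto simp: L2_def)
  ultimately show ?thesis by (simp add: L2_def)
qed

lemma L2_sum: "(\<And>i. i \<in> I \<Longrightarrow> L2 (u i)) \<Longrightarrow> L2 (\<lambda>x. \<Sum>i\<in>I. u i x)"
proof (induction I rule: infinite_finite_induct)
  case (insert i I)
  then have "L2 (\<lambda>x. u i x + (\<Sum>i\<in>I. u i x))" by (intro L2_add) auto
  then show ?case using insert by simp
qed (auto simp: L2_def)

lemma L2_mult_integrable: "L2 u \<Longrightarrow> L2 v \<Longrightarrow> integrable unit_cube (\<lambda>x. u x * v x)"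
  by (simp add: L2_def integrable_mult_of_square_integrable)

definition bounded_measurable :: "(real ^ 'd::finite \<Rightarrow> real) \<Rightarrow> bool" where
  "bounded_measurable w \<longleftrightarrow> w \<in> borel_measurable unit_cube \<and> (\<exists>B. \<forall>x\<in>cbox 0 1. \<bar>w x\<bar> \<le> B)"

lemma bounded_measurable_mult:
  assumes "bounded_measurable u" "bounded_measurable v"
  shows "bounded_measurable (\<lambda>x. u x * v x)"
proof -
  obtain B B' where "\<forall>x\<in>cbox 0 1. \<bar>u x\<bar> \<le> B" "\<forall>x\<in>cbox 0 1. \<bar>v x\<bar> \<le> B'"
    using assms by (auto simp: bounded_measurable_def)
  then have "\<forall>x\<in>cbox 0 1. \<bar>u x * v x\<bar> \<le> \<bar>B\<bar> * \<bar>B'\<bar>"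
    by (fastforce simp: abs_mult intro!: mult_mono)
  then show ?thesis using assms by (auto simp: bounded_measurable_def)
qed

lemma integrable_mult_bounded_measurable:
  assumes "integrable unit_cube u" "bounded_measurable w"
  shows "integrable unit_cube (\<lambda>x. u x * w x)"
proof -
  obtain B where B: "\<forall>x\<in>cbox 0 1. \<bar>w x\<bar> \<le> B" using assms by (auto simp: bounded_measurable_def)
  show ?thesis
  proof (rule Bochner_Integration.integrable_bound)
    show "integrable unit_cube (\<lambda>x. \<bar>B\<bar> * u x)" using assms by simp
    show "AE x in unit_cube. norm (u x * w x) \<le> norm (\<bar>B\<bar> * u x)"
    proof (rule AE_I2)
      fix x assume "x \<in> space (unit_cube :: (real ^ 'a) measure)"
      then have "\<bar>w x\<bar> \<le> \<bar>B\<bar>" using B by fastforce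
      then show "norm (u x * w x) \<le> norm (\<bar>B\<bar> * u x)"
        using mult_left_mono[of "\<bar>w x\<bar>" "\<bar>B\<bar>" "\<bar>u x\<bar>"] by (simp add: abs_mult mult.commute)
    qed
  qed (use assms in \<open>auto simp: bounded_measurable_def\<close>)
qed

lemma L2_mult_bounded:
  assumes "L2 u" "bounded_measurable w" shows "L2 (\<lambda>x. u x * w x)"
proof -
  have "integrable unit_cube (\<lambda>x. (u x)\<^sup>2 * (w x * w x))"
    using assms by (intro integrable_mult_bounded_measurable bounded_measurable_mult) (auto simp: L2_def)
  then show ?thesis
    using assms by (auto simp: L2_def bounded_measurable_def power2_eq_square mult_ac)
qed

lemma bounded_measurable_L2: assumes "bounded_measurable w" shows "L2 w"
  using L2_mult_bounded[OF _ assms, of "\<lambda>_. 1"] by (simp add: L2_def)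

lemma bounded_measurable_continuous:
  assumes "continuous_on UNIV w" shows "bounded_measurable w"
proof -
  have "compact (w ` cbox 0 1)"
    using assms by (intro compact_continuous_image) (auto intro: continuous_on_subset)
  then obtain B where "\<forall>y\<in>w ` cbox 0 1. norm y \<le> B"
    using compact_imp_bounded bounded_iff by metis
  then show ?thesis
    using assms by (auto simp: bounded_measurable_def intro!: borel_measurable_unit_cubeI borel_measurable_continuous_onI)
qed

lemma bounded_measurable_design: "bounded_measurable (design h X l)"
proof (rule bounded_measurable_continuous)
  have "design h X l = (case l of None \<Rightarrow> \<lambda>x. 1 | Some k \<Rightarrow> \<lambda>x. (X $ k - x $ k) * inverse (h $ k))"
    by (auto simp: design_def divide_inverse split: option.split)
  then show "continuous_on UNIV (design h X l)"
    by (cases l) (auto intro!: continuous_intros)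
qed

text \<open>The normalizing integrals depend on \<open>X\<close> and \<open>h\<close> but not on
  \<open>x\<close>, so they act as constants; written as multiplication by an inverse, continuity in
  \<open>x\<close> holds even if one of them is zero.\<close>

lemma bounded_measurable_K_h:
  assumes "continuous_on UNIV K"
  shows "bounded_measurable (K_h K h X)"
proof (rule bounded_measurable_continuous)
  have "continuous_on UNIV (\<lambda>x :: real ^ 'a. K ((X $ k - x $ k) * inverse (h $ k)))" for k
    by (rule continuous_on_compose2[OF assms]) (auto intro!: continuous_intros)
  then show "continuous_on UNIV (K_h K h X)"
    unfolding K_h_def by (auto simp: divide_inverse intro!: continuous_intros)
qed

lemma L2_local_fit: "r \<in> F_full \<Longrightarrow> L2 (local_fit h X r)"
  unfolding local_fit_def
  by (intro L2_sum L2_mult_bounded bounded_measurable_design) (simp add: F_full_iff_L2)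

section \<open>The quadratic criterion of a fixed sample\<close>

locale sample =
  fixes K :: "real \<Rightarrow> real" and h :: "real ^ 'd::finite" and n :: nat
    and X :: "nat \<Rightarrow> real ^ 'd" and Y :: "nat \<Rightarrow> real"
  assumes K_cont: "continuous_on UNIV K"
begin

definition gram :: "'d field \<Rightarrow> 'd field \<Rightarrow> real" where
  "gram r s = (LINT x|unit_cube. 1 / real n * (\<Sum>i<n. local_fit h (X i) r x * local_fit h (X i) s x * K_h K h (X i) x))"

text \<open>The Riesz representative of minus half the derivative of \<open>Q\<close> at
  \<open>r\<close>. Having it as a tuple of functions lets its norm bound the gradient
  functional.\<close>

definition score :: "'d field \<Rightarrow> 'd field" where
  "score r = (\<lambda>l x. 1 / real n * (\<Sum>i<n. (Y i - local_fit h (X i) r x) * design h (X i) l x * K_h K h (X i) x))"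

lemma gram_integrable:
  "r \<in> F_full \<Longrightarrow> s \<in> F_full \<Longrightarrow>
   integrable unit_cube (\<lambda>x. 1 / real n * (\<Sum>i<n. local_fit h (X i) r x * local_fit h (X i) s x * K_h K h (X i) x))"
  by (intro integrable_mult_right Bochner_Integration.integrable_sum integrable_mult_bounded_measurable
      L2_mult_integrable L2_local_fit bounded_measurable_K_h K_cont)

lemma score_F_full: assumes "r \<in> F_full" shows "score r \<in> F_full"
proof -
  have const: "bounded_measurable (\<lambda>_. a)" for a :: real by (auto simp: bounded_measurable_def)
  have "L2 (\<lambda>x. Y i + local_fit h (X i) r x * (- 1))" for i
    by (intro L2_add[OF bounded_measurable_L2 L2_mult_bounded] const L2_local_fit assms)
  then have "L2 (\<lambda>x. \<Sum>i<n. (Y i + local_fit h (X i) r x * (- 1)) * design h (X i) l x * K_h K h (X i) x)" for l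
    by (intro L2_sum L2_mult_bounded bounded_measurable_design bounded_measurable_K_h K_cont)
  then have "L2 (\<lambda>x. (\<Sum>i<n. (Y i + local_fit h (X i) r x * (- 1)) * design h (X i) l x * K_h K h (X i) x) * (1 / real n))" for l
    by (rule L2_mult_bounded) (auto simp: bounded_measurable_def)
  then show ?thesis
    by (simp add: F_full_iff_L2 score_def mult.commute[of "1 / real n"])
qed

lemma inner_score:
  "(\<Sum>l\<in>UNIV. score r l x * s l x) =
    1 / real n * (\<Sum>i<n. (Y i - local_fit h (X i) r x) * local_fit h (X i) s x * K_h K h (X i) x)"
proof -
  have "(\<Sum>l\<in>UNIV. score r l x * s l x) =
    (\<Sum>l\<in>UNIV. \<Sum>i<n. 1 / real n * ((Y i - local_fit h (X i) r x) * (s l x * design h (X i) l x) * K_h K h (X i) x))"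
    by (simp add: score_def sum_distrib_left sum_distrib_right algebra_simps)
  also have "\<dots> = (\<Sum>i<n. \<Sum>l\<in>UNIV. 1 / real n * ((Y i - local_fit h (X i) r x) * (s l x * design h (X i) l x) * K_h K h (X i) x))"
    by (rule sum.swap)
  also have "\<dots> = 1 / real n * (\<Sum>i<n. (Y i - local_fit h (X i) r x) * local_fit h (X i) s x * K_h K h (X i) x)"
    unfolding local_fit_def[of h _ s] by (simp add: sum_distrib_left sum_distrib_right algebra_simps)
  finally show ?thesis .
qed

lemma inner_F_score:
  assumes "r \<in> F_full" "s \<in> F_full"
  shows "inner_F (score r) s =
    (LINT x|unit_cube. 1 / real n * (\<Sum>i<n. (Y i - local_fit h (X i) r x) * local_fit h (X i) s x * K_h K h (X i) x))"
proof -
  have "inner_F (score r) s = (LINT x|unit_cube. (\<Sum>l\<in>UNIV. score r l x * s l x))"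
    unfolding inner_F_eq
    using integrable_mult_F_full[OF score_F_full[OF assms(1)] assms(2)]
    by (intro Bochner_Integration.integral_sum[symmetric]) auto
  then show ?thesis unfolding inner_score .
qed

lemma score_axpy:
  assumes "r \<in> F_full" "s \<in> F_full" "q \<in> F_full"
  shows "inner_F (score (axpy_F t s r)) q = inner_F (score r) q - t * gram s q"
proof -
  note i = gram_integrable[OF assms(2,3)] and j = integrable_mult_F_full[OF score_F_full[OF assms(1)] assms(3)]
  have "inner_F (score (axpy_F t s r)) q = (LINT x|unit_cube. (\<Sum>l\<in>UNIV. score r l x * q l x) -
      t * (1 / real n * (\<Sum>i<n. local_fit h (X i) s x * local_fit h (X i) q x * K_h K h (X i) x)))"
    unfolding inner_F_score[OF axpy_F_full[OF assms(1,2)] assms(3)] inner_score local_fit_axpy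
    by (simp add: sum_distrib_left sum_subtractf[symmetric] algebra_simps)
  also have "\<dots> = (LINT x|unit_cube. (\<Sum>l\<in>UNIV. score r l x * q l x)) - t * gram s q"
    unfolding gram_def integral_mult_right_zero[where c = t, symmetric]
    by (rule Bochner_Integration.integral_diff) (intro Bochner_Integration.integrable_sum j, rule integrable_mult_right[OF i])
  also have "(LINT x|unit_cube. (\<Sum>l\<in>UNIV. score r l x * q l x)) = inner_F (score r) q"
    unfolding inner_F_eq using j by (intro Bochner_Integration.integral_sum) auto
  finally show ?thesis .
qed

lemma gram_commute: "gram r s = gram s r"
  by (simp add: gram_def mult.commute mult.left_commute)

lemma gram_axpy:
  assumes "r \<in> F_full" "s \<in> F_full" "q \<in> F_full"
  shows "gram (axpy_F t s r) q = gram r q + t * gram s q"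
proof -
  note i = gram_integrable[OF assms(1,3)] gram_integrable[OF assms(2,3)]
  have "gram (axpy_F t s r) q = (LINT x|unit_cube.
      1 / real n * (\<Sum>i<n. local_fit h (X i) r x * local_fit h (X i) q x * K_h K h (X i) x) +
      t * (1 / real n * (\<Sum>i<n. local_fit h (X i) s x * local_fit h (X i) q x * K_h K h (X i) x)))"
    unfolding gram_def local_fit_axpy
    by (simp add: sum_distrib_left sum.distrib[symmetric] algebra_simps)
  also have "\<dots> = gram r q + t * gram s q"
    unfolding gram_def integral_mult_right_zero[where c = t, symmetric]
    by (rule Bochner_Integration.integral_add[OF i(1) integrable_mult_right[OF i(2)]])
  finally show ?thesis .
qed

definition q0 :: real where
  "q0 = (LINT x|unit_cube. 1 / real n * (\<Sum>i<n. (Y i)\<^sup>2 * K_h K h (X i) x))"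

definition lin :: "'d field \<Rightarrow> real" where
  "lin s = inner_F (score (\<lambda>_ _. 0)) s"

lemma zero_F_full: "(\<lambda>_ _. 0) \<in> F_full"
  by (rule F_add_subset[OF zero_F_add])

text \<open>The residual of the normal equation at \<open>r\<close> is the inner product of the
  score with the test tuple; at the oracle the norm of the score becomes the \<open>\<Gamma>\<close>
  of the comparison.\<close>

lemma lin_minus_gram:
  assumes "r \<in> F_full" "s \<in> F_full"
  shows "lin s - gram r s = inner_F (score r) s"
  using score_axpy[OF zero_F_full assms, of 1] by (simp add: lin_def axpy_F_def)

lemma Q_eq:
  assumes r: "r \<in> F_full"
  shows "Q K h n X Y r = q0 + (gram r r - 2 * lin r)"
proof -
  have z: "local_fit h (X i) (\<lambda>_ _. 0) x = 0" for i x by (simp add: local_fit_def)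
  have i0: "integrable unit_cube (\<lambda>x. 1 / real n * (\<Sum>i<n. (Y i)\<^sup>2 * K_h K h (X i) x))"
    by (intro integrable_mult_right Bochner_Integration.integrable_sum integrable_mult_bounded_measurable bounded_measurable_K_h K_cont) simp
  have i1: "integrable unit_cube (\<lambda>x. 1 / real n * (\<Sum>i<n. Y i * local_fit h (X i) r x * K_h K h (X i) x))"
  proof (intro integrable_mult_right Bochner_Integration.integrable_sum integrable_mult_bounded_measurable bounded_measurable_K_h K_cont)
    show "integrable unit_cube (local_fit h (X i) r)" for i
      using L2_mult_integrable[OF _ L2_local_fit[OF r], of "\<lambda>_. 1"] by (simp add: L2_def)
  qed
  note i2 = gram_integrable[OF r r]
  have "Q K h n X Y r = (LINT x|unit_cube. 1 / real n * (\<Sum>i<n. (Y i - local_fit h (X i) r x)\<^sup>2 * K_h K h (X i) x))"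
    unfolding Q_def set_lebesgue_integral_unit_cube local_fit_eq by (simp add: diff_diff_eq)
  also have "\<dots> = (LINT x|unit_cube. 1 / real n * (\<Sum>i<n. (Y i)\<^sup>2 * K_h K h (X i) x)
      + (1 / real n * (\<Sum>i<n. local_fit h (X i) r x * local_fit h (X i) r x * K_h K h (X i) x)
      - 2 * (1 / real n * (\<Sum>i<n. Y i * local_fit h (X i) r x * K_h K h (X i) x))))"
    by (rule Bochner_Integration.integral_cong)
      (simp_all add: sum_distrib_left sum.distrib[symmetric] sum_subtractf[symmetric] power2_eq_square algebra_simps)
  also have "\<dots> = q0 + (gram r r - 2 * (LINT x|unit_cube. 1 / real n * (\<Sum>i<n. Y i * local_fit h (X i) r x * K_h K h (X i) x)))"
    unfolding q0_def gram_def using i0 i1 i2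
    by (simp only: Bochner_Integration.integral_add Bochner_Integration.integral_diff
        Bochner_Integration.integrable_diff integrable_mult_right integral_mult_right_zero)
  also have "(LINT x|unit_cube. 1 / real n * (\<Sum>i<n. Y i * local_fit h (X i) r x * K_h K h (X i) x)) = lin r"
    unfolding lin_def inner_F_score[OF zero_F_full r] z by simp
  finally show ?thesis .
qed

end

text \<open>The eigenvalue bounds concern the local design matrix at every single \<open>x\<close>;
  applied to \<open>v l = r l x\<close> and integrated, they become bounds for the Gram
  form.\<close>

locale elliptic_sample = sample +
  fixes c C :: real
  assumes c_pos: "0 < c" and C_nonneg: "0 \<le> C"
    and elliptic: "\<And>x v. x \<in> cbox 0 1 \<Longrightarrow>
        c * (\<Sum>l\<in>UNIV. (v l)\<^sup>2) \<le> 1 / real n * (\<Sum>i<n. (\<Sum>l\<in>UNIV. v l * design h (X i) l x)\<^sup>2 * K_h K h (X i) x)"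
    and bounded: "\<And>x v. x \<in> cbox 0 1 \<Longrightarrow>
        1 / real n * (\<Sum>i<n. (\<Sum>l\<in>UNIV. v l * design h (X i) l x)\<^sup>2 * K_h K h (X i) x) \<le> C * (\<Sum>l\<in>UNIV. (v l)\<^sup>2)"
begin

lemma norm_F_square_eq:
  assumes "r \<in> F_full"
  shows "integrable unit_cube (\<lambda>x. k * (\<Sum>l\<in>UNIV. (r l x)\<^sup>2))"
    "(LINT x|unit_cube. k * (\<Sum>l\<in>UNIV. (r l x)\<^sup>2)) = k * (norm_F r)\<^sup>2"
  using assms unfolding norm_F_square inner_F_eq power2_eq_square[symmetric] by (simp_all add: F_full_iff)

lemma gram_bounds:
  assumes r: "r \<in> F_full"
  shows "c * (norm_F r)\<^sup>2 \<le> gram r r" "gram r r \<le> C * (norm_F r)\<^sup>2"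
proof -
  have i: "integrable unit_cube (\<lambda>x. 1 / real n * (\<Sum>i<n. (local_fit h (X i) r x)\<^sup>2 * K_h K h (X i) x))"
    using gram_integrable[OF r r] by (simp only: power2_eq_square)
  have g: "gram r r = (LINT x|unit_cube. 1 / real n * (\<Sum>i<n. (local_fit h (X i) r x)\<^sup>2 * K_h K h (X i) x))"
    by (simp only: gram_def power2_eq_square)
  show "c * (norm_F r)\<^sup>2 \<le> gram r r"
    unfolding g norm_F_square_eq(2)[OF r, symmetric]
    by (rule integral_mono[OF norm_F_square_eq(1)[OF r] i]) (use elliptic in \<open>simp add: local_fit_def\<close>)
  show "gram r r \<le> C * (norm_F r)\<^sup>2"
    unfolding g norm_F_square_eq(2)[OF r, symmetric]
    by (rule integral_mono[OF i norm_F_square_eq(1)[OF r]]) (use bounded in \<open>simp add: local_fit_def\<close>)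
qed

lemma lin_axpy: "r \<in> F_full \<Longrightarrow> s \<in> F_full \<Longrightarrow> lin (axpy_F t s r) = lin r + t * lin s"
  unfolding lin_def by (rule inner_F.axpy_right) (auto simp: score_F_full zero_F_full)

lemma lin_bounded: "r \<in> F_full \<Longrightarrow> \<bar>lin r\<bar> \<le> norm_F (score (\<lambda>_ _. 0)) * norm_F r"
  unfolding lin_def by (rule inner_F_le_norm) (auto simp: score_F_full zero_F_full)

lemma gram_nonneg: assumes "r \<in> F_full" shows "0 \<le> gram r r"
proof -
  have "0 \<le> c * (norm_F r)\<^sup>2" using c_pos by simp
  then show ?thesis using gram_bounds(1)[OF assms] by linarith
qed

sublocale quadratic_F gram lin c C "norm_F (score (\<lambda>_ _. 0))"
  by unfold_locales
    (auto intro: axpy_F_full gram_commute gram_axpy gram_nonneg c_pos gram_bounds lin_axpy lin_bounded C_nonneg)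

text \<open>The bound \<open>C + R\<close> serves to obtain a minimizer and its normal equation; it
  does not enter the rate.\<close>

lemma penalized_form:
  assumes "R > 0"
  shows "quadratic_F (\<lambda>r s. gram r s + R * inner_F (res_F r) (res_F s)) lin c (C + R) (norm_F (score (\<lambda>_ _. 0)))"
proof
  fix r s q :: "'a field" and t
  assume rs: "r \<in> F_full"
  show "0 \<le> gram r r + R * inner_F (res_F r) (res_F r)"
    using assms by (intro add_nonneg_nonneg mult_nonneg_nonneg gram_nonneg inner_F_nonneg rs) simp
  show "c * (norm_F r)\<^sup>2 \<le> gram r r + R * inner_F (res_F r) (res_F r)"
    using gram_bounds(1)[OF rs] assms inner_F_nonneg[of "res_F r"] by (simp add: add_increasing2)
  show "gram r r + R * inner_F (res_F r) (res_F r) \<le> (C + R) * (norm_F r)\<^sup>2"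
    using add_mono[OF gram_bounds(2)[OF rs] mult_left_mono[OF inner_res_F_le[OF rs], of R]] assms
    by (simp add: distrib_right)
  assume s: "s \<in> F_full"
  show "axpy_F t s r \<in> F_full" using rs s by (rule axpy_F_full)
  assume "q \<in> F_full"
  then show "gram (axpy_F t s r) q + R * inner_F (res_F (axpy_F t s r)) (res_F q) =
      gram r q + R * inner_F (res_F r) (res_F q) + t * (gram s q + R * inner_F (res_F s) (res_F q))"
    using gram_axpy[OF rs s] penalty.axpy[OF rs s] by (simp add: algebra_simps)
qed (use c_pos C_nonneg assms in \<open>auto intro: lin_axpy lin_bounded simp: gram_commute inner_F_commute\<close>)

text \<open>The conditional assumptions on \<open>ra\<close> and \<open>rR\<close> are discharged by
  the existence of minimizers of elliptic functionals. Any \<open>r0\<close> in \<open>F_add\<close>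
  is admissible; a good one makes the score small.\<close>

lemma estimators_close:
  assumes R: "R > 0" and r0: "r0 \<in> F_add"
    and ra: "\<exists>r. is_arg_min (Q K h n X Y) (\<lambda>r. r \<in> F_add) r \<Longrightarrow> is_arg_min (Q K h n X Y) (\<lambda>r. r \<in> F_add) ra"
    and rR: "\<exists>r. is_arg_min (Q_pen K h n X Y R) (\<lambda>r. r \<in> F_full) r \<Longrightarrow> is_arg_min (Q_pen K h n X Y R) (\<lambda>r. r \<in> F_full) rR"
  shows "norm_F (diff_F rR ra) \<le> (1 + C / c)\<^sup>2 * norm_F (score r0) / R"
proof -
  have cong: "is_arg_min f (\<lambda>r. r \<in> V) = is_arg_min g (\<lambda>r. r \<in> V)" if "\<And>r. r \<in> V \<Longrightarrow> f r = g r"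
    for f g :: "'a field \<Rightarrow> real" and V
    using that by (auto simp: is_arg_min_def fun_eq_iff)
  have Q_add: "is_arg_min (Q K h n X Y) (\<lambda>r. r \<in> F_add) = is_arg_min (\<lambda>r. q0 + J r) (\<lambda>r. r \<in> F_add)"
    by (rule cong) (simp add: Q_eq F_add_subset J_def)
  interpret pen: quadratic_F "\<lambda>r s. gram r s + R * inner_F (res_F r) (res_F s)" lin c "C + R" "norm_F (score (\<lambda>_ _. 0))"
    by (rule penalized_form[OF R])
  have Q_full: "is_arg_min (Q_pen K h n X Y R) (\<lambda>r. r \<in> F_full) = is_arg_min (\<lambda>r. q0 + pen.J r) (\<lambda>r. r \<in> F_full)"
    by (rule cong) (simp add: Q_pen_def Q_eq pen.J_def norm_F_square flip: res_F_def)
  have ra': "is_arg_min (\<lambda>r. q0 + J r) (\<lambda>r. r \<in> F_add) ra"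
    by (rule ra[unfolded Q_add]) (rule minimizer_exists[OF closed_subspace_F_add], blast)
  have rR': "is_arg_min (\<lambda>r. q0 + pen.J r) (\<lambda>r. r \<in> F_full) rR"
    by (rule rR[unfolded Q_full]) (rule pen.minimizer_exists[OF closed_subspace_F_full], blast)
  show ?thesis
  proof (rule penalized_minimizer_close[OF R norm_F_nonneg _ _ _ _ r0])
    show "ra \<in> F_add" "rR \<in> F_full" using ra' rR' by (auto simp: is_arg_min_def)
    show "gram ra s = lin s" if "s \<in> F_add" for s
      by (rule variational_equation[OF closed_subspace_F_add ra' that])
    show "gram rR s + R * inner_F (res_F rR) (res_F s) = lin s" if "s \<in> F_full" for s
      by (rule pen.variational_equation[OF closed_subspace_F_full rR' that])
    show "\<bar>lin s - gram r0 s\<bar> \<le> norm_F (score r0) * norm_F s" if "s \<in> F_full" for s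
      unfolding lin_minus_gram[OF F_add_subset[OF r0] that]
      by (rule inner_F_le_norm) (use that r0 in \<open>auto intro: score_F_full F_add_subset\<close>)
  qed
qed

end

subsection \<open>Kernel weights\<close>

text \<open>\<open>K\<close> may vanish near zero, so positivity is recorded on some interval from
  \<open>\<alpha>\<close> to \<open>\<beta>\<close> away from zero. Its mirror image is available by
  symmetry, which allows a choice of the side facing the interior of the cube.\<close>

locale kernel =
  fixes K :: "real \<Rightarrow> real" and C\<^sub>1 Km \<kappa> \<alpha> \<beta> :: real
  assumes K_cont: "continuous_on UNIV K"
    and K_nonneg: "K u \<ge> 0"
    and K_le: "K u \<le> Km"
    and K_sym: "K (- u) = K u"
    and K_zero: "\<bar>u\<bar> > C\<^sub>1 \<Longrightarrow> K u = 0"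
    and \<kappa>: "0 < \<kappa>" and \<alpha>: "0 < \<alpha>" and \<alpha>_less: "\<alpha> < \<beta>"
    and K_ge: "u \<in> {\<alpha>..\<beta>} \<Longrightarrow> \<kappa> \<le> K u"
begin

lemma \<beta>_le: "\<beta> \<le> C\<^sub>1"
proof (rule ccontr)
  assume "\<not> \<beta> \<le> C\<^sub>1"
  then have "K \<beta> = 0" using K_zero[of \<beta>] \<alpha> \<alpha>_less by simp
  then show False using K_ge[of \<beta>] \<alpha>_less \<kappa> by simp
qed

lemma \<beta>_pos: "0 < \<beta>" using \<alpha> \<alpha>_less by simp

lemma C\<^sub>1_pos: "0 < C\<^sub>1" using \<beta>_pos \<beta>_le by simp

lemma Km_pos: "0 < Km" using K_ge[of \<alpha>] K_le[of \<alpha>] \<alpha>_less \<kappa> by simp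

lemma K_scaled_integrable:
  assumes "hk > 0"
  shows "set_integrable lborel {0..1} (\<lambda>t. K ((x - t) / hk))"
proof -
  have "continuous_on {0..1} (\<lambda>t. K ((x - t) / hk))"
    by (rule continuous_on_compose2[OF K_cont]) (use assms in \<open>auto intro!: continuous_intros\<close>)
  then show ?thesis by (rule borel_integrable_atLeastAtMost'[unfolded atLeastAtMost_def[symmetric]])
qed

lemma mass_ge:
  assumes x: "0 \<le> x" "x \<le> 1" and hk: "hk > 0" "\<beta> * hk \<le> 1/2"
  shows "\<kappa> * (\<beta> - \<alpha>) * hk \<le> (LBINT t:{0..1}. K ((x - t) / hk))"
proof -
  \<comment> \<open>The interval lies on the side of the farther endpoint of [0, 1], where
    \<open>\<beta> * hk \<le> 1/2\<close> leaves room for it.\<close>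
  define I where "I = (if x \<ge> 1/2 then {x - \<beta> * hk..x - \<alpha> * hk} else {x + \<alpha> * hk..x + \<beta> * hk})"
  have ab: "\<alpha> * hk \<le> \<beta> * hk" "0 \<le> \<alpha> * hk" using \<alpha> \<alpha>_less hk by auto
  then have "measure lborel I = (\<beta> - \<alpha>) * hk"
    by (auto simp: I_def left_diff_distrib)
  then have m: "(LBINT t:I. \<kappa>) = \<kappa> * (\<beta> - \<alpha>) * hk"
    by (simp add: I_def set_lebesgue_integral_def)
  have sub: "I \<subseteq> {0..1}" using x hk ab by (auto simp: I_def)
  have K_I: "\<kappa> \<le> K ((x - t) / hk)" if "t \<in> I" for t
  proof (cases "x \<ge> 1/2")
    case True
    then have "(x - t) / hk \<in> {\<alpha>..\<beta>}" using that hk by (auto simp: I_def field_simps)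
    then show ?thesis by (rule K_ge)
  next
    case False
    then have "- ((x - t) / hk) \<in> {\<alpha>..\<beta>}" using that hk by (auto simp: I_def field_simps)
    then show ?thesis using K_ge K_sym by metis
  qed
  have "(LBINT t:I. \<kappa>) \<le> (LBINT t:{0..1}. K ((x - t) / hk))"
    unfolding set_lebesgue_integral_def
  proof (rule integral_mono)
    show "integrable lborel (\<lambda>t. indicat_real I t *\<^sub>R \<kappa>)"
      by (intro integrable_scaleR_left integrable_real_indicator) (auto simp: I_def emeasure_lborel_Icc_eq)
    show "integrable lborel (\<lambda>t. indicat_real {0..1} t *\<^sub>R K ((x - t) / hk))"
      using K_scaled_integrable[OF hk(1)] by (simp add: set_integrable_def)
    show "indicat_real I t *\<^sub>R \<kappa> \<le> indicat_real {0..1} t *\<^sub>R K ((x - t) / hk)" for t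
      using K_I[of t] sub K_nonneg by (auto simp: indicator_def)
  qed
  then show ?thesis unfolding m .
qed

lemma mass_le:
  assumes hk: "hk > 0"
  shows "(LBINT t:{0..1}. K ((x - t) / hk)) \<le> Km * (2 * C\<^sub>1) * hk"
proof -
  define I where "I = {x - C\<^sub>1 * hk..x + C\<^sub>1 * hk}"
  have "0 \<le> C\<^sub>1 * hk" using C\<^sub>1_pos hk by simp
  then have m: "(LBINT t:I. Km) = Km * (2 * C\<^sub>1) * hk"
    by (simp add: I_def set_lebesgue_integral_def)
  have "(LBINT t:{0..1}. K ((x - t) / hk)) \<le> (LBINT t:I. Km)"
    unfolding set_lebesgue_integral_def
  proof (rule integral_mono)
    show "integrable lborel (\<lambda>t. indicat_real I t *\<^sub>R Km)"
      by (intro integrable_scaleR_left integrable_real_indicator) (auto simp: I_def emeasure_lborel_Icc_eq)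
    show "integrable lborel (\<lambda>t. indicat_real {0..1} t *\<^sub>R K ((x - t) / hk))"
      using K_scaled_integrable[OF hk(1)] by (simp add: set_integrable_def)
    show "indicat_real {0..1} t *\<^sub>R K ((x - t) / hk) \<le> indicat_real I t *\<^sub>R Km" for t
    proof (cases "t \<in> I")
      case True
      then show ?thesis using K_le Km_pos by (auto simp: indicator_def)
    next
      case False
      then have "\<bar>x - t\<bar> > C\<^sub>1 * hk" unfolding I_def by auto
      then have "\<bar>(x - t) / hk\<bar> > C\<^sub>1" using hk by (simp add: abs_divide pos_less_divide_eq)
      then show ?thesis using K_zero False by simp
    qed
  qed
  then show ?thesis unfolding m .
qed

text \<open>Bounds for one coordinate factor of \<open>K_h\<close> times its bandwidth:
  \<open>Kup\<close> from above, and \<open>Klo\<close> from below where \<open>K\<close> is at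
  least \<open>\<kappa>\<close>.\<close>

definition Kup :: real where "Kup = Km / (\<kappa> * (\<beta> - \<alpha>))"
definition Klo :: real where "Klo = \<kappa> / (Km * (2 * C\<^sub>1))"

lemma Kup_pos: "Kup > 0" and Klo_pos: "Klo > 0"
  using Km_pos \<kappa> \<alpha>_less C\<^sub>1_pos by (auto simp: Kup_def Klo_def)

context
  fixes h :: "real ^ 'd::finite" and X :: "real ^ 'd"
  assumes h: "\<And>k. h $ k > 0" "\<And>k. \<beta> * h $ k \<le> 1/2" and X: "X \<in> cbox 0 1"
begin

lemma mass_pos: "0 < (LBINT t:{0..1}. K ((X $ k - t) / h $ k))"
proof -
  have "0 < \<kappa> * (\<beta> - \<alpha>) * h $ k" using \<kappa> \<alpha>_less h by simp
  also have "\<dots> \<le> (LBINT t:{0..1}. K ((X $ k - t) / h $ k))"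
    using X h by (intro mass_ge) (auto simp: mem_unit_cbox_cart)
  finally show ?thesis .
qed

lemma K_h_nonneg: "0 \<le> K_h K h X x"
  unfolding K_h_def by (intro prod_nonneg divide_nonneg_pos ballI K_nonneg mass_pos)

lemma K_h_le: "K_h K h X x \<le> Kup ^ CARD('d) / (\<Prod>k\<in>UNIV. h $ k)"
proof -
  have "K_h K h X x \<le> (\<Prod>k\<in>UNIV. Kup / h $ k)"
    unfolding K_h_def
  proof (rule prod_mono, safe)
    fix k
    show "0 \<le> K ((X $ k - x $ k) / h $ k) / (LBINT t:{0..1}. K ((X $ k - t) / h $ k))"
      by (intro divide_nonneg_pos K_nonneg mass_pos)
    have "K ((X $ k - x $ k) / h $ k) / (LBINT t:{0..1}. K ((X $ k - t) / h $ k)) \<le> Km / (\<kappa> * (\<beta> - \<alpha>) * h $ k)"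
      using X h \<kappa> \<alpha>_less Km_pos by (intro frac_le mass_ge K_le) (auto simp: mem_unit_cbox_cart)
    then show "K ((X $ k - x $ k) / h $ k) / (LBINT t:{0..1}. K ((X $ k - t) / h $ k)) \<le> Kup / h $ k"
      by (simp add: Kup_def)
  qed
  then show ?thesis by (simp add: prod_dividef)
qed

lemma K_h_zero: assumes "\<bar>X $ k - x $ k\<bar> > C\<^sub>1 * h $ k" shows "K_h K h X x = 0"
proof -
  have "\<bar>(X $ k - x $ k) / h $ k\<bar> > C\<^sub>1"
    using assms h[of k] by (simp add: abs_divide pos_less_divide_eq)
  then have "K ((X $ k - x $ k) / h $ k) = 0" by (rule K_zero)
  then show ?thesis unfolding K_h_def by (intro prod_zero) auto
qed

lemma K_h_ge:
  assumes "\<And>k. \<bar>(X $ k - x $ k) / h $ k\<bar> \<in> {\<alpha>..\<beta>}"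
  shows "Klo ^ CARD('d) / (\<Prod>k\<in>UNIV. h $ k) \<le> K_h K h X x"
proof -
  have "(\<Prod>k\<in>UNIV. Klo / h $ k) \<le> K_h K h X x"
    unfolding K_h_def
  proof (rule prod_mono, safe)
    fix k
    show "0 \<le> Klo / h $ k" using Klo_pos h[of k] by simp
    have "\<kappa> \<le> K \<bar>(X $ k - x $ k) / h $ k\<bar>" by (rule K_ge[OF assms])
    also have "\<dots> = K ((X $ k - x $ k) / h $ k)" using K_sym by (simp add: abs_if)
    finally have "\<kappa> / (Km * (2 * C\<^sub>1) * h $ k) \<le>
        K ((X $ k - x $ k) / h $ k) / (LBINT t:{0..1}. K ((X $ k - t) / h $ k))"
      using h(1) \<kappa> K_nonneg mass_pos by (intro frac_le mass_le) auto
    then show "Klo / h $ k \<le> K ((X $ k - x $ k) / h $ k) / (LBINT t:{0..1}. K ((X $ k - t) / h $ k))"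
      by (simp add: Klo_def)
  qed
  then show ?thesis by (simp add: prod_dividef)
qed

lemma design_abs_le:
  assumes "K_h K h X x \<noteq> 0"
  shows "\<bar>X $ k - x $ k\<bar> \<le> C\<^sub>1 * h $ k" "\<bar>design h X l x\<bar> \<le> 1 + C\<^sub>1"
proof -
  show *: "\<bar>X $ k - x $ k\<bar> \<le> C\<^sub>1 * h $ k" for k
    using K_h_zero assms by (meson not_le)
  have "\<bar>(X $ k - x $ k) / h $ k\<bar> \<le> C\<^sub>1" for k
    using *[of k] h[of k] by (simp add: abs_divide pos_divide_le_eq)
  then show "\<bar>design h X l x\<bar> \<le> 1 + C\<^sub>1"
    using C\<^sub>1_pos by (cases l) (auto simp: design_def intro: add_increasing)
qed

end

end

subsection \<open>Uniform ellipticity of the local design matrices\<close>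

text \<open>
  An affine function that is small at one point of each of \<open>d + 1\<close> small boxes, placed like the
  vertices of a simplex, has small coefficients.
\<close>

lemma affine_coefficients_le:
  fixes v :: "'d::finite option \<Rightarrow> real" and s :: "'d \<Rightarrow> real" and u :: "'d option \<Rightarrow> 'd \<Rightarrow> real"
  assumes \<alpha>: "0 < \<alpha>" "\<alpha> < \<beta>" and \<eta>: "\<eta> = (\<beta> - \<alpha>) / (2 * (real CARD('d) + 2))"
    and s: "\<And>k. \<bar>s k\<bar> = 1"
    and u: "\<And>l k. l \<noteq> Some k \<Longrightarrow> u l k \<in> {\<alpha>..\<alpha> + \<eta>}" "\<And>k. u (Some k) k \<in> {\<beta> - \<eta>..\<beta>}"
    and w: "\<And>l. \<bar>v None + (\<Sum>k\<in>UNIV. v (Some k) * (s k * u l k))\<bar> \<le> \<tau>"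
  shows "(\<Sum>l\<in>UNIV. (v l)\<^sup>2) \<le> ((1 + (1 + \<beta>) * (4 * real CARD('d) / (\<beta> - \<alpha>))) * \<tau>)\<^sup>2"
proof -
  define d where "d = real CARD('d)"
  have d: "d \<ge> 1" unfolding d_def by (simp add: Suc_leI)
  define A where "A = (\<Sum>k\<in>UNIV. \<bar>v (Some k)\<bar>)"
  have A: "A \<ge> 0" by (simp add: A_def sum_nonneg)
  have \<tau>: "\<tau> \<ge> 0" using w[of None] by linarith
  have \<eta>_pos: "\<eta> > 0" using \<alpha> by (simp add: \<eta>)
  \<comment> \<open>This is the purpose of the choice of \<open>\<eta>\<close>: the errors due to
    the widths of the boxes, summed over all coordinates, use up only half of the separation
    \<open>\<beta> - \<alpha>\<close>.\<close>
  have \<eta>_eq: "\<beta> - \<alpha> - 2 * \<eta> - d * \<eta> = (\<beta> - \<alpha>) / 2"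
  proof -
    have "(2 * (d + 2)) * \<eta> = \<beta> - \<alpha>" using d by (simp add: \<eta> d_def[symmetric])
    then show ?thesis by (simp add: algebra_simps)
  qed
  \<comment> \<open>Subtracting the values at the vertices \<open>Some k\<close> and
    \<open>None\<close> cancels the intercept and isolates coefficient \<open>k\<close>; the other
    coordinates of the two points differ by at most \<open>\<eta>\<close>.\<close>
  have step: "(\<beta> - \<alpha> - 2 * \<eta>) * \<bar>v (Some k)\<bar> \<le> 2 * \<tau> + \<eta> * A" for k
  proof -
    define \<delta> where "\<delta> j = u (Some k) j - u None j" for j
    have \<delta>k: "\<beta> - \<alpha> - 2 * \<eta> \<le> \<delta> k" using u(1)[of None k] u(2)[of k] by (auto simp: \<delta>_def)
    have \<delta>j: "\<bar>\<delta> j\<bar> \<le> \<eta>" if "j \<noteq> k" for j using u(1)[of None j] u(1)[of "Some k" j] that by (auto simp: \<delta>_def)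
    have pos: "0 \<le> \<beta> - \<alpha> - 2 * \<eta>" using \<eta>_eq d \<eta>_pos \<alpha> by (smt (verit) divide_pos_pos mult_nonneg_nonneg)
    define W where "W = (\<Sum>j\<in>UNIV. v (Some j) * (s j * \<delta> j))"
    have "W = (v None + (\<Sum>j\<in>UNIV. v (Some j) * (s j * u (Some k) j))) - (v None + (\<Sum>j\<in>UNIV. v (Some j) * (s j * u None j)))"
      by (simp add: W_def \<delta>_def right_diff_distrib sum_subtractf)
    then have W: "\<bar>W\<bar> \<le> 2 * \<tau>" using w[of "Some k"] w[of None] by linarith
    have W_split: "W = v (Some k) * (s k * \<delta> k) + (\<Sum>j\<in>UNIV - {k}. v (Some j) * (s j * \<delta> j))"
      unfolding W_def by (rule sum.remove) auto
    have "\<bar>\<Sum>j\<in>UNIV - {k}. v (Some j) * (s j * \<delta> j)\<bar> \<le> (\<Sum>j\<in>UNIV - {k}. \<bar>v (Some j)\<bar> * \<eta>)"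
      using s \<delta>j by (intro order_trans[OF sum_abs] sum_mono) (auto simp: abs_mult intro!: mult_left_mono)
    also have "\<dots> \<le> (\<Sum>j\<in>UNIV. \<bar>v (Some j)\<bar> * \<eta>)" using \<eta>_pos by (intro sum_mono2) auto
    also have "\<dots> = \<eta> * A" by (simp add: A_def sum_distrib_left mult.commute)
    finally have rest: "\<bar>\<Sum>j\<in>UNIV - {k}. v (Some j) * (s j * \<delta> j)\<bar> \<le> \<eta> * A" .
    have "(\<beta> - \<alpha> - 2 * \<eta>) * \<bar>v (Some k)\<bar> \<le> \<delta> k * \<bar>v (Some k)\<bar>" using \<delta>k by (intro mult_right_mono) auto
    also have "\<dots> = \<bar>v (Some k) * (s k * \<delta> k)\<bar>" using s[of k] \<delta>k pos by (simp add: abs_mult)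
    also have "\<dots> \<le> 2 * \<tau> + \<eta> * A" using W W_split rest by linarith
    finally show ?thesis .
  qed
  have "(\<beta> - \<alpha> - 2 * \<eta>) * A = (\<Sum>k\<in>UNIV. (\<beta> - \<alpha> - 2 * \<eta>) * \<bar>v (Some k)\<bar>)"
    by (simp add: A_def sum_distrib_left)
  also have "\<dots> \<le> (\<Sum>k\<in>(UNIV :: 'd set). 2 * \<tau> + \<eta> * A)" by (intro sum_mono step)
  also have "\<dots> = d * (2 * \<tau> + \<eta> * A)" by (simp add: d_def)
  \<comment> \<open>After summation over \<open>k\<close>, the perturbation
    \<open>d * \<eta> * A\<close> is absorbed into the left-hand side.\<close>
  finally have "(\<beta> - \<alpha> - 2 * \<eta> - d * \<eta>) * A \<le> 2 * d * \<tau>" by (simp add: algebra_simps)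
  then have "A * (\<beta> - \<alpha>) \<le> 4 * d * \<tau>" unfolding \<eta>_eq by (simp add: mult_ac)
  then have A_le: "A \<le> 4 * d / (\<beta> - \<alpha>) * \<tau>" using \<alpha> by (simp add: field_simps)
  have "\<bar>\<Sum>k\<in>UNIV. v (Some k) * (s k * u None k)\<bar> \<le> (\<Sum>k\<in>UNIV. \<bar>v (Some k)\<bar> * \<beta>)"
  proof (intro order_trans[OF sum_abs] sum_mono)
    fix k
    have "\<eta> \<le> \<beta> - \<alpha>" using \<eta>_eq d \<eta>_pos \<alpha> by (smt (verit) divide_pos_pos mult_nonneg_nonneg)
    then have "\<bar>u None k\<bar> \<le> \<beta>" using u(1)[of None k] \<alpha> by auto
    then show "\<bar>v (Some k) * (s k * u None k)\<bar> \<le> \<bar>v (Some k)\<bar> * \<beta>"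
      using s[of k] by (simp add: abs_mult mult_left_mono)
  qed
  also have "\<dots> = \<beta> * A" by (simp add: A_def sum_distrib_left mult.commute)
  finally have "\<bar>v None\<bar> \<le> \<tau> + \<beta> * A" using w[of None] by linarith
  then have "\<bar>v None\<bar> + A \<le> \<tau> + (1 + \<beta>) * A" by (simp add: algebra_simps)
  also have "\<dots> \<le> \<tau> + (1 + \<beta>) * (4 * d / (\<beta> - \<alpha>) * \<tau>)"
    using A_le \<alpha> by (intro add_left_mono mult_left_mono) auto
  finally have le: "\<bar>v None\<bar> + A \<le> (1 + (1 + \<beta>) * (4 * d / (\<beta> - \<alpha>))) * \<tau>" by (simp add: algebra_simps)
  have "(\<Sum>l\<in>UNIV. (v l)\<^sup>2) \<le> (\<Sum>l\<in>UNIV. \<bar>v l\<bar>)\<^sup>2"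
  proof -
    have "(\<Sum>l\<in>UNIV. (v l)\<^sup>2) = (\<Sum>l\<in>UNIV. \<bar>v l\<bar> * \<bar>v l\<bar>)" by (simp add: power2_eq_square)
    also have "\<dots> \<le> (\<Sum>l\<in>UNIV. \<bar>v l\<bar> * (\<Sum>l\<in>UNIV. \<bar>v l\<bar>))"
      by (intro sum_mono mult_left_mono member_le_sum) auto
    finally show ?thesis by (simp add: power2_eq_square sum_distrib_right)
  qed
  also have "(\<Sum>l\<in>UNIV. \<bar>v l\<bar>) = \<bar>v None\<bar> + A" by (simp add: sum_UNIV_option A_def)
  also have "(\<bar>v None\<bar> + A)\<^sup>2 \<le> ((1 + (1 + \<beta>) * (4 * d / (\<beta> - \<alpha>))) * \<tau>)\<^sup>2"
    using le A by (intro power_mono) auto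
  finally show ?thesis by (simp add: d_def)
qed

section \<open>The grid of cubic cells\<close>

definition cell :: "nat \<Rightarrow> ('d::finite \<Rightarrow> nat) \<Rightarrow> (real ^ 'd) set" where
  "cell m j = cbox (\<chi> k. real (j k) / real m) (\<chi> k. (real (j k) + 1) / real m)"

lemma mem_cell: "y \<in> cell m j \<longleftrightarrow> (\<forall>k. real (j k) / real m \<le> y $ k \<and> y $ k \<le> (real (j k) + 1) / real m)"
  by (simp add: cell_def mem_box_cart)

text \<open>Two mesh widths suffice: less than one is lost in rounding \<open>lo\<close> up to the
  grid, and the other holds the mesh interval.\<close>

lemma grid_interval_exists:
  fixes lo hi :: real
  assumes "0 \<le> lo" "hi \<le> 1" "m > 0" "2 / real m \<le> hi - lo"
  shows "\<exists>j<m. lo \<le> real j / real m \<and> (real j + 1) / real m \<le> hi"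
proof -
  define j where "j = nat \<lceil>lo * real m\<rceil>"
  have "0 \<le> lo * real m" using assms by simp
  then have j: "lo * real m \<le> real j" "real j < lo * real m + 1" by (auto simp: j_def) linarith+
  have "2 \<le> (hi - lo) * real m" using assms by (simp add: field_simps)
  then have "real j + 1 \<le> hi * real m" using j by (simp add: algebra_simps)
  moreover have "hi * real m \<le> real m" using assms mult_right_mono[of hi 1 "real m"] by simp
  ultimately have "j < m" by linarith
  then show ?thesis using j \<open>real j + 1 \<le> hi * real m\<close> assms by (intro exI[of _ j]) (simp add: field_simps)
qed

lemma grid_point_exists:
  assumes "y \<in> cbox 0 (1 :: real ^ 'd::finite)" "m > 0"
  obtains j where "\<And>k. j k < m" "y \<in> cell m j"
proof -
  have "\<exists>i<m. real i / real m \<le> y $ k \<and> y $ k \<le> (real i + 1) / real m" for k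
  \<comment> \<open>At the right end the floor would give the index \<open>m\<close>, beyond the
    grid; cells are closed, so the last one takes the point.\<close>
  proof (cases "y $ k = 1")
    case True
    then show ?thesis using assms by (intro exI[of _ "m - 1"]) (auto simp: of_nat_diff)
  next
    case False
    have "0 \<le> y $ k \<and> y $ k \<le> 1" using assms(1) unfolding mem_unit_cbox_cart by blast
    with False have y: "0 \<le> y $ k" "y $ k < 1" by auto
    define i where "i = nat \<lfloor>y $ k * real m\<rfloor>"
    have "0 \<le> y $ k * real m" using y by simp
    then have i: "real i \<le> y $ k * real m" "y $ k * real m < real i + 1" by (auto simp: i_def)
    have "y $ k * real m < real m" using y assms by simp
    then have "i < m" using i by linarith
    then show ?thesis using i assms by (intro exI[of _ i]) (auto simp: field_simps)
  qed
  then obtain j where "\<And>k. j k < m \<and> real (j k) / real m \<le> y $ k \<and> y $ k \<le> (real (j k) + 1) / real m" by metis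
  then show ?thesis by (intro that[of j]) (auto simp: mem_cell)
qed

lemma prod_const_times: "(\<Prod>k\<in>(UNIV :: 'd::finite set). c * h $ k) = c ^ CARD('d) * (\<Prod>k\<in>UNIV. h $ k :: real)"
  by (simp add: prod.distrib)

context kernel
begin

text \<open>The lower bound on \<open>m\<close> makes the grid fine enough for whole cells to fit
  into the boxes of the simplex construction; \<open>real m * h $ k \<le> M\<close> keeps it from
  being too fine, so that a cell still has volume of order h^d.\<close>

definition well_spread :: "real \<Rightarrow> real \<Rightarrow> real \<Rightarrow> real ^ 'd::finite \<Rightarrow> nat \<Rightarrow> (nat \<Rightarrow> real ^ 'd) \<Rightarrow> nat \<Rightarrow> bool" where
  "well_spread M a b h n X m \<longleftrightarrow> n > 0 \<and> m > 0 \<and> (\<forall>k. h $ k > 0 \<and> \<beta> * h $ k \<le> 1/2 \<and>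
      2 / real m \<le> (\<beta> - \<alpha>) / (2 * (real CARD('d) + 2)) * h $ k \<and> real m * h $ k \<le> M) \<and>
    (\<forall>i<n. X i \<in> cbox 0 1) \<and>
    (\<forall>j. (\<forall>k. j k < m) \<longrightarrow> a * real n / real m ^ CARD('d) \<le> real (card {i. i < n \<and> X i \<in> cell m j}) \<and>
        real (card {i. i < n \<and> X i \<in> cell m j}) \<le> b * real n / real m ^ CARD('d))"

text \<open>Around each \<open>x\<close> there are d + 1 cells placed like the vertices of a
  simplex. The affine function with coefficients \<open>v\<close> cannot be small somewhere in each
  of them, so it is large on the whole of one cell, whose design points alone give the bound. Which
  cell that is depends on \<open>v\<close> and \<open>x\<close>, hence the counts are controlled for
  all cells in advance.\<close>

lemma well_spread_elliptic:
  fixes h :: "real ^ 'd::finite"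
  assumes ws: "well_spread M a b h n X m" and a: "a > 0" and x: "x \<in> cbox 0 1"
  shows "a * (Klo / M) ^ CARD('d) / (2 + (1 + \<beta>) * (4 * real CARD('d) / (\<beta> - \<alpha>)))\<^sup>2 * (\<Sum>l\<in>UNIV. (v l)\<^sup>2)
    \<le> 1 / real n * (\<Sum>i<n. (\<Sum>l\<in>UNIV. v l * design h (X i) l x)\<^sup>2 * K_h K h (X i) x)"
proof -
  define \<eta> where "\<eta> = (\<beta> - \<alpha>) / (2 * (real CARD('d) + 2))"
  define D where "D = 2 + (1 + \<beta>) * (4 * real CARD('d) / (\<beta> - \<alpha>))"
  have "0 \<le> (1 + \<beta>) * (4 * real CARD('d) / (\<beta> - \<alpha>))"
    using \<alpha>_less \<beta>_pos by (intro mult_nonneg_nonneg divide_nonneg_nonneg) auto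
  then have D: "D > 1" unfolding D_def by linarith
  from ws have n: "n > 0" and m: "m > 0" and h: "\<And>k. h $ k > 0" "\<And>k. \<beta> * h $ k \<le> 1/2"
    and \<eta>m: "\<And>k. 2 / real m \<le> \<eta> * h $ k" and M: "\<And>k. real m * h $ k \<le> M"
    and X: "\<And>i. i < n \<Longrightarrow> X i \<in> cbox 0 1"
    and count: "\<And>j. (\<And>k. j k < m) \<Longrightarrow> a * real n / real m ^ CARD('d) \<le> real (card {i. i < n \<and> X i \<in> cell m j})"
    by (auto simp: well_spread_def \<eta>_def)
  have \<eta>_pos: "\<eta> > 0" using \<alpha>_less by (simp add: \<eta>_def)
  have \<eta>_le: "\<eta> \<le> \<beta> - \<alpha>"
    using \<alpha>_less divide_left_mono[of 1 "2 * (real CARD('d) + 2)" "\<beta> - \<alpha>"] by (simp add: \<eta>_def)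
  \<comment> \<open>Each coordinate moves towards the farther face of the cube, so the cells used
    lie in the cube even if \<open>x\<close> is on its boundary.\<close>
  define s :: "'d \<Rightarrow> real" where "s k = (if x $ k \<le> 1/2 then 1 else - 1)" for k
  have s: "\<bar>s k\<bar> = 1" "s k * s k = 1" for k by (auto simp: s_def)
  define lo where "lo l k = (if l = Some k then \<beta> - \<eta> else \<alpha>)" for l :: "'d option" and k :: 'd
  have lo: "\<alpha> \<le> lo l k" "lo l k + \<eta> \<le> \<beta>" for l k using \<eta>_le by (auto simp: lo_def)
  have J_exists: "\<exists>i<m. \<forall>y. real i / real m \<le> y \<longrightarrow> y \<le> (real i + 1) / real m \<longrightarrow>
      s k * ((y - x $ k) / h $ k) \<in> {lo l k..lo l k + \<eta>}" for l k
  proof -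
    have xk: "0 \<le> x $ k" "x $ k \<le> 1" using x by (auto simp: mem_unit_cbox_cart)
    have lh: "0 \<le> lo l k * h $ k" "(lo l k + \<eta>) * h $ k \<le> 1/2"
    proof -
      show "0 \<le> lo l k * h $ k" using h(1)[of k] lo(1)[of l k] \<alpha> by (intro mult_nonneg_nonneg) auto
      have "(lo l k + \<eta>) * h $ k \<le> \<beta> * h $ k" using lo(2) h(1)[of k] by (intro mult_right_mono) auto
      then show "(lo l k + \<eta>) * h $ k \<le> 1/2" using h(2)[of k] by linarith
    qed
    show ?thesis
    proof (cases "x $ k \<le> 1/2")
      case True
      obtain i where i: "i < m" "x $ k + lo l k * h $ k \<le> real i / real m" "(real i + 1) / real m \<le> x $ k + (lo l k + \<eta>) * h $ k"
        using grid_interval_exists[of "x $ k + lo l k * h $ k" "x $ k + (lo l k + \<eta>) * h $ k" m] xk lh True m \<eta>m[of k]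
        by (auto simp: algebra_simps)
      have "s k * ((y - x $ k) / h $ k) \<in> {lo l k..lo l k + \<eta>}" if "real i / real m \<le> y" "y \<le> (real i + 1) / real m" for y
      proof -
        have "lo l k * h $ k \<le> y - x $ k" "y - x $ k \<le> (lo l k + \<eta>) * h $ k" using i that by linarith+
        then show ?thesis using True h(1)[of k] by (simp add: s_def pos_le_divide_eq pos_divide_le_eq)
      qed
      then show ?thesis using i(1) by blast
    next
      case False
      obtain i where i: "i < m" "x $ k - (lo l k + \<eta>) * h $ k \<le> real i / real m" "(real i + 1) / real m \<le> x $ k - lo l k * h $ k"
        using grid_interval_exists[of "x $ k - (lo l k + \<eta>) * h $ k" "x $ k - lo l k * h $ k" m] xk lh False m \<eta>m[of k]
        by (auto simp: algebra_simps)
      have "s k * ((y - x $ k) / h $ k) \<in> {lo l k..lo l k + \<eta>}" if "real i / real m \<le> y" "y \<le> (real i + 1) / real m" for y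
      proof -
        have "lo l k * h $ k \<le> x $ k - y" "x $ k - y \<le> (lo l k + \<eta>) * h $ k" using i that by linarith+
        then have "(x $ k - y) / h $ k \<in> {lo l k..lo l k + \<eta>}"
          using h(1)[of k] by (simp add: pos_le_divide_eq pos_divide_le_eq)
        then show ?thesis using False by (simp add: s_def minus_divide_left)
      qed
      then show ?thesis using i(1) by blast
    qed
  qed
  define J where "J l k = (SOME i. i < m \<and> (\<forall>y. real i / real m \<le> y \<longrightarrow> y \<le> (real i + 1) / real m \<longrightarrow>
      s k * ((y - x $ k) / h $ k) \<in> {lo l k..lo l k + \<eta>}))" for l k
  have J: "J l k < m" "real (J l k) / real m \<le> y \<Longrightarrow> y \<le> (real (J l k) + 1) / real m \<Longrightarrow>
      s k * ((y - x $ k) / h $ k) \<in> {lo l k..lo l k + \<eta>}" for l k y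
    using someI_ex[OF J_exists[of k l]] unfolding J_def by blast+
  have in_cell: "s k * ((y $ k - x $ k) / h $ k) \<in> {lo l k..lo l k + \<eta>}" if "y \<in> cell m (J l)" for y l k
    using that J(2) by (simp add: mem_cell)
  define V where "V = (\<Sum>l\<in>UNIV. (v l)\<^sup>2)"
  have V: "V \<ge> 0" by (simp add: V_def sum_nonneg)
  define w where "w X = (\<Sum>l\<in>UNIV. v l * design h X l x)" for X
  have w_eq: "w X = v None + (\<Sum>k\<in>UNIV. v (Some k) * (s k * (s k * ((X $ k - x $ k) / h $ k))))" for X
    by (simp add: w_def sum_UNIV_option design_def mult.assoc[symmetric] s)
  \<comment> \<open>\<open>D\<close> exceeds the constant of \<open>affine_coefficients_le\<close>
    by one, which turns the non-strict bound there into a contradiction.\<close>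
  define \<tau> where "\<tau> = sqrt V / D"
  have \<tau>: "\<tau> \<ge> 0" using V D by (simp add: \<tau>_def)
  have "\<exists>l. \<forall>y \<in> cell m (J l). \<tau>\<^sup>2 \<le> (w y)\<^sup>2"
  proof (rule ccontr)
    assume "\<not> ?thesis"
    then obtain y where y: "\<And>l. y l \<in> cell m (J l)" "\<And>l. (w (y l))\<^sup>2 < \<tau>\<^sup>2"
      by (metis not_le)
    then have lt: "\<bar>w (y l)\<bar> < \<tau>" for l using \<tau> by (metis abs_of_nonneg power2_abs abs_ge_zero power2_less_imp_less)
    have "V \<le> ((1 + (1 + \<beta>) * (4 * real CARD('d) / (\<beta> - \<alpha>))) * \<tau>)\<^sup>2"
      unfolding V_def
    proof (rule affine_coefficients_le[OF \<alpha> \<alpha>_less \<eta>_def s(1), where u = "\<lambda>l k. s k * ((y l $ k - x $ k) / h $ k)"])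
      show "\<bar>v None + (\<Sum>k\<in>UNIV. v (Some k) * (s k * (s k * ((y l $ k - x $ k) / h $ k))))\<bar> \<le> \<tau>" for l
        using lt[of l] unfolding w_eq by simp
      show "s k * ((y l $ k - x $ k) / h $ k) \<in> {\<alpha>..\<alpha> + \<eta>}" if "l \<noteq> Some k" for l k
        using in_cell[of "y l" l k, OF y(1)] that by (simp add: lo_def)
      show "s k * ((y (Some k) $ k - x $ k) / h $ k) \<in> {\<beta> - \<eta>..\<beta>}" for k
        using in_cell[of "y (Some k)" "Some k" k, OF y(1)] by (simp add: lo_def)
    qed
    also have "\<dots> = ((D - 1) * \<tau>)\<^sup>2" by (simp add: D_def algebra_simps)
    finally have *: "V \<le> ((D - 1) * \<tau>)\<^sup>2" .
    have "\<tau> > 0" using lt[of None] by linarith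
    then have "((D - 1) * \<tau>)\<^sup>2 < (D * \<tau>)\<^sup>2" using D by (intro power_strict_mono) auto
    also have "\<dots> = V" using V D by (simp add: \<tau>_def)
    finally show False using * by simp
  qed
  then obtain l where l: "\<And>y. y \<in> cell m (J l) \<Longrightarrow> \<tau>\<^sup>2 \<le> (w y)\<^sup>2" by blast
  define S where "S = {i. i < n \<and> X i \<in> cell m (J l)}"
  define P where "P = (\<Prod>k\<in>UNIV. h $ k)"
  have P: "P > 0" unfolding P_def by (intro prod_pos) (simp add: h)
  \<comment> \<open>The number of points per cell, of order n / m^d, times the kernel height, of
    order 1 / P, is at least of order n because m^d * P stays bounded.\<close>
  have mP: "real m ^ CARD('d) * P \<le> M ^ CARD('d)"
  proof -
    have "real m ^ CARD('d) * P = (\<Prod>k\<in>UNIV. real m * h $ k)" by (simp add: P_def prod_const_times)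
    also have "\<dots> \<le> (\<Prod>k\<in>(UNIV :: 'd set). M)" using M h(1) by (intro prod_mono) (auto simp: less_imp_le)
    finally show ?thesis by simp
  qed
  have summand: "\<tau>\<^sup>2 * (Klo ^ CARD('d) / P) \<le> (w (X i))\<^sup>2 * K_h K h (X i) x" if "i \<in> S" for i
  proof (rule mult_mono)
    show "\<tau>\<^sup>2 \<le> (w (X i))\<^sup>2" using that l by (simp add: S_def)
    have "\<bar>(X i $ k - x $ k) / h $ k\<bar> \<in> {\<alpha>..\<beta>}" for k
    proof -
      define u where "u = (X i $ k - x $ k) / h $ k"
      have "s k * u \<in> {lo l k..lo l k + \<eta>}" unfolding u_def by (rule in_cell) (use that in \<open>simp add: S_def\<close>)
      moreover have "s k = 1 \<or> s k = - 1" by (simp add: s_def)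
      ultimately have "\<bar>u\<bar> \<in> {lo l k..lo l k + \<eta>}" using lo(1)[of l k] \<alpha> by auto
      then show ?thesis using lo[of l k] unfolding u_def[symmetric] by simp
    qed
    then show "Klo ^ CARD('d) / P \<le> K_h K h (X i) x"
      unfolding P_def using that X h by (intro K_h_ge) (auto simp: S_def)
    show "0 \<le> Klo ^ CARD('d) / P" using Klo_pos P by simp
  qed simp
  have "a * (Klo / M) ^ CARD('d) / D\<^sup>2 * V = \<tau>\<^sup>2 * Klo ^ CARD('d) * a / M ^ CARD('d)"
    using V D by (simp add: \<tau>_def power_divide mult_ac)
  also have "\<dots> \<le> \<tau>\<^sup>2 * Klo ^ CARD('d) * a / (real m ^ CARD('d) * P)"
  proof (rule divide_left_mono[OF mP])
    have pos: "0 < real m ^ CARD('d) * P" using m P by simp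
    then have "0 < M ^ CARD('d)" using mP by linarith
    then show "0 < M ^ CARD('d) * (real m ^ CARD('d) * P)" using pos by (rule mult_pos_pos)
    show "0 \<le> \<tau>\<^sup>2 * Klo ^ CARD('d) * a" using Klo_pos a by simp
  qed
  also have "\<dots> = 1 / real n * ((a * real n / real m ^ CARD('d)) * (\<tau>\<^sup>2 * (Klo ^ CARD('d) / P)))"
    using n by simp
  also have "\<dots> \<le> 1 / real n * (real (card S) * (\<tau>\<^sup>2 * (Klo ^ CARD('d) / P)))"
    using count[of "J l"] J(1) Klo_pos P unfolding S_def by (intro mult_left_mono mult_right_mono) auto
  also have "\<dots> = 1 / real n * (\<Sum>i\<in>S. \<tau>\<^sup>2 * (Klo ^ CARD('d) / P))" by simp
  also have "\<dots> \<le> 1 / real n * (\<Sum>i\<in>S. (w (X i))\<^sup>2 * K_h K h (X i) x)"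
    by (intro mult_left_mono sum_mono summand) auto
  also have "\<dots> \<le> 1 / real n * (\<Sum>i<n. (w (X i))\<^sup>2 * K_h K h (X i) x)"
    using X h by (intro mult_left_mono sum_mono2) (auto simp: S_def intro!: mult_nonneg_nonneg K_h_nonneg)
  finally show ?thesis unfolding V_def D_def w_def .
qed

lemma card_nat_interval_le:
  assumes "p \<le> (q :: real)"
  shows "finite {j :: nat. p \<le> real j \<and> real j \<le> q}" "real (card {j :: nat. p \<le> real j \<and> real j \<le> q}) \<le> q - p + 1"
proof -
  have sub: "{j :: nat. p \<le> real j \<and> real j \<le> q} \<subseteq> {nat \<lceil>p\<rceil>..nat \<lfloor>q\<rfloor>}"
    by (auto simp: nat_le_iff le_nat_iff ceiling_le_iff le_floor_iff)
  show fin: "finite {j :: nat. p \<le> real j \<and> real j \<le> q}" using sub by (rule finite_subset) simp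
  show "real (card {j :: nat. p \<le> real j \<and> real j \<le> q}) \<le> q - p + 1"
  \<comment> \<open>For negative \<open>q\<close> the truncation in \<open>nat\<close> would still
    count the index 0.\<close>
  proof (cases "q < 0")
    case True
    then have "{j :: nat. p \<le> real j \<and> real j \<le> q} = {}" by auto
    then have "card {j :: nat. p \<le> real j \<and> real j \<le> q} = 0" by (simp only: card.empty)
    then show ?thesis using assms by linarith
  next
    case False
    have "card {j :: nat. p \<le> real j \<and> real j \<le> q} \<le> Suc (nat \<lfloor>q\<rfloor>) - nat \<lceil>p\<rceil>"
      using card_mono[OF _ sub] by simp
    moreover have "real (nat \<lfloor>q\<rfloor>) \<le> q" "p \<le> real (nat \<lceil>p\<rceil>)" using False by linarith+
    ultimately show ?thesis using assms by linarith
  qed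
qed

text \<open>The window around \<open>x\<close> is covered by the grid cells that it meets.
  Neighbouring closed cells share faces, so points may be counted twice, which is harmless in an
  upper bound.\<close>

lemma card_near_le:
  fixes x :: "real ^ 'd::finite" and n :: nat
  assumes X: "\<And>i. i < n \<Longrightarrow> X i \<in> cbox 0 1" and m: "m > 0" and \<rho>: "\<rho> \<ge> 0"
    and count: "\<And>j. (\<And>k. j k < m) \<Longrightarrow> real (card {i. i < n \<and> X i \<in> cell m j}) \<le> b" and b: "b \<ge> 0"
  shows "real (card {i. i < n \<and> (\<forall>k. real m * \<bar>X i $ k - x $ k\<bar> \<le> \<rho>)}) \<le> (2 * \<rho> + 2) ^ CARD('d) * b"
proof -
  \<comment> \<open>A cell is indexed by its lower corner, so the index can be one below the lower
    end of the window; an interval of length \<open>2 * \<rho> + 1\<close> contains at most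
    \<open>2 * \<rho> + 2\<close> integers.\<close>
  define A where "A k = {j :: nat. real m * x $ k - \<rho> - 1 \<le> real j \<and> real j \<le> real m * x $ k + \<rho>}" for k
  have A: "finite (A k)" "real (card (A k)) \<le> 2 * \<rho> + 2" for k
    using card_nat_interval_le[of "real m * x $ k - \<rho> - 1" "real m * x $ k + \<rho>"] \<rho> by (auto simp: A_def)
  define B where "B = {j \<in> Pi\<^sub>E UNIV A. \<forall>k. j k < m}"
  have fin: "finite (Pi\<^sub>E UNIV A)" by (intro finite_PiE) (auto simp: A)
  then have finB: "finite B" by (simp add: B_def)
  have "real (card B) \<le> real (card (Pi\<^sub>E UNIV A))"
    using fin by (intro of_nat_mono card_mono) (auto simp: B_def)
  also have "\<dots> = (\<Prod>k\<in>UNIV. real (card (A k)))" by (simp add: card_PiE)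
  also have "\<dots> \<le> (\<Prod>k\<in>(UNIV :: 'd set). 2 * \<rho> + 2)" by (intro prod_mono) (auto simp: A)
  finally have cardB: "real (card B) \<le> (2 * \<rho> + 2) ^ CARD('d)" by simp
  have "{i. i < n \<and> (\<forall>k. real m * \<bar>X i $ k - x $ k\<bar> \<le> \<rho>)} \<subseteq> (\<Union>j\<in>B. {i. i < n \<and> X i \<in> cell m j})"
  proof safe
    fix i assume i: "i < n" and near: "\<forall>k. real m * \<bar>X i $ k - x $ k\<bar> \<le> \<rho>"
    obtain j where j: "\<And>k. j k < m" "X i \<in> cell m j" using grid_point_exists[OF X[OF i] m] by blast
    have "j k \<in> A k" for k
    proof -
      have "real (j k) \<le> X i $ k * real m" "X i $ k * real m \<le> real (j k) + 1"
        using j(2)[unfolded mem_cell, rule_format, of k] m by (simp_all add: pos_divide_le_eq pos_le_divide_eq)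
      moreover have "\<bar>real m * X i $ k - real m * x $ k\<bar> \<le> \<rho>"
      proof -
        have "\<bar>real m * X i $ k - real m * x $ k\<bar> = real m * \<bar>X i $ k - x $ k\<bar>"
          by (simp only: right_diff_distrib[symmetric] abs_mult abs_of_nat)
        then show ?thesis using near by simp
      qed
      ultimately show ?thesis unfolding A_def mem_Collect_eq mult.commute[of "X i $ k"] by linarith
    qed
    then show "i \<in> (\<Union>j\<in>B. {i. i < n \<and> X i \<in> cell m j})" using j i by (auto simp: B_def PiE_iff)
  qed
  moreover have "finite {i. i < n \<and> X i \<in> cell m j}" for j
    by (rule finite_subset[of _ "{..<n}"]) auto
  ultimately have "card {i. i < n \<and> (\<forall>k. real m * \<bar>X i $ k - x $ k\<bar> \<le> \<rho>)} \<le> card (\<Union>j\<in>B. {i. i < n \<and> X i \<in> cell m j})"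
    using finB by (intro card_mono) auto
  also have "\<dots> \<le> (\<Sum>j\<in>B. card {i. i < n \<and> X i \<in> cell m j})" by (rule card_UN_le[OF finB])
  finally have "real (card {i. i < n \<and> (\<forall>k. real m * \<bar>X i $ k - x $ k\<bar> \<le> \<rho>)}) \<le> (\<Sum>j\<in>B. real (card {i. i < n \<and> X i \<in> cell m j}))"
    unfolding of_nat_sum[symmetric] by (rule of_nat_mono)
  also have "\<dots> \<le> (\<Sum>j\<in>B. b)" by (intro sum_mono count) (simp add: B_def)
  also have "\<dots> \<le> (2 * \<rho> + 2) ^ CARD('d) * b" using cardB b by (simp add: mult_right_mono)
  finally show ?thesis .
qed

text \<open>Kernel weight sits on points within \<open>C\<^sub>1 * h $ k\<close> of \<open>x\<close>
  in each coordinate, which boundedly many cells cover; the kernel height 1 / P times the cell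
  frequency 1 / m^d is bounded because the mesh width is at most a fixed multiple of each
  bandwidth.\<close>

lemma well_spread_bounded:
  fixes h :: "real ^ 'd::finite"
  assumes ws: "well_spread M a b h n X m" and b: "b \<ge> 0" and x: "x \<in> cbox 0 1"
  shows "1 / real n * (\<Sum>i<n. (\<Sum>l\<in>UNIV. v l * design h (X i) l x)\<^sup>2 * K_h K h (X i) x)
    \<le> real CARD('d option) * (1 + C\<^sub>1)\<^sup>2 * (2 * (C\<^sub>1 * M) + 2) ^ CARD('d) * b *
        (Kup * ((\<beta> - \<alpha>) / (2 * (real CARD('d) + 2)))) ^ CARD('d) * (\<Sum>l\<in>UNIV. (v l)\<^sup>2)"
proof -
  define \<eta> where "\<eta> = (\<beta> - \<alpha>) / (2 * (real CARD('d) + 2))"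
  from ws have n: "n > 0" and m: "m > 0" and h: "\<And>k. h $ k > 0" "\<And>k. \<beta> * h $ k \<le> 1/2"
    and \<eta>m: "\<And>k. 2 / real m \<le> \<eta> * h $ k" and M: "\<And>k. real m * h $ k \<le> M"
    and X: "\<And>i. i < n \<Longrightarrow> X i \<in> cbox 0 1"
    and count: "\<And>j. (\<And>k. j k < m) \<Longrightarrow> real (card {i. i < n \<and> X i \<in> cell m j}) \<le> b * real n / real m ^ CARD('d)"
    by (auto simp: well_spread_def \<eta>_def)
  have \<eta>: "\<eta> > 0" using \<alpha>_less by (simp add: \<eta>_def)
  \<comment> \<open>\<open>undefined\<close> stands for an arbitrary coordinate; index types are
    nonempty.\<close>
  have M_pos: "M \<ge> 0" using M[of undefined] h(1)[of undefined] by (meson mult_nonneg_nonneg of_nat_0_le_iff less_imp_le order_trans)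
  define P where "P = (\<Prod>k\<in>UNIV. h $ k)"
  have P: "P > 0" unfolding P_def by (intro prod_pos) (simp add: h)
  define V where "V = (\<Sum>l\<in>UNIV. (v l)\<^sup>2)"
  have V: "V \<ge> 0" by (simp add: V_def sum_nonneg)
  define S where "S = {i. i < n \<and> (\<forall>k. real m * \<bar>X i $ k - x $ k\<bar> \<le> C\<^sub>1 * M)}"
  define D where "D = real CARD('d option)"
  have summand: "(\<Sum>l\<in>UNIV. v l * design h (X i) l x)\<^sup>2 * K_h K h (X i) x \<le> (if i \<in> S then V * (D * (1 + C\<^sub>1)\<^sup>2) * (Kup ^ CARD('d) / P) else 0)"
    if i: "i < n" for i
  proof (cases "K_h K h (X i) x = 0")
    case True
    then show ?thesis using V P Kup_pos by (simp add: D_def)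
  next
    case False
    note near = design_abs_le[OF h X[OF i] False]
    have "i \<in> S" unfolding S_def
    proof (safe intro!: i)
      fix k
      have "real m * \<bar>X i $ k - x $ k\<bar> \<le> real m * (C\<^sub>1 * h $ k)" using near(1) by (intro mult_left_mono) auto
      also have "\<dots> = C\<^sub>1 * (real m * h $ k)" by simp
      also have "\<dots> \<le> C\<^sub>1 * M" using M C\<^sub>1_pos by (intro mult_left_mono) auto
      finally show "real m * \<bar>X i $ k - x $ k\<bar> \<le> C\<^sub>1 * M" .
    qed
    have "(\<Sum>l\<in>UNIV. v l * design h (X i) l x)\<^sup>2 \<le> V * (\<Sum>l\<in>UNIV. (design h (X i) l x)\<^sup>2)"
      unfolding V_def by (rule Cauchy_Schwarz_ineq_sum)
    also have "\<dots> \<le> V * (\<Sum>l\<in>(UNIV :: 'd option set). (1 + C\<^sub>1)\<^sup>2)"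
    proof (intro mult_left_mono sum_mono V)
      show "(design h (X i) l x)\<^sup>2 \<le> (1 + C\<^sub>1)\<^sup>2" for l
        using power_mono[OF near(2)[of l], of 2] by simp
    qed
    also have "\<dots> = V * (D * (1 + C\<^sub>1)\<^sup>2)" by (simp add: D_def)
    finally have "(\<Sum>l\<in>UNIV. v l * design h (X i) l x)\<^sup>2 * K_h K h (X i) x \<le> V * (D * (1 + C\<^sub>1)\<^sup>2) * (Kup ^ CARD('d) / P)"
      unfolding P_def using V by (intro mult_mono K_h_le K_h_nonneg h X i) (auto simp: D_def)
    then show ?thesis using \<open>i \<in> S\<close> by simp
  qed
  have cardS: "real (card S) \<le> (2 * (C\<^sub>1 * M) + 2) ^ CARD('d) * (b * real n / real m ^ CARD('d))"
    unfolding S_def using X m C\<^sub>1_pos M_pos b count by (intro card_near_le) auto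
  have mP: "1 \<le> \<eta> ^ CARD('d) * (real m ^ CARD('d) * P)"
  proof -
    have "1 \<le> (\<Prod>k\<in>(UNIV :: 'd set). \<eta> * (real m * h $ k))"
    proof (rule prod_ge_1)
      fix k
      have "2 \<le> \<eta> * h $ k * real m" using \<eta>m[of k] m by (simp add: field_simps)
      then show "1 \<le> \<eta> * (real m * h $ k)" by (simp add: mult_ac)
    qed
    also have "\<dots> = \<eta> ^ CARD('d) * (real m ^ CARD('d) * P)" by (simp add: P_def prod.distrib)
    finally show ?thesis .
  qed
  define E where "E = V * (D * (1 + C\<^sub>1)\<^sup>2) * (2 * (C\<^sub>1 * M) + 2) ^ CARD('d) * b * Kup ^ CARD('d)"
  have E: "E \<ge> 0" unfolding E_def using V C\<^sub>1_pos M_pos b Kup_pos by (intro mult_nonneg_nonneg) (auto simp: D_def)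
  have "1 / real n * (\<Sum>i<n. (\<Sum>l\<in>UNIV. v l * design h (X i) l x)\<^sup>2 * K_h K h (X i) x)
    \<le> 1 / real n * (\<Sum>i<n. if i \<in> S then V * (D * (1 + C\<^sub>1)\<^sup>2) * (Kup ^ CARD('d) / P) else 0)"
    by (intro mult_left_mono sum_mono summand) auto
  also have "\<dots> = 1 / real n * (real (card S) * (V * (D * (1 + C\<^sub>1)\<^sup>2) * (Kup ^ CARD('d) / P)))"
  proof -
    have "{..<n} \<inter> {i. i \<in> S} = S" by (auto simp: S_def)
    then show ?thesis by (simp add: sum.If_cases)
  qed
  also have "\<dots> \<le> 1 / real n * (((2 * (C\<^sub>1 * M) + 2) ^ CARD('d) * (b * real n / real m ^ CARD('d))) * (V * (D * (1 + C\<^sub>1)\<^sup>2) * (Kup ^ CARD('d) / P)))"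
    using V P Kup_pos by (intro mult_left_mono mult_right_mono cardS) (auto simp: D_def)
  also have "\<dots> = E * (1 / (real m ^ CARD('d) * P))" using n by (simp add: E_def)
  also have "\<dots> \<le> E * \<eta> ^ CARD('d)"
    using mP P m E by (intro mult_left_mono) (auto simp: pos_divide_le_eq)
  finally show ?thesis
    unfolding E_def D_def[symmetric] V_def[symmetric] \<eta>_def[symmetric] power_mult_distrib
    by (simp only: mult_ac)
qed

end

subsection \<open>Sums of independent random variables\<close>

context prob_space
begin

text \<open>The mixed terms vanish, since independence factorizes their expectations and the means
  are zero.\<close>

lemma second_moment_sum_indep:
  fixes W :: "nat \<Rightarrow> 'a \<Rightarrow> real"
  assumes indep: "indep_vars (\<lambda>_. borel) W {..<n}"
    and int: "\<And>i. i < n \<Longrightarrow> integrable M (W i)" "\<And>i. i < n \<Longrightarrow> integrable M (\<lambda>\<omega>. (W i \<omega>)\<^sup>2)"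
    and mean: "\<And>i. i < n \<Longrightarrow> expectation (W i) = 0"
  shows "integrable M (\<lambda>\<omega>. (\<Sum>i<n. W i \<omega>)\<^sup>2)"
    and "expectation (\<lambda>\<omega>. (\<Sum>i<n. W i \<omega>)\<^sup>2) = (\<Sum>i<n. expectation (\<lambda>\<omega>. (W i \<omega>)\<^sup>2))"
proof -
  have eq: "(\<lambda>\<omega>. (\<Sum>i<n. W i \<omega>)\<^sup>2) = (\<lambda>\<omega>. \<Sum>i<n. \<Sum>j<n. W i \<omega> * W j \<omega>)"
    by (simp add: power2_eq_square sum_product)
  have prod: "integrable M (\<lambda>\<omega>. W i \<omega> * W j \<omega>) \<and>
      expectation (\<lambda>\<omega>. W i \<omega> * W j \<omega>) = (if i = j then expectation (\<lambda>\<omega>. (W i \<omega>)\<^sup>2) else 0)"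
    if "i < n" "j < n" for i j
  proof (cases "i = j")
    case True
    then show ?thesis using int(2)[OF that(1)] by (simp add: power2_eq_square)
  next
    case False
    have ind: "indep_vars (\<lambda>_. borel) W {i, j}" using indep by (rule indep_vars_subset) (use that in auto)
    have "integrable M (\<lambda>\<omega>. \<Prod>k\<in>{i, j}. W k \<omega>)"
      by (rule indep_vars_integrable[OF _ ind]) (use that int(1) in auto)
    moreover have "expectation (\<lambda>\<omega>. \<Prod>k\<in>{i, j}. W k \<omega>) = (\<Prod>k\<in>{i, j}. expectation (W k))"
      by (rule indep_vars_lebesgue_integral[OF _ ind]) (use that int(1) in auto)
    ultimately show ?thesis using False mean[OF that(1)] by simp
  qed
  show "integrable M (\<lambda>\<omega>. (\<Sum>i<n. W i \<omega>)\<^sup>2)"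
    unfolding eq using prod by (intro Bochner_Integration.integrable_sum) auto
  have "expectation (\<lambda>\<omega>. (\<Sum>i<n. W i \<omega>)\<^sup>2) = (\<Sum>i<n. \<Sum>j<n. expectation (\<lambda>\<omega>. W i \<omega> * W j \<omega>))"
  proof -
    have "expectation (\<lambda>\<omega>. \<Sum>i<n. \<Sum>j<n. W i \<omega> * W j \<omega>) = (\<Sum>i<n. expectation (\<lambda>\<omega>. \<Sum>j<n. W i \<omega> * W j \<omega>))"
      using prod by (intro Bochner_Integration.integral_sum Bochner_Integration.integrable_sum) auto
    also have "\<dots> = (\<Sum>i<n. \<Sum>j<n. expectation (\<lambda>\<omega>. W i \<omega> * W j \<omega>))"
      using prod by (intro sum.cong refl Bochner_Integration.integral_sum) auto
    finally show ?thesis unfolding eq .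
  qed
  also have "\<dots> = (\<Sum>i<n. \<Sum>j<n. if i = j then expectation (\<lambda>\<omega>. (W i \<omega>)\<^sup>2) else 0)"
    using prod by (intro sum.cong refl) auto
  also have "\<dots> = (\<Sum>i<n. expectation (\<lambda>\<omega>. (W i \<omega>)\<^sup>2))" by simp
  finally show "expectation (\<lambda>\<omega>. (\<Sum>i<n. W i \<omega>)\<^sup>2) = (\<Sum>i<n. expectation (\<lambda>\<omega>. (W i \<omega>)\<^sup>2))" .
qed

text \<open>The moment generating function of a binomial count factorizes by independence, and 1 + u
  <= exp u is applied to each factor.\<close>

lemma expectation_exp_count_le:
  assumes indep: "indep_vars (\<lambda>_. N) W UNIV" and S: "S \<in> sets N"
    and p: "\<And>i. prob {\<omega> \<in> space M. W i \<omega> \<in> S} = p"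
  shows "integrable M (\<lambda>\<omega>. exp (t * real (card {i. i < n \<and> W i \<omega> \<in> S})))"
    and "expectation (\<lambda>\<omega>. exp (t * real (card {i. i < n \<and> W i \<omega> \<in> S}))) \<le> exp (real n * p * (exp t - 1))"
proof -
  have W [measurable]: "W i \<in> measurable M N" for i using indep by (simp add: indep_vars_def)
  note S [measurable]
  have [measurable]: "{\<omega> \<in> space M. W i \<omega> \<in> S} \<in> events" for i by measurable
  define g where "g w = exp (t * indicat_real S w)" for w
  have g [measurable]: "g \<in> borel_measurable N" unfolding g_def by measurable
  have eq: "exp (t * real (card {i. i < n \<and> W i \<omega> \<in> S})) = (\<Prod>i<n. g (W i \<omega>))" for \<omega>
  proof -
    have "real (card {i. i < n \<and> W i \<omega> \<in> S}) = (\<Sum>i<n. indicat_real S (W i \<omega>))"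
      by (simp add: indicator_def sum.If_cases Collect_conj_eq lessThan_def)
    then show ?thesis unfolding g_def exp_sum[OF finite_lessThan, symmetric] sum_distrib_left[symmetric] by simp
  qed
  have indep_g: "indep_vars (\<lambda>_. borel) (\<lambda>i \<omega>. g (W i \<omega>)) {..<n}"
    by (rule indep_vars_compose2[OF indep_vars_subset[OF indep]]) auto
  have g_eq: "g (W i \<omega>) = 1 + (exp t - 1) * indicat_real {\<omega> \<in> space M. W i \<omega> \<in> S} \<omega>" if "\<omega> \<in> space M" for i \<omega>
    using that by (simp add: g_def indicator_def)
  have int: "integrable M (\<lambda>\<omega>. g (W i \<omega>))" for i
    by (subst Bochner_Integration.integrable_cong[OF refl g_eq]) (auto simp: integrable_indicator_iff emeasure_eq_measure)
  have E: "expectation (\<lambda>\<omega>. g (W i \<omega>)) = 1 + (exp t - 1) * p" for i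
    by (subst Bochner_Integration.integral_cong[OF refl g_eq])
      (auto simp: p prob_space integrable_indicator_iff emeasure_eq_measure)
  show "integrable M (\<lambda>\<omega>. exp (t * real (card {i. i < n \<and> W i \<omega> \<in> S})))"
    unfolding eq by (rule indep_vars_integrable[OF _ indep_g int]) simp
  have "expectation (\<lambda>\<omega>. exp (t * real (card {i. i < n \<and> W i \<omega> \<in> S}))) = (\<Prod>i<n. expectation (\<lambda>\<omega>. g (W i \<omega>)))"
    unfolding eq by (rule indep_vars_lebesgue_integral[OF _ indep_g int]) simp
  also have "\<dots> = (1 + (exp t - 1) * p) ^ n" by (simp add: E)
  also have "\<dots> \<le> exp ((exp t - 1) * p) ^ n"
  proof (rule power_mono)
    have "p \<le> 1" "0 \<le> p" using p[of 0] prob_le_1 measure_nonneg by metis+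
    then have "0 \<le> 1 - p" "0 \<le> exp t * p" by auto
    then show "0 \<le> 1 + (exp t - 1) * p" by (simp add: algebra_simps)
  qed (rule exp_ge_add_one_self)
  also have "\<dots> = exp (real n * p * (exp t - 1))" by (simp add: exp_of_nat_mult[symmetric] mult_ac)
  finally show "expectation (\<lambda>\<omega>. exp (t * real (card {i. i < n \<and> W i \<omega> \<in> S}))) \<le> exp (real n * p * (exp t - 1))" .
qed

lemma count_measurable:
  assumes "\<And>i. W i \<in> measurable M N" "S \<in> sets N"
  shows "(\<lambda>\<omega>. real (card {i. i < (n::nat) \<and> W i \<omega> \<in> S})) \<in> borel_measurable M"
proof -
  note assms [measurable]
  have "real (card {i. i < n \<and> W i \<omega> \<in> S}) = (\<Sum>i<n. indicat_real S (W i \<omega>))" for \<omega>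
    by (simp add: indicator_def sum.If_cases Collect_conj_eq lessThan_def)
  then show ?thesis by simp
qed

text \<open>The Chernoff bound with t = -1 below and t = 1 above. As e lies between 5/2 and 3, the
  exponents are at most np (2/5 - 1 + 1/2) = -np / 10 and np (3 - 1 - 3) = -np; this is where the
  factors 1/2, 3 and 10 come from.\<close>

lemma count_tails:
  assumes indep: "indep_vars (\<lambda>_. N) W UNIV" and S: "S \<in> sets N"
    and p: "\<And>i. prob {\<omega> \<in> space M. W i \<omega> \<in> S} = p"
  shows "prob {\<omega> \<in> space M. \<not> (real n * p / 2 \<le> real (card {i. i < n \<and> W i \<omega> \<in> S}) \<and>
      real (card {i. i < n \<and> W i \<omega> \<in> S}) \<le> 3 * real n * p)} \<le> 2 * exp (- real n * p / 10)"
proof -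
  define Z where "Z \<omega> = real (card {i. i < n \<and> W i \<omega> \<in> S})" for \<omega>
  have Z [measurable]: "Z \<in> borel_measurable M"
    unfolding Z_def using indep S by (intro count_measurable) (auto simp: indep_vars_def)
  have np: "0 \<le> real n * p" using p[of 0] measure_nonneg[of M] by (metis mult_nonneg_nonneg of_nat_0_le_iff)
  have tail: "prob {\<omega> \<in> space M. u \<le> t * Z \<omega>} \<le> exp (real n * p * (exp t - 1) - u)" for t u
  proof -
    have "prob {\<omega> \<in> space M. exp u \<le> exp (t * Z \<omega>)} \<le> expectation (\<lambda>\<omega>. exp (t * Z \<omega>)) / exp u"
      unfolding Z_def
      by (rule integral_Markov_inequality_measure[OF expectation_exp_count_le(1)[OF indep S p], where A = "{}", unfolded Diff_empty]) auto
    also have "\<dots> \<le> exp (real n * p * (exp t - 1)) / exp u"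
      unfolding Z_def by (intro divide_right_mono expectation_exp_count_le(2)[OF indep S p]) simp
    finally show ?thesis by (simp add: exp_diff)
  qed
  have e: "exp (1 :: real) \<le> 3" "exp (- 1 :: real) \<le> 2/5"
  proof -
    show "exp (1 :: real) \<le> 3" by (rule exp_le)
    have "1 + 1 + 1\<^sup>2 / 2 \<le> exp (1 :: real)" by (rule exp_lower_Taylor_quadratic) simp
    then show "exp (- 1 :: real) \<le> 2/5" by (simp add: exp_minus field_simps)
  qed
  have "{\<omega> \<in> space M. \<not> (real n * p / 2 \<le> Z \<omega> \<and> Z \<omega> \<le> 3 * real n * p)} \<subseteq>
      {\<omega> \<in> space M. - (real n * p / 2) \<le> - 1 * Z \<omega>} \<union> {\<omega> \<in> space M. 3 * real n * p \<le> 1 * Z \<omega>}"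
    by auto
  then have "prob {\<omega> \<in> space M. \<not> (real n * p / 2 \<le> Z \<omega> \<and> Z \<omega> \<le> 3 * real n * p)} \<le>
      prob ({\<omega> \<in> space M. - (real n * p / 2) \<le> - 1 * Z \<omega>} \<union> {\<omega> \<in> space M. 3 * real n * p \<le> 1 * Z \<omega>})"
    by (rule finite_measure_mono) measurable
  also have "\<dots> \<le> prob {\<omega> \<in> space M. - (real n * p / 2) \<le> - 1 * Z \<omega>} + prob {\<omega> \<in> space M. 3 * real n * p \<le> 1 * Z \<omega>}"
    by (rule measure_Un_le) measurable
  also have "\<dots> \<le> exp (real n * p * (exp (- 1) - 1) - - (real n * p / 2)) + exp (real n * p * (exp 1 - 1) - 3 * real n * p)"
    by (intro add_mono tail)
  also have "\<dots> \<le> exp (- real n * p / 10) + exp (- real n * p / 10)"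
  proof (intro add_mono; subst exp_le_cancel_iff)
    show "real n * p * (exp (- 1) - 1) - - (real n * p / 2) \<le> - real n * p / 10"
      using mult_left_mono[OF e(2) np] by (simp add: algebra_simps)
    show "real n * p * (exp 1 - 1) - 3 * real n * p \<le> - real n * p / 10"
      using mult_left_mono[OF e(1) np] np by (simp add: algebra_simps)
  qed
  finally show ?thesis unfolding Z_def by simp
qed

end

subsection \<open>The random design and the noise\<close>

lemma sigma_sets_vimage_subset:
  assumes "\<And>A. A \<in> sets N \<Longrightarrow> \<exists>B\<in>sets N'. Z -` A \<inter> \<Omega> = Z' -` B \<inter> \<Omega>"
  shows "sigma_sets \<Omega> {Z -` A \<inter> \<Omega> | A. A \<in> sets N} \<subseteq> sets (vimage_algebra \<Omega> Z' N')"
proof -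
  have "{Z -` A \<inter> \<Omega> | A. A \<in> sets N} \<subseteq> sets (vimage_algebra \<Omega> Z' N')"
  proof
    fix C assume "C \<in> {Z -` A \<inter> \<Omega> | A. A \<in> sets N}"
    then obtain A where A: "A \<in> sets N" "C = Z -` A \<inter> \<Omega>" by auto
    from assms[OF A(1)] obtain B where B: "B \<in> sets N'" "Z -` A \<inter> \<Omega> = Z' -` B \<inter> \<Omega>" ..
    show "C \<in> sets (vimage_algebra \<Omega> Z' N')"
      unfolding A(2) B(2) by (rule in_vimage_algebra[OF B(1)])
  qed
  from sets.sigma_sets_subset[OF this] show ?thesis unfolding space_vimage_algebra .
qed

text \<open>The two variables of \<open>indep_var\<close> share a value type, whereas a design point
  is a vector and an error a number. Composition with \<open>g\<close> brings both to one type, and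
  the generated sigma-algebra can only shrink.\<close>

lemma (in prob_space) indep_var_of_vimage_algebra:
  assumes indep: "indep_set (sets (vimage_algebra (space M) X N)) (sets (vimage_algebra (space M) E L))"
    and X: "X \<in> measurable M N" and E: "E \<in> measurable M L" and g: "g \<in> measurable N L"
  shows "indep_var L (\<lambda>\<omega>. g (X \<omega>)) L E"
proof -
  have 1: "sigma_sets (space M) {(\<lambda>\<omega>. g (X \<omega>)) -` A \<inter> space M | A. A \<in> sets L} \<subseteq> sets (vimage_algebra (space M) X N)"
  proof (rule sigma_sets_vimage_subset)
    fix A assume "A \<in> sets L"
    then have "g -` A \<inter> space N \<in> sets N" by (rule measurable_sets[OF g])
    moreover have "(\<lambda>\<omega>. g (X \<omega>)) -` A \<inter> space M = X -` (g -` A \<inter> space N) \<inter> space M"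
      using measurable_space[OF X] by auto
    ultimately show "\<exists>B\<in>sets N. (\<lambda>\<omega>. g (X \<omega>)) -` A \<inter> space M = X -` B \<inter> space M" by blast
  qed
  have 2: "sigma_sets (space M) {E -` A \<inter> space M | A. A \<in> sets L} \<subseteq> sets (vimage_algebra (space M) E L)"
    by (rule sigma_sets_vimage_subset) (rule bexI, rule refl)
  have "indep_set (sigma_sets (space M) {(\<lambda>\<omega>. g (X \<omega>)) -` A \<inter> space M | A. A \<in> sets L})
      (sigma_sets (space M) {E -` A \<inter> space M | A. A \<in> sets L})"
    unfolding indep_sets2_eq
  proof (intro conjI ballI)
    note i = indep[unfolded indep_sets2_eq]
    show "sigma_sets (space M) {(\<lambda>\<omega>. g (X \<omega>)) -` A \<inter> space M | A. A \<in> sets L} \<subseteq> events"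
      by (rule subset_trans[OF 1 conjunct1[OF i]])
    show "sigma_sets (space M) {E -` A \<inter> space M | A. A \<in> sets L} \<subseteq> events"
      by (rule subset_trans[OF 2 conjunct1[OF conjunct2[OF i]]])
    fix A B
    assume "A \<in> sigma_sets (space M) {(\<lambda>\<omega>. g (X \<omega>)) -` A \<inter> space M | A. A \<in> sets L}"
      "B \<in> sigma_sets (space M) {E -` A \<inter> space M | A. A \<in> sets L}"
    then show "prob (A \<inter> B) = prob A * prob B"
      by (intro indep_setD[OF indep] subsetD[OF 1] subsetD[OF 2])
  qed
  then show ?thesis
    unfolding indep_var_eq using measurable_compose[OF X g] E by (intro conjI)
qed

section \<open>The random design and its cell counts\<close>

locale iid_sample = prob_space M for M :: "'w measure" +
  fixes X :: "nat \<Rightarrow> 'w \<Rightarrow> real ^ 'd::finite" and \<epsilon> :: "nat \<Rightarrow> 'w \<Rightarrow> real"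
    and f :: "real ^ 'd \<Rightarrow> real" and a b \<sigma>2 :: real
  assumes indep: "indep_vars (\<lambda>_. borel) (\<lambda>i \<omega>. (X i \<omega>, \<epsilon> i \<omega>)) UNIV"
    and density: "distributed M lborel (X i) (\<lambda>x. ennreal (f x))"
    and f_zero: "x \<notin> cbox 0 1 \<Longrightarrow> f x = 0"
    and f_bounds: "x \<in> cbox 0 1 \<Longrightarrow> a \<le> f x \<and> f x \<le> b" and a_pos: "0 < a"
    and X_\<epsilon>_indep: "indep_set (sets (vimage_algebra (space M) (X i) borel)) (sets (vimage_algebra (space M) (\<epsilon> i) borel))"
    and \<epsilon>_int: "integrable M (\<epsilon> i)" "integrable M (\<lambda>\<omega>. (\<epsilon> i \<omega>)\<^sup>2)"
    and \<epsilon>_mean: "expectation (\<epsilon> i) = 0" and \<epsilon>_var: "expectation (\<lambda>\<omega>. (\<epsilon> i \<omega>)\<^sup>2) = \<sigma>2"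
begin

lemma X_measurable [measurable]: "X i \<in> borel_measurable M"
  using distributed_measurable[OF density[of i]] by simp

lemma \<epsilon>_measurable [measurable]: "\<epsilon> i \<in> borel_measurable M"
  using \<epsilon>_int(1)[of i] by simp

lemma b_nonneg: "0 \<le> b"
proof -
  have "(0 :: real ^ 'd) \<in> cbox 0 1" by (simp add: mem_unit_cbox_cart)
  then show ?thesis using f_bounds a_pos by fastforce
qed

lemma emeasure_X:
  assumes "S \<in> sets borel"
  shows "emeasure M {\<omega> \<in> space M. X i \<omega> \<in> S} = (\<integral>\<^sup>+x. ennreal (f x) * indicator S x \<partial>lborel)"
  using distributed_emeasure[OF density[of i], of S] assms by (simp add: vimage_def Int_def conj_commute)

lemma prob_X_eq:
  assumes "S \<in> sets borel"
  shows "prob {\<omega> \<in> space M. X i \<omega> \<in> S} = prob {\<omega> \<in> space M. X 0 \<omega> \<in> S}"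
  unfolding measure_def emeasure_X[OF assms] ..

lemma prob_X_le:
  assumes S: "S \<in> sets borel" "emeasure lborel S < \<infinity>"
  shows "prob {\<omega> \<in> space M. X i \<omega> \<in> S} \<le> b * measure lborel S"
proof -
  have "emeasure M {\<omega> \<in> space M. X i \<omega> \<in> S} \<le> (\<integral>\<^sup>+x. ennreal b * indicator S x \<partial>lborel)"
    unfolding emeasure_X[OF S(1)]
  proof (intro nn_integral_mono mult_right_mono ennreal_leI)
    show "f x \<le> b" for x using f_bounds[of x] f_zero[of x] b_nonneg by (cases "x \<in> cbox 0 1") auto
  qed simp
  also have "\<dots> = ennreal b * emeasure lborel S" using S by (simp add: nn_integral_cmult_indicator)
  also have "\<dots> = ennreal (b * measure lborel S)"
    using S b_nonneg by (simp add: emeasure_eq_ennreal_measure ennreal_mult)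
  finally show ?thesis
    unfolding emeasure_eq_measure using b_nonneg by (subst (asm) ennreal_le_iff) auto
qed

lemma prob_X_ge:
  assumes S: "S \<in> sets borel" "emeasure lborel S < \<infinity>" "S \<subseteq> cbox 0 1"
  shows "a * measure lborel S \<le> prob {\<omega> \<in> space M. X i \<omega> \<in> S}"
proof -
  have "ennreal (a * measure lborel S) = ennreal a * emeasure lborel S"
    using S a_pos by (simp add: emeasure_eq_ennreal_measure ennreal_mult)
  also have "\<dots> = (\<integral>\<^sup>+x. ennreal a * indicator S x \<partial>lborel)" using S by (simp add: nn_integral_cmult_indicator)
  also have "\<dots> \<le> (\<integral>\<^sup>+x. ennreal (f x) * indicator S x \<partial>lborel)"
  proof (intro nn_integral_mono)
    fix x show "ennreal a * indicator S x \<le> ennreal (f x) * indicator S x"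
      using f_bounds[of x] S(3) by (cases "x \<in> S") (auto intro!: ennreal_leI)
  qed
  also have "\<dots> = emeasure M {\<omega> \<in> space M. X i \<omega> \<in> S}" by (rule emeasure_X[OF S(1), symmetric])
  finally show ?thesis unfolding emeasure_eq_measure by (subst (asm) ennreal_le_iff) auto
qed

lemma AE_X_cube: "AE \<omega> in M. X i \<omega> \<in> cbox 0 1"
proof -
  have "emeasure M {\<omega> \<in> space M. X i \<omega> \<in> - cbox 0 1} = (\<integral>\<^sup>+x. ennreal (f x) * indicator (- cbox 0 1) x \<partial>lborel)"
    by (rule emeasure_X) simp
  also have "\<dots> = (\<integral>\<^sup>+x. 0 \<partial>(lborel :: (real ^ 'd) measure))"
    by (intro nn_integral_cong) (auto simp: f_zero indicator_def)
  finally show ?thesis by (intro AE_I[OF _ _ ]) (auto intro!: AE_I)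
qed

lemma measure_cell:
  assumes "m > 0"
  shows "measure lborel (cell m j :: (real ^ 'd) set) = 1 / real m ^ CARD('d)"
proof -
  have ne: "cell m j \<noteq> ({} :: (real ^ 'd) set)"
    using assms by (auto simp: mem_cell divide_right_mono intro!: exI[of _ "\<chi> k. real (j k) / real m"] simp flip: ex_in_conv)
  have "measure lborel (cell m j :: (real ^ 'd) set) =
      (\<Prod>k\<in>(UNIV :: 'd set). (real (j k) + 1) / real m - real (j k) / real m)"
    using content_cbox_cart[OF ne[unfolded cell_def]] by (simp add: cell_def)
  also have "\<dots> = (\<Prod>k\<in>(UNIV :: 'd set). 1 / real m)" by (simp add: add_divide_distrib)
  finally show ?thesis by (simp add: power_one_over)
qed

text \<open>A cell has volume 1 / m^d, hence probability between a / m^d and b / m^d. The event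
  results from the tail bound for one cell and a union bound over all m^d cells, intersected with
  the almost sure event that the design points lie in the cube.\<close>

lemma counts_event:
  assumes m: "m > 0"
  obtains A where "A \<in> events" "prob A \<ge> 1 - real m ^ CARD('d) * (2 * exp (- (real n * a / (10 * real m ^ CARD('d)))))"
    "\<And>\<omega>. \<omega> \<in> A \<Longrightarrow> \<omega> \<in> space M"
    "\<And>\<omega> i. \<omega> \<in> A \<Longrightarrow> i < n \<Longrightarrow> X i \<omega> \<in> cbox 0 1"
    "\<And>\<omega> j. \<omega> \<in> A \<Longrightarrow> \<forall>k. j k < m \<Longrightarrow> a / 2 * real n / real m ^ CARD('d) \<le> real (card {i. i < n \<and> X i \<omega> \<in> cell m j}) \<and>
        real (card {i. i < n \<and> X i \<omega> \<in> cell m j}) \<le> 3 * b * real n / real m ^ CARD('d)"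
proof -
  define N where "N = real m ^ CARD('d)"
  have N: "N > 0" using m by (simp add: N_def)
  define J where "J = Pi\<^sub>E (UNIV :: 'd set) (\<lambda>_. {..<m})"
  have J: "finite J" "real (card J) = N" by (simp_all add: J_def finite_PiE card_PiE N_def)
  define good where "good j \<omega> \<longleftrightarrow> a / 2 * real n / N \<le> real (card {i. i < n \<and> X i \<omega> \<in> cell m j}) \<and>
        real (card {i. i < n \<and> X i \<omega> \<in> cell m j}) \<le> 3 * b * real n / N" for j \<omega>
  have cell_sets: "cell m j \<in> sets borel" for j by (simp add: cell_def)
  have [measurable]: "(\<lambda>\<omega>. real (card {i. i < n \<and> X i \<omega> \<in> cell m j})) \<in> borel_measurable M" for j
    by (rule count_measurable[OF X_measurable cell_sets])
  have meas: "{\<omega> \<in> space M. \<not> good j \<omega>} \<in> events" for j unfolding good_def by measurable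
  have bad: "prob {\<omega> \<in> space M. \<not> good j \<omega>} \<le> 2 * exp (- (real n * a / (10 * N)))" if j: "j \<in> J" for j
  proof -
    define p where "p = prob {\<omega> \<in> space M. X 0 \<omega> \<in> cell m j}"
    have sub: "cell m j \<subseteq> (cbox 0 1 :: (real ^ 'd) set)"
    proof
      fix y assume y: "y \<in> cell m j"
      have "0 \<le> y $ k \<and> y $ k \<le> 1" for k
      proof -
        have "j k < m" using j by (auto simp: J_def PiE_iff)
        then have "real (j k) + 1 \<le> real m" by linarith
        then have "(real (j k) + 1) / real m \<le> 1" using m by simp
        moreover have "0 \<le> real (j k) / real m" by simp
        ultimately show ?thesis using y unfolding mem_cell by (meson order_trans)
      qed
      then show "y \<in> cbox 0 1" by (simp add: mem_unit_cbox_cart)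
    qed
    have fin: "emeasure lborel (cell m j :: (real ^ 'd) set) < \<infinity>"
      unfolding cell_def by (rule emeasure_bounded_finite) simp
    have p: "a / N \<le> p" "p \<le> b / N"
      using prob_X_ge[OF cell_sets fin sub, of 0] prob_X_le[OF cell_sets fin, of 0] measure_cell[OF m, of j]
      by (simp_all add: p_def N_def)
    \<comment> \<open>Independence over the observations is assumed of the pairs, so the cell is
      extended to a cylinder in the space of pairs.\<close>
    have "prob {\<omega> \<in> space M. \<not> (real n * p / 2 \<le> real (card {i. i < n \<and> (X i \<omega>, \<epsilon> i \<omega>) \<in> cell m j \<times> UNIV}) \<and>
        real (card {i. i < n \<and> (X i \<omega>, \<epsilon> i \<omega>) \<in> cell m j \<times> UNIV}) \<le> 3 * real n * p)} \<le> 2 * exp (- real n * p / 10)"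
    proof (rule count_tails[OF indep])
      show "cell m j \<times> UNIV \<in> sets (borel :: ((real ^ 'd) \<times> real) measure)"
        using cell_sets by (intro borel_Times) auto
      show "prob {\<omega> \<in> space M. (X i \<omega>, \<epsilon> i \<omega>) \<in> cell m j \<times> UNIV} = p" for i
        using prob_X_eq[OF cell_sets, of i] by (simp add: p_def)
    qed
    then have tails: "prob {\<omega> \<in> space M. \<not> (real n * p / 2 \<le> real (card {i. i < n \<and> X i \<omega> \<in> cell m j}) \<and>
        real (card {i. i < n \<and> X i \<omega> \<in> cell m j}) \<le> 3 * real n * p)} \<le> 2 * exp (- real n * p / 10)"
      by simp
    have "a / 2 * real n / N \<le> real n * p / 2" "3 * real n * p \<le> 3 * b * real n / N"
      using mult_left_mono[OF p(1), of "real n"] mult_left_mono[OF p(2), of "3 * real n"] by (simp_all add: field_simps)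
    then have "{\<omega> \<in> space M. \<not> good j \<omega>} \<subseteq> {\<omega> \<in> space M. \<not> (real n * p / 2 \<le> real (card {i. i < n \<and> X i \<omega> \<in> cell m j}) \<and>
        real (card {i. i < n \<and> X i \<omega> \<in> cell m j}) \<le> 3 * real n * p)}"
      unfolding good_def by (intro Collect_mono) linarith
    then have "prob {\<omega> \<in> space M. \<not> good j \<omega>} \<le> prob {\<omega> \<in> space M. \<not> (real n * p / 2 \<le> real (card {i. i < n \<and> X i \<omega> \<in> cell m j}) \<and>
        real (card {i. i < n \<and> X i \<omega> \<in> cell m j}) \<le> 3 * real n * p)}"
      by (rule finite_measure_mono) measurable
    also have "\<dots> \<le> 2 * exp (- real n * p / 10)" by (rule tails)
    also have "\<dots> \<le> 2 * exp (- (real n * a / (10 * N)))"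
      using mult_left_mono[OF p(1), of "real n"] by (simp add: field_simps)
    finally show ?thesis .
  qed
  define D where "D = {\<omega> \<in> space M. \<forall>i<n. X i \<omega> \<in> cbox 0 1}"
  have D: "D \<in> events" unfolding D_def by measurable
  have "AE \<omega> in M. \<forall>i<n. X i \<omega> \<in> cbox 0 1" using AE_X_cube by (intro AE_all_countable[THEN iffD2] allI AE_impI)
  then have "prob D = 1" unfolding D_def by (intro prob_Collect_eq_1[THEN iffD2]) auto
  define B where "B = (\<Union>j\<in>J. {\<omega> \<in> space M. \<not> good j \<omega>})"
  have B: "B \<in> events" unfolding B_def using J(1) meas by (intro sets.finite_UN) auto
  have "prob B \<le> (\<Sum>j\<in>J. prob {\<omega> \<in> space M. \<not> good j \<omega>})"
    unfolding B_def using J(1) meas by (intro measure_UNION_le) auto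
  also have "\<dots> \<le> (\<Sum>j\<in>J. 2 * exp (- (real n * a / (10 * N))))" by (intro sum_mono bad)
  also have "\<dots> = N * (2 * exp (- (real n * a / (10 * N))))" by (simp add: J)
  finally have PB: "prob B \<le> N * (2 * exp (- (real n * a / (10 * N))))" .
  have "prob (D - B) \<ge> prob D - prob B"
    using finite_measure_Diff'[OF D B] finite_measure_mono[of "D \<inter> B" B] B by simp
  then have "prob (D - B) \<ge> 1 - N * (2 * exp (- (real n * a / (10 * N))))"
    using PB \<open>prob D = 1\<close> by simp
  moreover have "good j \<omega>" if "\<omega> \<in> D - B" "\<forall>k. j k < m" for j \<omega>
    using that by (auto simp: B_def D_def J_def)
  ultimately show ?thesis
    using D B by (intro that[of "D - B"]) (auto simp: N_def[symmetric] good_def D_def)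
qed

end

section \<open>Second moments of the noise part of the score\<close>

locale noisy_sample = iid_sample M X \<epsilon> f a b \<sigma>2 + kernel K C\<^sub>1 Km \<kappa> \<alpha> \<beta>
  for M :: "'w measure" and X :: "nat \<Rightarrow> 'w \<Rightarrow> real ^ 'd::finite" and \<epsilon> :: "nat \<Rightarrow> 'w \<Rightarrow> real"
    and f :: "real ^ 'd \<Rightarrow> real" and a b \<sigma>2 :: real and K :: "real \<Rightarrow> real" and C\<^sub>1 Km \<kappa> \<alpha> \<beta> :: real
begin

text \<open>The indicator makes the weight globally bounded: for points outside the cube the
  normalizing integrals can be arbitrarily small. Design points lie in the cube almost surely, so
  nothing changes on the good event.\<close>

definition weight :: "real ^ 'd \<Rightarrow> 'd option \<Rightarrow> real ^ 'd \<Rightarrow> real ^ 'd \<Rightarrow> real" where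
  "weight h l x y = indicator (cbox 0 1) y * (design h y l x * K_h K h y x)"

lemma weight_measurable_pair: "(\<lambda>p. weight h l (snd p) (fst p)) \<in> borel_measurable (borel \<Otimes>\<^sub>M borel)"
proof -
  have K [measurable]: "K \<in> borel_measurable borel" using K_cont by (rule borel_measurable_continuous_onI)
  have nth [measurable]: "(\<lambda>y :: real ^ 'd. y $ k) \<in> borel_measurable borel" for k
    by (intro borel_measurable_continuous_onI continuous_intros)
  have "(\<lambda>y :: real ^ 'd. (LBINT t:{0..1}. K ((y $ k - t) / h $ k))) \<in> borel_measurable borel" for k
    unfolding set_lebesgue_integral_def by measurable
  then have [measurable]: "(\<lambda>p. K_h K h (fst p) (snd p)) \<in> borel_measurable (borel \<Otimes>\<^sub>M borel)"
    unfolding K_h_def by measurable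
  have [measurable]: "(\<lambda>p. design h (fst p) l (snd p)) \<in> borel_measurable (borel \<Otimes>\<^sub>M borel)"
    by (cases l) (simp_all add: design_def)
  show ?thesis unfolding weight_def by measurable
qed

lemma weight_measurable [measurable]: "weight h l x \<in> borel_measurable borel"
  using measurable_compose[OF measurable_Pair2'[of x borel borel] weight_measurable_pair[of h l]] by simp

context
  fixes h :: "real ^ 'd"
  assumes h: "\<And>k. h $ k > 0" "\<And>k. \<beta> * h $ k \<le> 1/2"
begin

definition "wbound = (1 + C\<^sub>1) * (Kup ^ CARD('d) / (\<Prod>k\<in>UNIV. h $ k))"

lemma weight_bound:
  "\<bar>weight h l x y\<bar> \<le> wbound * indicator (cbox (x - C\<^sub>1 *\<^sub>R h) (x + C\<^sub>1 *\<^sub>R h)) y"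
proof (cases "y \<in> cbox 0 1 \<and> K_h K h y x \<noteq> 0")
  case True
  then have y: "y \<in> cbox 0 1" "K_h K h y x \<noteq> 0" by auto
  note d = design_abs_le[OF h y]
  have "y \<in> cbox (x - C\<^sub>1 *\<^sub>R h) (x + C\<^sub>1 *\<^sub>R h)"
    using d(1) by (auto simp: mem_box_cart abs_le_iff algebra_simps)
  moreover have "\<bar>design h y l x * K_h K h y x\<bar> \<le> wbound"
    unfolding wbound_def abs_mult using d(2) K_h_nonneg[OF h y(1)] K_h_le[OF h y(1)] C\<^sub>1_pos
    by (intro mult_mono) auto
  ultimately show ?thesis using y by (simp add: weight_def)
next
  case False
  have "0 \<le> wbound" unfolding wbound_def using C\<^sub>1_pos Kup_pos h(1)
    by (intro mult_nonneg_nonneg divide_nonneg_nonneg prod_nonneg) (auto simp: less_imp_le)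
  then show ?thesis using False by (auto simp: weight_def)
qed

lemma measure_window: "measure lborel (cbox (x - C\<^sub>1 *\<^sub>R h) (x + C\<^sub>1 *\<^sub>R h)) = (2 * C\<^sub>1) ^ CARD('d) * (\<Prod>k\<in>UNIV. h $ k)"
proof -
  have pos: "0 \<le> C\<^sub>1 * h $ k" for k using C\<^sub>1_pos h(1)[of k] by simp
  have "x \<in> cbox (x - C\<^sub>1 *\<^sub>R h) (x + C\<^sub>1 *\<^sub>R h)" using pos by (simp add: mem_box_cart)
  then have "measure lborel (cbox (x - C\<^sub>1 *\<^sub>R h) (x + C\<^sub>1 *\<^sub>R h)) =
      (\<Prod>k\<in>UNIV. (x + C\<^sub>1 *\<^sub>R h) $ k - (x - C\<^sub>1 *\<^sub>R h) $ k)"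
    by (intro content_cbox_cart) auto
  also have "\<dots> = (\<Prod>k\<in>UNIV. (2 * C\<^sub>1) * h $ k)" by (intro prod.cong) auto
  finally show ?thesis by (simp only: prod_const_times)
qed

text \<open>Of order 1 / h^d: the squared weight is at most of order h^(-2d), and a design point
  falls into its window with probability of order h^d.\<close>

definition "noise_var = \<sigma>2 * (wbound\<^sup>2 * (b * ((2 * C\<^sub>1) ^ CARD('d) * (\<Prod>k\<in>UNIV. h $ k))))"

lemma summand_moments:
  shows "integrable M (\<lambda>\<omega>. \<epsilon> i \<omega> * weight h l x (X i \<omega>))"
    and "expectation (\<lambda>\<omega>. \<epsilon> i \<omega> * weight h l x (X i \<omega>)) = 0"
    and "integrable M (\<lambda>\<omega>. (\<epsilon> i \<omega> * weight h l x (X i \<omega>))\<^sup>2)"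
    and "expectation (\<lambda>\<omega>. (\<epsilon> i \<omega> * weight h l x (X i \<omega>))\<^sup>2) \<le> noise_var"
proof -
  have wb: "0 \<le> wbound" unfolding wbound_def using C\<^sub>1_pos Kup_pos h(1)
    by (intro mult_nonneg_nonneg divide_nonneg_nonneg prod_nonneg) (auto simp: less_imp_le)
  define S where "S = cbox (x - C\<^sub>1 *\<^sub>R h) (x + C\<^sub>1 *\<^sub>R h)"
  have S [measurable]: "S \<in> sets borel" by (simp add: S_def)
  have bound: "\<bar>weight h l x y\<bar> \<le> wbound" for y
    using weight_bound[of l x y] wb by (cases "y \<in> cbox (x - C\<^sub>1 *\<^sub>R h) (x + C\<^sub>1 *\<^sub>R h)") auto
  have bsq: "(weight h l x y)\<^sup>2 \<le> wbound\<^sup>2" for y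
    using power_mono[OF bound[of y], of 2] by simp
  have bound2: "(weight h l x y)\<^sup>2 \<le> wbound\<^sup>2 * indicator S y" for y
    using power_mono[OF weight_bound[of l x y], of 2] by (cases "y \<in> S") (auto simp: S_def)
  have ind1: "indep_var borel (\<lambda>\<omega>. weight h l x (X i \<omega>)) borel (\<epsilon> i)"
    by (rule indep_var_of_vimage_algebra[OF X_\<epsilon>_indep[of i]]) measurable
  have i1: "integrable M (\<lambda>\<omega>. weight h l x (X i \<omega>))"
    by (rule integrable_const_bound[where B = wbound]) (use bound in auto)
  show "integrable M (\<lambda>\<omega>. \<epsilon> i \<omega> * weight h l x (X i \<omega>))"
    using indep_var_integrable[OF ind1 i1 \<epsilon>_int(1)] by (simp add: mult.commute)
  show "expectation (\<lambda>\<omega>. \<epsilon> i \<omega> * weight h l x (X i \<omega>)) = 0"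
    using indep_var_lebesgue_integral[OF ind1 i1 \<epsilon>_int(1)] \<epsilon>_mean by (simp add: mult.commute)
  have ind2: "indep_var borel (\<lambda>\<omega>. (weight h l x (X i \<omega>))\<^sup>2) borel (\<lambda>\<omega>. (\<epsilon> i \<omega>)\<^sup>2)"
    using indep_var_compose[OF ind1, of "\<lambda>u. u\<^sup>2" borel "\<lambda>u. u\<^sup>2" borel] by (simp add: o_def)
  have i2: "integrable M (\<lambda>\<omega>. (weight h l x (X i \<omega>))\<^sup>2)"
    by (rule integrable_const_bound[where B = "wbound\<^sup>2"])
      (use bsq in simp_all)
  show "integrable M (\<lambda>\<omega>. (\<epsilon> i \<omega> * weight h l x (X i \<omega>))\<^sup>2)"
    using indep_var_integrable[OF ind2 i2 \<epsilon>_int(2)] by (simp add: mult.commute power_mult_distrib)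
  have i3: "integrable M (\<lambda>\<omega>. wbound\<^sup>2 * indicat_real {\<omega> \<in> space M. X i \<omega> \<in> S} \<omega>)"
    by (intro integrable_mult_right integrable_real_indicator) (auto simp: emeasure_eq_measure)
  have eq: "expectation (\<lambda>\<omega>. (\<epsilon> i \<omega> * weight h l x (X i \<omega>))\<^sup>2) = \<sigma>2 * expectation (\<lambda>\<omega>. (weight h l x (X i \<omega>))\<^sup>2)"
    using indep_var_lebesgue_integral[OF ind2 i2 \<epsilon>_int(2)] \<epsilon>_var by (simp add: mult.commute power_mult_distrib)
  have "expectation (\<lambda>\<omega>. (weight h l x (X i \<omega>))\<^sup>2) \<le> expectation (\<lambda>\<omega>. wbound\<^sup>2 * indicat_real {\<omega> \<in> space M. X i \<omega> \<in> S} \<omega>)"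
    by (rule integral_mono[OF i2 i3]) (use bound2 in \<open>auto simp: indicator_def\<close>)
  also have "\<dots> = wbound\<^sup>2 * prob {\<omega> \<in> space M. X i \<omega> \<in> S}" by simp
  also have "\<dots> \<le> wbound\<^sup>2 * (b * measure lborel S)"
    by (intro mult_left_mono prob_X_le S) (auto simp: S_def b_nonneg simp del: infinity_ennreal_def intro!: emeasure_bounded_finite)
  also have "\<dots> = wbound\<^sup>2 * (b * ((2 * C\<^sub>1) ^ CARD('d) * (\<Prod>k\<in>UNIV. h $ k)))" by (simp add: S_def measure_window)
  finally have le: "expectation (\<lambda>\<omega>. (weight h l x (X i \<omega>))\<^sup>2) \<le> wbound\<^sup>2 * (b * ((2 * C\<^sub>1) ^ CARD('d) * (\<Prod>k\<in>UNIV. h $ k)))" .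
  have "0 \<le> \<sigma>2" unfolding \<epsilon>_var[of i, symmetric] by simp
  then show "expectation (\<lambda>\<omega>. (\<epsilon> i \<omega> * weight h l x (X i \<omega>))\<^sup>2) \<le> noise_var"
    unfolding noise_var_def eq by (rule mult_left_mono[OF le])
qed

definition noise :: "nat \<Rightarrow> 'w \<Rightarrow> 'd field" where
  "noise n \<omega> l x = 1 / real n * (\<Sum>i<n. \<epsilon> i \<omega> * weight h l x (X i \<omega>))"

lemma noise_second_moment:
  assumes n: "n > 0"
  shows "(\<integral>\<^sup>+\<omega>. ennreal ((noise n \<omega> l x)\<^sup>2) \<partial>M) \<le> ennreal (noise_var / real n)"
proof -
  define W where "W i \<omega> = \<epsilon> i \<omega> * weight h l x (X i \<omega>)" for i \<omega>
  have ind: "indep_vars (\<lambda>_. borel) W {..<n}"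
  proof -
    have "(\<lambda>p. snd p * weight h l x (fst p)) \<in> borel_measurable borel"
      unfolding borel_prod[symmetric] by measurable
    then have "indep_vars (\<lambda>_. borel) (\<lambda>i \<omega>. (\<lambda>p. snd p * weight h l x (fst p)) (X i \<omega>, \<epsilon> i \<omega>)) {..<n}"
      by (intro indep_vars_compose2[OF indep_vars_subset[OF indep]]) auto
    then show ?thesis by (simp add: W_def[abs_def])
  qed
  note W = second_moment_sum_indep[OF ind]
  have int: "integrable M (\<lambda>\<omega>. (\<Sum>i<n. W i \<omega>)\<^sup>2)"
    by (rule W(1)) (auto simp: W_def[abs_def] summand_moments)
  have "expectation (\<lambda>\<omega>. (\<Sum>i<n. W i \<omega>)\<^sup>2) = (\<Sum>i<n. expectation (\<lambda>\<omega>. (W i \<omega>)\<^sup>2))"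
    by (rule W(2)) (auto simp: W_def[abs_def] summand_moments)
  also have "\<dots> \<le> (\<Sum>i<n. noise_var)" by (intro sum_mono) (simp add: W_def summand_moments)
  finally have le: "expectation (\<lambda>\<omega>. (\<Sum>i<n. W i \<omega>)\<^sup>2) \<le> real n * noise_var" by simp
  have eq: "(noise n \<omega> l x)\<^sup>2 = 1 / (real n)\<^sup>2 * (\<Sum>i<n. W i \<omega>)\<^sup>2" for \<omega>
    by (simp add: noise_def W_def power_mult_distrib power_divide)
  have "(\<integral>\<^sup>+\<omega>. ennreal ((noise n \<omega> l x)\<^sup>2) \<partial>M) = ennreal (expectation (\<lambda>\<omega>. 1 / (real n)\<^sup>2 * (\<Sum>i<n. W i \<omega>)\<^sup>2))"
    unfolding eq using int by (intro nn_integral_eq_integral) auto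
  also have "expectation (\<lambda>\<omega>. 1 / (real n)\<^sup>2 * (\<Sum>i<n. W i \<omega>)\<^sup>2) = 1 / (real n)\<^sup>2 * expectation (\<lambda>\<omega>. (\<Sum>i<n. W i \<omega>)\<^sup>2)"
    by simp
  also have "ennreal \<dots> \<le> ennreal (1 / (real n)\<^sup>2 * (real n * noise_var))"
    by (intro ennreal_leI mult_left_mono le) simp
  also have "1 / (real n)\<^sup>2 * (real n * noise_var) = noise_var / real n" using n by (simp add: power2_eq_square)
  finally show ?thesis .
qed

text \<open>Fubini turns the pointwise variance bound into one for the expected integrated square,
  and Markov's inequality does the rest. \<open>Z\<close> has extended nonnegative values, so joint
  measurability is enough for this; square integrability of the noise is then read off on
  \<open>A\<close>.\<close>

lemma noise_event:
  assumes n: "n > 0" and \<delta>: "\<delta> > 0"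
  obtains A where "A \<in> events" "prob A \<ge> 1 - \<delta>"
    "\<And>\<omega>. \<omega> \<in> A \<Longrightarrow> noise n \<omega> \<in> F_full \<and> (norm_F (noise n \<omega>))\<^sup>2 \<le> real CARD('d option) * noise_var / (real n * \<delta>)"
proof -
  interpret MU: pair_sigma_finite M "unit_cube :: (real ^ 'd) measure" ..
  have id: "(\<lambda>x. x) \<in> measurable (unit_cube :: (real ^ 'd) measure) borel"
    by (rule borel_measurable_unit_cubeI) simp
  have snd: "snd \<in> measurable (M \<Otimes>\<^sub>M (unit_cube :: (real ^ 'd) measure)) borel"
    using measurable_compose[where f = snd and g = "\<lambda>x. x", OF measurable_snd[of M unit_cube] id] .
  have [measurable]: "(\<lambda>p. weight h l (snd p) (X i (fst p))) \<in> borel_measurable (M \<Otimes>\<^sub>M unit_cube)" for i l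
  proof -
    have "(\<lambda>p. (X i (fst p), snd p)) \<in> measurable (M \<Otimes>\<^sub>M (unit_cube :: (real ^ 'd) measure)) (borel \<Otimes>\<^sub>M borel)"
      by (intro measurable_Pair measurable_compose[OF measurable_fst X_measurable] snd)
    from measurable_compose[OF this weight_measurable_pair[of h l]] show ?thesis by simp
  qed
  have joint [measurable]: "(\<lambda>p. noise n (fst p) l (snd p)) \<in> borel_measurable (M \<Otimes>\<^sub>M unit_cube)" for l
    unfolding noise_def by measurable
  have noise_meas: "noise n \<omega> l \<in> borel_measurable unit_cube" if "\<omega> \<in> space M" for \<omega> l
    using measurable_compose[OF measurable_Pair1'[OF that] joint[of l]] by simp
  have pair: "(\<lambda>(\<omega>, x). ennreal ((noise n \<omega> l x)\<^sup>2)) \<in> borel_measurable (M \<Otimes>\<^sub>M unit_cube)" for l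
    unfolding case_prod_beta by measurable
  have inner_meas: "(\<lambda>\<omega>. \<integral>\<^sup>+x. ennreal ((noise n \<omega> l x)\<^sup>2) \<partial>unit_cube) \<in> borel_measurable M" for l
    by (rule unit_cube.borel_measurable_nn_integral[OF pair])
  define Z where "Z \<omega> = (\<Sum>l\<in>UNIV. \<integral>\<^sup>+x. ennreal ((noise n \<omega> l x)\<^sup>2) \<partial>unit_cube)" for \<omega>
  have Z_meas [measurable]: "Z \<in> borel_measurable M"
    unfolding Z_def by (intro borel_measurable_sum inner_meas)
  define V where "V = real CARD('d option) * noise_var / real n"
  have "0 \<le> expectation (\<lambda>\<omega>. (\<epsilon> 0 \<omega> * weight h None 0 (X 0 \<omega>))\<^sup>2)" by simp
  then have nv: "noise_var \<ge> 0" using summand_moments(4)[of 0 None 0] by (rule order_trans)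
  have V: "V \<ge> 0" using nv by (simp add: V_def)
  have "(\<integral>\<^sup>+\<omega>. Z \<omega> \<partial>M) = (\<Sum>l\<in>UNIV. \<integral>\<^sup>+\<omega>. \<integral>\<^sup>+x. ennreal ((noise n \<omega> l x)\<^sup>2) \<partial>unit_cube \<partial>M)"
    unfolding Z_def by (intro nn_integral_sum inner_meas)
  also have "\<dots> = (\<Sum>l\<in>UNIV. \<integral>\<^sup>+x. \<integral>\<^sup>+\<omega>. ennreal ((noise n \<omega> l x)\<^sup>2) \<partial>M \<partial>unit_cube)"
    by (intro sum.cong refl MU.Fubini'[OF pair, symmetric])
  also have "\<dots> \<le> (\<Sum>l\<in>(UNIV :: 'd option set). \<integral>\<^sup>+x. ennreal (noise_var / real n) \<partial>(unit_cube :: (real ^ 'd) measure))"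
    by (intro sum_mono nn_integral_mono noise_second_moment n)
  also have "\<dots> = ennreal V"
  proof -
    have "ennreal (real CARD('d option)) * ennreal (noise_var / real n) = ennreal V"
      unfolding V_def by (subst ennreal_mult[symmetric]) (use nv in auto)
    then show ?thesis
      unfolding nn_integral_const unit_cube.emeasure_space_1 mult_1_right sum_constant ennreal_of_nat_eq_real_of_nat .
  qed
  finally have EZ: "(\<integral>\<^sup>+\<omega>. Z \<omega> \<partial>M) \<le> ennreal V" .
  define A where "A = {\<omega> \<in> space M. Z \<omega> \<le> ennreal (V / \<delta>)}"
  have A: "A \<in> events" unfolding A_def by measurable
  show ?thesis
  proof (rule that[OF A])
    fix \<omega> assume \<omega>: "\<omega> \<in> A"
    then have Z\<omega>: "Z \<omega> \<le> ennreal (V / \<delta>)" and sp: "\<omega> \<in> space M" by (auto simp: A_def)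
    have "(\<integral>\<^sup>+x. ennreal ((noise n \<omega> l x)\<^sup>2) \<partial>unit_cube) \<le> Z \<omega>" for l
      unfolding Z_def by (rule member_le_sum) auto
    then have fin: "(\<integral>\<^sup>+x. ennreal ((noise n \<omega> l x)\<^sup>2) \<partial>unit_cube) < \<infinity>" for l
      using Z\<omega> by (metis ennreal_less_top infinity_ennreal_def le_less_trans)
    have int: "integrable unit_cube (\<lambda>x. (noise n \<omega> l x)\<^sup>2)" for l
      using noise_meas[OF sp, of l] fin[of l] by (intro integrableI_nonneg) auto
    have F: "noise n \<omega> \<in> F_full" using int noise_meas[OF sp] by (simp add: F_full_iff)
    have "ennreal ((norm_F (noise n \<omega>))\<^sup>2) = (\<Sum>l\<in>UNIV. ennreal (LINT x|unit_cube. (noise n \<omega> l x)\<^sup>2))"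
      unfolding norm_F_square inner_F_eq by (simp add: power2_eq_square sum_ennreal)
    also have "\<dots> = Z \<omega>" unfolding Z_def using int by (simp add: nn_integral_eq_integral)
    finally have "ennreal ((norm_F (noise n \<omega>))\<^sup>2) \<le> ennreal (V / \<delta>)" using Z\<omega> by simp
    then have "(norm_F (noise n \<omega>))\<^sup>2 \<le> V / \<delta>" using V \<delta> by (subst (asm) ennreal_le_iff) auto
    then show "noise n \<omega> \<in> F_full \<and> (norm_F (noise n \<omega>))\<^sup>2 \<le> real CARD('d option) * noise_var / (real n * \<delta>)"
      using F by (simp add: V_def)
  next
    show "prob A \<ge> 1 - \<delta>"
    \<comment> \<open>Markov's inequality is applied with the factor \<open>\<delta> / V\<close>;
      for \<open>V = 0\<close> the integrated square vanishes almost surely.\<close>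
    proof (cases "V = 0")
      case True
      then have "(\<integral>\<^sup>+\<omega>. Z \<omega> \<partial>M) = 0" using EZ by simp
      then have "AE \<omega> in M. Z \<omega> = 0" by (subst (asm) nn_integral_0_iff_AE) auto
      then have "AE \<omega> in M. Z \<omega> \<le> ennreal (V / \<delta>)" by (rule AE_mp) simp
      then have "prob A = 1" unfolding A_def by (intro prob_Collect_eq_1[THEN iffD2]) auto
      then show ?thesis using \<delta> by simp
    next
      case False
      then have Vpos: "V > 0" using V by simp
      have sub: "space M - A \<subseteq> {\<omega> \<in> space M. 1 \<le> ennreal (\<delta> / V) * Z \<omega>}"
      proof safe
        fix \<omega> assume "\<omega> \<in> space M" "\<omega> \<notin> A"
        then have "ennreal (V / \<delta>) \<le> Z \<omega>" by (simp add: A_def)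
        then have "ennreal (\<delta> / V) * ennreal (V / \<delta>) \<le> ennreal (\<delta> / V) * Z \<omega>" by (rule mult_left_mono) simp
        moreover have "ennreal (\<delta> / V) * ennreal (V / \<delta>) = 1" using Vpos \<delta> by (simp add: ennreal_mult[symmetric])
        ultimately show "1 \<le> ennreal (\<delta> / V) * Z \<omega>" by simp
      qed
      have "emeasure M (space M - A) \<le> emeasure M {\<omega> \<in> space M. 1 \<le> ennreal (\<delta> / V) * Z \<omega>}"
        by (rule emeasure_mono[OF sub]) measurable
      also have "\<dots> \<le> ennreal (\<delta> / V) * (\<integral>\<^sup>+\<omega>. Z \<omega> * indicator (space M) \<omega> \<partial>M)"
        by (rule nn_integral_Markov_inequality) auto
      also have "(\<integral>\<^sup>+\<omega>. Z \<omega> * indicator (space M) \<omega> \<partial>M) = (\<integral>\<^sup>+\<omega>. Z \<omega> \<partial>M)" by (intro nn_integral_cong) auto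
      also have "ennreal (\<delta> / V) * \<dots> \<le> ennreal (\<delta> / V) * ennreal V" by (intro mult_left_mono EZ) simp
      also have "\<dots> = ennreal \<delta>" using Vpos \<delta> by (simp add: ennreal_mult[symmetric])
      finally have "prob (space M - A) \<le> \<delta>" unfolding emeasure_eq_measure using \<delta> by simp
      then show ?thesis using A by (simp add: prob_compl)
    qed
  qed
qed

end

end

subsection \<open>The local linear bias\<close>

text \<open>By the support condition \<open>C\<^sub>1 / 2\<close> is a limit of points where
  \<open>K\<close> is positive; continuity spreads the positivity over a short interval to the right
  of such a point.\<close>

lemma kernel_exists:
  fixes K :: "real \<Rightarrow> real"
  assumes bdd: "bounded (range K)" and nonneg: "\<And>u. K u \<ge> 0"
    and supp: "C\<^sub>1 > 0" "closure {u. K u \<noteq> 0} = {- C\<^sub>1..C\<^sub>1}"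
    and sym: "\<And>u. K (- u) = K u" and lip: "\<exists>L. L-lipschitz_on UNIV K"
  shows "\<exists>Km \<kappa> \<alpha> \<beta>. kernel K C\<^sub>1 Km \<kappa> \<alpha> \<beta>"
proof -
  have cont: "continuous_on UNIV K" using lip lipschitz_on_continuous_on by blast
  obtain Km where bound: "\<forall>y\<in>range K. norm y \<le> Km" using bdd unfolding bounded_iff ..
  have Km: "K u \<le> Km" for u using bspec[OF bound rangeI, of u] by simp
  have "C\<^sub>1 / 2 \<in> closure {u. K u \<noteq> 0}" unfolding supp(2) using supp(1) by simp
  then have "\<exists>u\<in>{u. K u \<noteq> 0}. dist u (C\<^sub>1 / 2) < C\<^sub>1 / 4"
    unfolding closure_approachable using supp(1) by (elim allE[of _ "C\<^sub>1 / 4"]) simp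
  then obtain u0 where u0: "K u0 \<noteq> 0" "dist u0 (C\<^sub>1 / 2) < C\<^sub>1 / 4" by blast
  \<comment> \<open>Distance below \<open>C\<^sub>1 / 4\<close> keeps \<open>u0\<close> away from
    zero, so that it can serve as \<open>\<alpha>\<close>.\<close>
  have u0_pos: "u0 > C\<^sub>1 / 4" using u0(2) unfolding dist_real_def by linarith
  have K0: "K u0 > 0" using u0(1) nonneg[of u0] by simp
  have "isCont K u0" using cont by (simp add: continuous_on_eq_continuous_at)
  from this[unfolded continuous_at_eps_delta, rule_format, OF half_gt_zero[OF K0]]
  obtain s where s: "s > 0" "\<And>u. dist u u0 < s \<Longrightarrow> dist (K u) (K u0) < K u0 / 2"
    by blast
  have "K u0 / 2 \<le> K u" if "u \<in> {u0..u0 + s / 2}" for u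
  proof -
    have "\<bar>K u - K u0\<bar> < K u0 / 2" using s(2)[of u] s(1) that unfolding dist_real_def by simp
    then show ?thesis by linarith
  qed
  moreover have "K u = 0" if "\<bar>u\<bar> > C\<^sub>1" for u
  proof (rule ccontr)
    assume "K u \<noteq> 0"
    then have "u \<in> closure {u. K u \<noteq> 0}" by (intro subsetD[OF closure_subset]) simp
    then show False unfolding supp(2) using that by auto
  qed
  ultimately have "kernel K C\<^sub>1 Km (K u0 / 2) u0 (u0 + s / 2)"
    using cont nonneg Km sym K0 u0_pos supp(1) s(1) by unfold_locales auto
  then show ?thesis by blast
qed

section \<open>Taylor bound and the oracle tuple\<close>

lemma norm_matrix_vector_mult_le:
  fixes A :: "real ^ 'n::finite ^ 'm::finite"
  shows "norm (A *v v) \<le> real CARD('m) * norm A * norm v"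
proof -
  have "norm (A *v v) \<le> (\<Sum>i\<in>UNIV. \<bar>(A *v v) $ i\<bar>)" by (rule norm_le_l1_cart)
  also have "\<dots> \<le> (\<Sum>i\<in>(UNIV :: 'm set). norm A * norm v)"
  proof (rule sum_mono)
    fix i
    have "\<bar>(A *v v) $ i\<bar> = \<bar>(A $ i) \<bullet> v\<bar>" by (simp add: matrix_vector_mul_component)
    also have "\<dots> \<le> norm (A $ i) * norm v" by (rule Cauchy_Schwarz_ineq2)
    also have "\<dots> \<le> norm A * norm v" by (rule mult_right_mono[OF Finite_Cartesian_Product.norm_nth_le]) simp
    finally show "\<bar>(A *v v) $ i\<bar> \<le> norm A * norm v" .
  qed
  finally show ?thesis by (simp add: mult.assoc)
qed

text \<open>Compactness bounds the second derivative, so the gradient is Lipschitz with constant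
  \<open>B\<close>; the mean value inequality on the segment from \<open>x\<close> to
  \<open>y\<close>, applied to \<open>r\<close> minus its linear part at \<open>x\<close>, gives the
  remainder. Only derivatives within the convex set enter, so boundary points are included.\<close>

lemma C2_on_Taylor:
  fixes r :: "real ^ 'd::finite \<Rightarrow> real"
  assumes "C2_on S r" "compact S" "convex S"
  obtains g B where "B \<ge> 0" "continuous_on S g" "\<And>x. x \<in> S \<Longrightarrow> (r has_derivative (\<lambda>v. g x \<bullet> v)) (at x within S)"
    "\<And>x y. x \<in> S \<Longrightarrow> y \<in> S \<Longrightarrow> \<bar>r y - r x - g x \<bullet> (y - x)\<bar> \<le> B * (norm (y - x))\<^sup>2"
proof -
  from assms(1)[unfolded C2_on_def] obtain g H where H: "continuous_on S H"
    and r'': "\<forall>x\<in>S. (r has_derivative (\<lambda>v. g x \<bullet> v)) (at x within S)"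
    and g'': "\<forall>x\<in>S. (g has_derivative (\<lambda>v. H x *v v)) (at x within S)"
    by (elim exE conjE)
  note r' = bspec[OF r''] and g' = bspec[OF g'']
  have "compact (H ` S)" using H assms(2) by (rule compact_continuous_image)
  then have "\<exists>B0. \<forall>x\<in>S. norm (H x) \<le> B0"
    by (auto dest!: compact_imp_bounded simp: bounded_iff)
  then obtain B0 where B0: "\<And>x. x \<in> S \<Longrightarrow> norm (H x) \<le> B0" by blast
  define B where "B = real CARD('d) * \<bar>B0\<bar>"
  have B: "B \<ge> 0" by (simp add: B_def)
  have g_lip: "norm (g x - g y) \<le> B * norm (x - y)" if "x \<in> S" "y \<in> S" for x y
  proof (rule differentiable_bound[OF assms(3) g' _ that])
    fix z assume z: "z \<in> S"
    show "onorm ((*v) (H z)) \<le> B"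
    proof (rule onorm_le)
      fix v :: "real ^ 'd"
      have "real CARD('d) * norm (H z) * norm v \<le> B * norm v"
        unfolding B_def using B0[OF z] by (intro mult_right_mono mult_left_mono) auto
      then show "norm (H z *v v) \<le> B * norm v" using norm_matrix_vector_mult_le[of "H z" v] by linarith
    qed
  qed
  have g_cont: "continuous_on S g"
    by (rule has_derivative_continuous_on[OF g'])
  have "\<bar>r y - r x - g x \<bullet> (y - x)\<bar> \<le> B * (norm (y - x))\<^sup>2" if xy: "x \<in> S" "y \<in> S" for x y
  proof -
    define T where "T = closed_segment x y"
    have T: "T \<subseteq> S" unfolding T_def using xy assms(3) by (rule closed_segment_subset)
    have "norm ((r y - g x \<bullet> y) - (r x - g x \<bullet> x)) \<le> (B * norm (y - x)) * norm (y - x)"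
    proof (rule differentiable_bound[where S = T and f' = "\<lambda>z v. g z \<bullet> v - g x \<bullet> v"])
      show "convex T" by (simp add: T_def)
      show "y \<in> T" "x \<in> T" by (simp_all add: T_def)
      fix z assume z: "z \<in> T"
      have "(r has_derivative (\<lambda>v. g z \<bullet> v)) (at z within T)"
        using r' z T by (blast intro: has_derivative_subset)
      then show "((\<lambda>z. r z - g x \<bullet> z) has_derivative (\<lambda>v. g z \<bullet> v - g x \<bullet> v)) (at z within T)"
        by (auto intro!: derivative_eq_intros)
      show "onorm (\<lambda>v. g z \<bullet> v - g x \<bullet> v) \<le> B * norm (y - x)"
      proof (rule onorm_le)
        fix v :: "real ^ 'd"
        have "norm (z - x) \<le> norm (y - x)" using z segment_bound(1) by (auto simp: T_def)
        then have "B * norm (z - x) \<le> B * norm (y - x)" using B by (rule mult_left_mono)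
        moreover have "z \<in> S" using z T by blast
        ultimately have "norm (g z - g x) \<le> B * norm (y - x)"
          using g_lip[of z x] xy(1) by linarith
        then have "norm (g z - g x) * norm v \<le> B * norm (y - x) * norm v" by (intro mult_right_mono) auto
        then show "norm (g z \<bullet> v - g x \<bullet> v) \<le> B * norm (y - x) * norm v"
          using Cauchy_Schwarz_ineq2[of "g z - g x" v] by (simp add: inner_diff_left)
      qed
    qed
    then show ?thesis by (simp add: power2_eq_square inner_diff_right algebra_simps)
  qed
  with B g_cont r' show ?thesis by (rule that)
qed

text \<open>On a line in direction \<open>k\<close> the component \<open>c k\<close> equals
  \<open>r\<close> minus a constant, so it inherits the derivative \<open>g x $ k\<close>.
  Uniqueness of derivatives within [0, 1] shows that this number depends on \<open>x $ k\<close>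
  only.\<close>

lemma gradient_of_additive:
  fixes r :: "real ^ 'd::finite \<Rightarrow> real"
  assumes add: "\<And>x. x \<in> cbox 0 1 \<Longrightarrow> r x = r0 + (\<Sum>k\<in>UNIV. c k (x $ k))"
    and deriv: "\<And>x. x \<in> cbox 0 1 \<Longrightarrow> (r has_derivative (\<lambda>v. g x \<bullet> v)) (at x within cbox 0 1)"
    and x: "x \<in> cbox 0 1" and y: "y \<in> cbox 0 1" and eq: "x $ k = y $ k"
  shows "g x $ k = g y $ k"
proof -
  have *: "(c k has_vector_derivative g x $ k) (at (x $ k) within cbox 0 1)" if x: "x \<in> cbox 0 1" for x
  proof -
    have in_cube: "subst_coord k x t \<in> cbox 0 1" if "t \<in> cbox 0 1" for t
      using x that by (simp add: mem_unit_cbox_cart)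
    have x_eq: "subst_coord k x (x $ k) = x" by (simp add: vec_eq_iff)
    have line: "subst_coord k x t = x + (t - x $ k) *\<^sub>R axis k 1" for t
      by (simp add: vec_eq_iff axis_def)
    have "((\<lambda>t. x + (t - x $ k) *\<^sub>R axis k (1 :: real)) has_derivative (\<lambda>s. s *\<^sub>R axis k 1)) (at (x $ k) within cbox 0 1)"
      by (auto intro!: derivative_eq_intros)
    then have 1: "(subst_coord k x has_derivative (\<lambda>s. s *\<^sub>R axis k 1)) (at (x $ k) within cbox 0 1)"
      by (simp add: line[abs_def])
    have 2: "(r has_derivative (\<lambda>v. g x \<bullet> v)) (at (subst_coord k x (x $ k)) within subst_coord k x ` cbox 0 1)"
      unfolding x_eq using deriv[OF x] by (rule has_derivative_subset) (use in_cube in auto)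
    have 3: "((\<lambda>t. r (subst_coord k x t)) has_derivative (\<lambda>s. g x \<bullet> (s *\<^sub>R axis k 1))) (at (x $ k) within cbox 0 1)"
      using diff_chain_within[OF 1 2] by (simp add: o_def)
    define b where "b = r0 + (\<Sum>j\<in>UNIV - {k}. c j (x $ j))"
    have r_eq: "r (subst_coord k x t) = b + c k t" if "t \<in> cbox 0 1" for t
    proof -
      have "(\<Sum>j\<in>UNIV. c j (subst_coord k x t $ j)) = c k t + (\<Sum>j\<in>UNIV - {k}. c j (x $ j))"
        by (subst sum.remove[of _ k]) auto
      then show ?thesis using add[OF in_cube[OF that]] by (simp add: b_def)
    qed
    have xk: "x $ k \<in> cbox 0 1" using x by (simp add: mem_unit_cbox_cart)
    have "((\<lambda>t. r (subst_coord k x t) - b) has_derivative (\<lambda>s. g x \<bullet> (s *\<^sub>R axis k 1))) (at (x $ k) within cbox 0 1)"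
      using has_derivative_diff[OF 3 has_derivative_const[of b]] by simp
    then have "(c k has_derivative (\<lambda>s. g x \<bullet> (s *\<^sub>R axis k 1))) (at (x $ k) within cbox 0 1)"
      by (rule has_derivative_transform[OF xk, rotated]) (simp add: r_eq)
    then show ?thesis
      by (simp add: has_vector_derivative_def inner_axis mult.commute)
  qed
  show ?thesis
    using vector_derivative_unique_within_closed_interval[of 0 1 "x $ k" "c k" "g x $ k" "g y $ k"] *[OF x] *[OF y] x[unfolded mem_unit_cbox_cart, rule_format, of k] eq
    by simp
qed

lemma L2_continuous_on_cube:
  assumes "continuous_on (cbox 0 1) u" shows "L2 u"
proof (rule bounded_measurable_L2)
  have "compact (u ` cbox 0 1)" using assms by (rule compact_continuous_image) simp
  from compact_imp_bounded[OF this] obtain B where B: "\<forall>y\<in>u ` cbox 0 1. norm y \<le> B"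
    unfolding bounded_iff ..
  have "u \<in> borel_measurable (restrict_space borel (cbox 0 1))"
    using assms by (rule borel_measurable_continuous_on_restrict)
  then have "u \<in> borel_measurable unit_cube"
    unfolding measurable_cong_sets[OF sets_unit_cube refl] .
  then show "bounded_measurable u" using B by (auto simp: bounded_measurable_def)
qed

text \<open>The local linear target: value and partial derivatives of \<open>r\<close>, the latter
  scaled by the bandwidths because the regressors in \<open>design\<close> are divided by
  them.\<close>

definition oracle_F :: "(real ^ 'd::finite \<Rightarrow> real) \<Rightarrow> (real ^ 'd \<Rightarrow> real ^ 'd) \<Rightarrow> real ^ 'd \<Rightarrow> 'd field" where
  "oracle_F r g h l x = (case l of None \<Rightarrow> r x | Some k \<Rightarrow> h $ k * g x $ k)"

lemma oracle_F_add:
  fixes r :: "real ^ 'd::finite \<Rightarrow> real"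
  assumes add: "\<And>x. x \<in> cbox 0 1 \<Longrightarrow> r x = r0 + (\<Sum>k\<in>UNIV. c k (x $ k))"
    and deriv: "\<And>x. x \<in> cbox 0 1 \<Longrightarrow> (r has_derivative (\<lambda>v. g x \<bullet> v)) (at x within cbox 0 1)"
    and g: "continuous_on (cbox 0 1) g"
  shows "oracle_F r g h \<in> F_add"
proof -
  have r: "continuous_on (cbox 0 1) r"
    by (rule has_derivative_continuous_on[OF deriv])
  have "L2 (oracle_F r g h l)" for l
  proof (rule L2_continuous_on_cube, cases l)
    case None
    then show "continuous_on (cbox 0 1) (oracle_F r g h l)" using r by (simp add: oracle_F_def[abs_def])
  next
    case (Some k)
    then show "continuous_on (cbox 0 1) (oracle_F r g h l)"
      using g by (simp add: oracle_F_def[abs_def] continuous_intros)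
  qed
  then have F: "oracle_F r g h \<in> F_full" by (simp add: F_full_iff_L2)
  show ?thesis
    unfolding F_add_def
  proof (intro CollectI conjI allI F)
    \<comment> \<open>\<open>F_add\<close> has no slot for a separate constant, so \<open>r0\<close>
      is shared equally among the components.\<close>
    show "\<exists>m. \<forall>x\<in>cbox 0 1. oracle_F r g h None x = (\<Sum>k\<in>UNIV. m k (x $ k))"
      by (rule exI[of _ "\<lambda>k t. r0 / real CARD('d) + c k t"]) (simp add: oracle_F_def add sum.distrib)
    show "\<exists>q. \<forall>x\<in>cbox 0 1. oracle_F r g h (Some k) x = q (x $ k)" for k
    proof (intro exI[of _ "\<lambda>t. h $ k * g (subst_coord k 0 t) $ k"] ballI)
      fix x :: "real ^ 'd" assume x: "x \<in> cbox 0 1"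
      have "subst_coord k 0 (x $ k) \<in> cbox 0 1" using x by (simp add: mem_unit_cbox_cart)
      then have "g x $ k = g (subst_coord k 0 (x $ k)) $ k"
        by (intro gradient_of_additive[OF add deriv x]) auto
      then show "oracle_F r g h (Some k) x = h $ k * g (subst_coord k 0 (x $ k)) $ k"
        by (simp add: oracle_F_def)
    qed
  qed
qed

lemma local_fit_oracle_F:
  assumes "\<And>k. h $ k > 0"
  shows "local_fit h X (oracle_F r g h) x = r x + g x \<bullet> (X - x)"
proof -
  have "h $ k * g x $ k * ((X $ k - x $ k) / h $ k) = g x $ k * (X $ k - x $ k)" for k
    using assms[of k] by simp
  then show ?thesis unfolding local_fit_eq by (simp add: oracle_F_def inner_vec_def)
qed

lemma norm_F_le_bound:
  fixes r :: "'d::finite field"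
  assumes "r \<in> F_full" "\<And>l x. x \<in> cbox 0 1 \<Longrightarrow> \<bar>r l x\<bar> \<le> B"
  shows "norm_F r \<le> real CARD('d option) * B"
proof -
  have "(0 :: real ^ 'd) \<in> cbox 0 1" by (simp add: mem_unit_cbox_cart)
  then have B: "B \<ge> 0" using assms(2)[of 0 None] by linarith
  have "(norm_F r)\<^sup>2 = (\<Sum>l\<in>UNIV. LINT x|unit_cube. (r l x)\<^sup>2)"
    unfolding norm_F_square inner_F_eq by (simp add: power2_eq_square)
  also have "\<dots> \<le> (\<Sum>l\<in>(UNIV :: 'd option set). B\<^sup>2)"
  proof (rule sum_mono)
    fix l
    show "(LINT x|unit_cube. (r l x)\<^sup>2) \<le> B\<^sup>2"
    proof (rule unit_cube.integral_le_const)
      show "integrable unit_cube (\<lambda>x. (r l x)\<^sup>2)" using assms(1) by (simp add: F_full_iff)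
      show "AE x in unit_cube. (r l x)\<^sup>2 \<le> B\<^sup>2"
      proof (rule AE_I2)
        fix x :: "real ^ 'd" assume "x \<in> space unit_cube"
        then have "\<bar>r l x\<bar> \<le> B" by (intro assms(2)) simp
        from power_mono[OF this abs_ge_zero, of 2] show "(r l x)\<^sup>2 \<le> B\<^sup>2" by (simp only: power2_abs)
      qed
    qed
  qed
  also have "\<dots> = real CARD('d option) * B\<^sup>2" by (simp only: sum_constant)
  also have "\<dots> \<le> (real CARD('d option))\<^sup>2 * B\<^sup>2"
    by (intro mult_right_mono self_le_power) simp_all
  finally have "(norm_F r)\<^sup>2 \<le> (real CARD('d option) * B)\<^sup>2" unfolding power_mult_distrib .
  then show ?thesis by (rule power2_le_imp_le) (rule mult_nonneg_nonneg[OF of_nat_0_le_iff B])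
qed

subsection \<open>The estimators on the good event\<close>

definition arg_min_if_exists :: "('b \<Rightarrow> real) \<Rightarrow> ('b \<Rightarrow> bool) \<Rightarrow> 'b \<Rightarrow> bool" where
  "arg_min_if_exists J P q \<longleftrightarrow> ((\<exists>r. is_arg_min J P r) \<longrightarrow> is_arg_min J P q)"

context noisy_sample
begin

text \<open>\<open>ell_lo\<close> and \<open>ell_hi\<close> are the constants of the two Gram bounds
  for the count factors \<open>a / 2\<close> and \<open>3 * b\<close> of the Chernoff event. Mesh
  and bandwidths enter through \<open>M0\<close> only, so both are free of n.\<close>

definition ell_lo :: "real \<Rightarrow> real" where
  "ell_lo M0 = a / 2 * (Klo / M0) ^ CARD('d) / (2 + (1 + \<beta>) * (4 * real CARD('d) / (\<beta> - \<alpha>)))\<^sup>2"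

definition ell_hi :: "real \<Rightarrow> real" where
  "ell_hi M0 = real CARD('d option) * (1 + C\<^sub>1)\<^sup>2 * (2 * (C\<^sub>1 * M0) + 2) ^ CARD('d) * (3 * b) *
      (Kup * ((\<beta> - \<alpha>) / (2 * (real CARD('d) + 2)))) ^ CARD('d)"

text \<open>What remains of the noise variances of all d + 1 components once the inverse product of
  the bandwidths is split off.\<close>

definition noise_const :: real where
  "noise_const = real CARD('d option) * (\<sigma>2 * ((1 + C\<^sub>1)\<^sup>2 * (Kup ^ CARD('d))\<^sup>2 * (b * (2 * C\<^sub>1) ^ CARD('d))))"

lemma ell_lo_pos: "M0 > 0 \<Longrightarrow> 0 < ell_lo M0"
proof -
  assume "M0 > 0"
  have "0 \<le> (1 + \<beta>) * (4 * real CARD('d) / (\<beta> - \<alpha>))"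
    using \<alpha>_less \<beta>_pos by (intro mult_nonneg_nonneg divide_nonneg_nonneg) auto
  then have "0 < 2 + (1 + \<beta>) * (4 * real CARD('d) / (\<beta> - \<alpha>))" by linarith
  then show "0 < ell_lo M0"
    unfolding ell_lo_def using a_pos Klo_pos \<open>M0 > 0\<close>
    by (intro divide_pos_pos mult_pos_pos zero_less_power) auto
qed

lemma ell_hi_nonneg: "M0 > 0 \<Longrightarrow> 0 \<le> ell_hi M0"
  unfolding ell_hi_def using C\<^sub>1_pos b_nonneg Kup_pos \<alpha>_less
  by (intro mult_nonneg_nonneg zero_le_power add_nonneg_nonneg divide_nonneg_nonneg) auto

lemma noise_var_eq:
  fixes h :: "real ^ 'd"
  assumes h: "\<And>k. h $ k > 0" "\<And>k. \<beta> * h $ k \<le> 1/2"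
  shows "real CARD('d option) * noise_var h = noise_const / (\<Prod>k\<in>UNIV. h $ k)"
proof -
  define P where "P = (\<Prod>k\<in>UNIV. h $ k)"
  have P: "P > 0" unfolding P_def using h(1) by (intro prod_pos) simp
  have "noise_var h = \<sigma>2 * ((1 + C\<^sub>1)\<^sup>2 * (Kup ^ CARD('d))\<^sup>2 * (b * (2 * C\<^sub>1) ^ CARD('d))) / P"
    unfolding noise_var_def[OF h] wbound_def[OF h] P_def[symmetric] using P
    by (simp add: power_mult_distrib power_divide power2_eq_square)
  then show ?thesis unfolding noise_const_def P_def by (simp only: times_divide_eq_right)
qed

text \<open>All randomness is settled by one event that depends neither on the penalty nor on the
  minimizers; on it the bound is deterministic, with a noise term and a bias term of order
  \<open>\<rho>\<close> squared.\<close>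

lemma estimators_event:
  fixes h :: "real ^ 'd" and r :: "real ^ 'd \<Rightarrow> real"
  assumes n: "n > 0" and m: "m > 0" and \<delta>: "\<delta> > 0" and M0: "M0 > 0"
    and h: "\<And>k. h $ k > 0" "\<And>k. \<beta> * h $ k \<le> 1/2" "\<And>k. h $ k \<le> \<rho>"
    and hm: "\<And>k. 2 / real m \<le> (\<beta> - \<alpha>) / (2 * (real CARD('d) + 2)) * h $ k" "\<And>k. real m * h $ k \<le> M0"
    and B: "B \<ge> 0" "\<And>x y. x \<in> cbox 0 1 \<Longrightarrow> y \<in> cbox 0 1 \<Longrightarrow> \<bar>r y - r x - g x \<bullet> (y - x)\<bar> \<le> B * (norm (y - x))\<^sup>2"
    and oracle_in: "oracle_F r g h \<in> F_add"
  obtains A where "A \<in> events" "prob A \<ge> 1 - \<delta> - real m ^ CARD('d) * (2 * exp (- (real n * a / (10 * real m ^ CARD('d)))))"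
    "\<And>\<omega>. \<omega> \<in> A \<Longrightarrow> \<omega> \<in> space M"
    "\<And>\<omega> R ra rR. \<omega> \<in> A \<Longrightarrow> R > 0 \<Longrightarrow>
      arg_min_if_exists (Q K h n (\<lambda>i. X i \<omega>) (\<lambda>i. r (X i \<omega>) + \<epsilon> i \<omega>)) (\<lambda>r. r \<in> F_add) ra \<Longrightarrow>
      arg_min_if_exists (Q_pen K h n (\<lambda>i. X i \<omega>) (\<lambda>i. r (X i \<omega>) + \<epsilon> i \<omega>) R) (\<lambda>r. r \<in> F_full) rR \<Longrightarrow>
      norm_F (diff_F rR ra) \<le> (1 + ell_hi M0 / ell_lo M0)\<^sup>2 *
        (sqrt (noise_const / \<delta>) / sqrt (real n * (\<Prod>k\<in>UNIV. h $ k)) +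
         real CARD('d option) * (B * (real CARD('d) * C\<^sub>1)\<^sup>2 * (1 + C\<^sub>1) * ell_hi M0) * \<rho>\<^sup>2) / R"
proof -
  obtain A1 where A1: "A1 \<in> events" "prob A1 \<ge> 1 - real m ^ CARD('d) * (2 * exp (- (real n * a / (10 * real m ^ CARD('d)))))"
    "\<And>\<omega>. \<omega> \<in> A1 \<Longrightarrow> \<omega> \<in> space M"
    "\<And>\<omega> i. \<omega> \<in> A1 \<Longrightarrow> i < n \<Longrightarrow> X i \<omega> \<in> cbox 0 1"
    "\<And>\<omega> j. \<omega> \<in> A1 \<Longrightarrow> \<forall>k. j k < m \<Longrightarrow> a / 2 * real n / real m ^ CARD('d) \<le> real (card {i. i < n \<and> X i \<omega> \<in> cell m j}) \<and>
        real (card {i. i < n \<and> X i \<omega> \<in> cell m j}) \<le> 3 * b * real n / real m ^ CARD('d)"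
    by (rule counts_event[OF m, of n]) (rule that)
  obtain A2 where A2: "A2 \<in> events" "prob A2 \<ge> 1 - \<delta>"
    "\<And>\<omega>. \<omega> \<in> A2 \<Longrightarrow> noise h n \<omega> \<in> F_full \<and> (norm_F (noise h n \<omega>))\<^sup>2 \<le> real CARD('d option) * noise_var h / (real n * \<delta>)"
    by (rule noise_event[OF h(1,2) n \<delta>]) (rule that)
  show ?thesis
  proof (rule that[of "A1 \<inter> A2"])
    show "A1 \<inter> A2 \<in> events" using A1(1) A2(1) by simp
    have "prob A1 + prob A2 - prob (A1 \<union> A2) = prob (A1 \<inter> A2)"
      using measure_Un3[of A1 M A2] A1(1) A2(1) by (simp add: fmeasurable_eq_sets)
    then show "prob (A1 \<inter> A2) \<ge> 1 - \<delta> - real m ^ CARD('d) * (2 * exp (- (real n * a / (10 * real m ^ CARD('d)))))"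
      using A1(2) A2(2) prob_le_1[of "A1 \<union> A2"] by linarith
    show "\<omega> \<in> space M" if "\<omega> \<in> A1 \<inter> A2" for \<omega> using that A1(3) by blast
    fix \<omega> R ra rR
    assume \<omega>: "\<omega> \<in> A1 \<inter> A2" and R: "R > 0"
      and ra: "arg_min_if_exists (Q K h n (\<lambda>i. X i \<omega>) (\<lambda>i. r (X i \<omega>) + \<epsilon> i \<omega>)) (\<lambda>r. r \<in> F_add) ra"
      and rR: "arg_min_if_exists (Q_pen K h n (\<lambda>i. X i \<omega>) (\<lambda>i. r (X i \<omega>) + \<epsilon> i \<omega>) R) (\<lambda>r. r \<in> F_full) rR"
    define Xs where "Xs = (\<lambda>i. X i \<omega>)"
    define Ys where "Ys = (\<lambda>i. r (X i \<omega>) + \<epsilon> i \<omega>)"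
    have X_in: "Xs i \<in> cbox 0 1" if "i < n" for i using A1(4) \<omega> that by (simp add: Xs_def)
    have ws: "well_spread M0 (a / 2) (3 * b) h n Xs m"
      unfolding well_spread_def using n m h hm X_in A1(5)[of \<omega>] \<omega> by (simp add: Xs_def)
    have a2: "a / 2 > 0" and b3: "3 * b \<ge> 0" using a_pos b_nonneg by auto
    have upper: "1 / real n * (\<Sum>i<n. (\<Sum>l\<in>UNIV. v l * design h (Xs i) l x)\<^sup>2 * K_h K h (Xs i) x) \<le> ell_hi M0 * (\<Sum>l\<in>UNIV. (v l)\<^sup>2)"
      if "x \<in> cbox 0 1" for x v
      unfolding ell_hi_def by (rule well_spread_bounded[OF ws b3 that])
    interpret elliptic_sample K h n Xs Ys "ell_lo M0" "ell_hi M0"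
    proof
      show "ell_lo M0 * (\<Sum>l\<in>UNIV. (v l)\<^sup>2) \<le> 1 / real n * (\<Sum>i<n. (\<Sum>l\<in>UNIV. v l * design h (Xs i) l x)\<^sup>2 * K_h K h (Xs i) x)"
        if "x \<in> cbox 0 1" for x v
        unfolding ell_lo_def by (rule well_spread_elliptic[OF ws a2 that])
    qed (use K_cont ell_lo_pos[OF M0] ell_hi_nonneg[OF M0] upper in auto)
    define r0 where "r0 = oracle_F r g h"
    have r0: "r0 \<in> F_add" using oracle_in by (simp add: r0_def)
    have noise_F: "noise h n \<omega> \<in> F_full" using A2(3) \<omega> by blast
    define bias where "bias = diff_F (score r0) (noise h n \<omega>)"
    have bias_F: "bias \<in> F_full"
      unfolding bias_def by (intro diff_F_full score_F_full noise_F F_add_subset[OF r0])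
    \<comment> \<open>The upper Gram bound at the unit vector of the intercept bounds the kernel
      average.\<close>
    have K_mean: "1 / real n * (\<Sum>i<n. K_h K h (Xs i) x) \<le> ell_hi M0" if x: "x \<in> cbox 0 1" for x
      using upper[OF x, of "\<lambda>l. if l = None then 1 else 0"] by (simp add: sum_UNIV_option design_def)
    define D where "D = B * (real CARD('d) * C\<^sub>1 * \<rho>)\<^sup>2"
    have bias_le: "\<bar>bias l x\<bar> \<le> D * (1 + C\<^sub>1) * ell_hi M0" if x: "x \<in> cbox 0 1" for l x
    proof -
      \<comment> \<open>The errors cancel exactly, since the indicator in \<open>weight\<close> is
        one here; what remains is the Taylor remainder at the design points.\<close>
      have "bias l x = 1 / real n * (\<Sum>i<n. (r (Xs i) - r x - g x \<bullet> (Xs i - x)) * design h (Xs i) l x * K_h K h (Xs i) x)"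
      proof -
        have "(\<Sum>i<n. (Ys i - local_fit h (Xs i) r0 x) * design h (Xs i) l x * K_h K h (Xs i) x) - (\<Sum>i<n. \<epsilon> i \<omega> * weight h l x (X i \<omega>))
            = (\<Sum>i<n. (r (Xs i) - r x - g x \<bullet> (Xs i - x)) * design h (Xs i) l x * K_h K h (Xs i) x)"
          unfolding sum_subtractf[symmetric]
        proof (rule sum.cong[OF refl])
          fix i assume "i \<in> {..<n}"
          then have "weight h l x (X i \<omega>) = design h (Xs i) l x * K_h K h (Xs i) x"
            using X_in[of i] by (simp add: weight_def Xs_def)
          then show "(Ys i - local_fit h (Xs i) r0 x) * design h (Xs i) l x * K_h K h (Xs i) x - \<epsilon> i \<omega> * weight h l x (X i \<omega>) =
              (r (Xs i) - r x - g x \<bullet> (Xs i - x)) * design h (Xs i) l x * K_h K h (Xs i) x"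
            unfolding r0_def local_fit_oracle_F[OF h(1)] by (simp add: Ys_def Xs_def algebra_simps)
        qed
        then show ?thesis
          unfolding bias_def diff_F_def score_def noise_def[OF h(1,2)] right_diff_distrib[symmetric] by simp
      qed
      also have "\<bar>\<dots>\<bar> \<le> 1 / real n * (\<Sum>i<n. D * (1 + C\<^sub>1) * K_h K h (Xs i) x)"
        unfolding abs_mult
      proof (intro mult_mono order_trans[OF sum_abs] sum_mono)
        fix i assume "i \<in> {..<n}"
        then have Xi: "Xs i \<in> cbox 0 1" using X_in by simp
        note Kn = K_h_nonneg[OF h(1,2) Xi, of x]
        show "\<bar>(r (Xs i) - r x - g x \<bullet> (Xs i - x)) * design h (Xs i) l x * K_h K h (Xs i) x\<bar> \<le> D * (1 + C\<^sub>1) * K_h K h (Xs i) x"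
        proof (cases "K_h K h (Xs i) x = 0")
          case False
          note d = design_abs_le[OF h(1,2) Xi False]
          have "norm (Xs i - x) \<le> (\<Sum>k\<in>UNIV. \<bar>(Xs i - x) $ k\<bar>)" by (rule norm_le_l1_cart)
          also have "\<dots> \<le> (\<Sum>k\<in>(UNIV :: 'd set). C\<^sub>1 * \<rho>)"
          proof (rule sum_mono)
            fix k
            have "C\<^sub>1 * h $ k \<le> C\<^sub>1 * \<rho>" using h(3) C\<^sub>1_pos by (intro mult_left_mono) auto
            then show "\<bar>(Xs i - x) $ k\<bar> \<le> C\<^sub>1 * \<rho>" using d(1)[of k] by simp
          qed
          finally have "norm (Xs i - x) \<le> real CARD('d) * C\<^sub>1 * \<rho>" by simp
          then have "B * (norm (Xs i - x))\<^sup>2 \<le> D" unfolding D_def using B(1) by (intro mult_left_mono power_mono) auto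
          then have "\<bar>r (Xs i) - r x - g x \<bullet> (Xs i - x)\<bar> \<le> D" using B(2)[OF x Xi] by linarith
          then show ?thesis unfolding abs_mult using d(2)[of l] Kn by (intro mult_mono) auto
        qed simp
      qed auto
      also have "\<dots> = D * (1 + C\<^sub>1) * (1 / real n * (\<Sum>i<n. K_h K h (Xs i) x))"
        by (simp add: sum_distrib_left[symmetric])
      also have "\<dots> \<le> D * (1 + C\<^sub>1) * ell_hi M0"
        using K_mean[OF x] B(1) C\<^sub>1_pos by (intro mult_left_mono mult_nonneg_nonneg) (auto simp: D_def)
      finally show ?thesis .
    qed
    have norm_bias: "norm_F bias \<le> real CARD('d option) * (D * (1 + C\<^sub>1) * ell_hi M0)"
      by (rule norm_F_le_bound[OF bias_F bias_le])
    have P: "(\<Prod>k\<in>UNIV. h $ k) > 0" using h(1) by (intro prod_pos) simp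
    have "(norm_F (noise h n \<omega>))\<^sup>2 \<le> noise_const / \<delta> / (real n * (\<Prod>k\<in>UNIV. h $ k))"
    proof -
      have "(norm_F (noise h n \<omega>))\<^sup>2 \<le> noise_const / (\<Prod>k\<in>UNIV. h $ k) / (real n * \<delta>)"
        using A2(3) \<omega> unfolding noise_var_eq[OF h(1,2)] by blast
      then show ?thesis by (simp add: mult_ac)
    qed
    then have norm_noise: "norm_F (noise h n \<omega>) \<le> sqrt (noise_const / \<delta>) / sqrt (real n * (\<Prod>k\<in>UNIV. h $ k))"
      unfolding real_sqrt_divide[symmetric] by (rule real_le_rsqrt)
    have "score r0 = axpy_F 1 bias (noise h n \<omega>)" by (simp add: bias_def axpy_F_def diff_F_def)
    then have "norm_F (score r0) \<le> norm_F (noise h n \<omega>) + norm_F bias"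
      using norm_F_axpy_le[OF noise_F bias_F, of 1] by simp
    also have "\<dots> \<le> sqrt (noise_const / \<delta>) / sqrt (real n * (\<Prod>k\<in>UNIV. h $ k)) + real CARD('d option) * (D * (1 + C\<^sub>1) * ell_hi M0)"
      by (intro add_mono norm_noise norm_bias)
    also have "real CARD('d option) * (D * (1 + C\<^sub>1) * ell_hi M0) = real CARD('d option) * (B * (real CARD('d) * C\<^sub>1)\<^sup>2 * (1 + C\<^sub>1) * ell_hi M0) * \<rho>\<^sup>2"
      by (simp add: D_def power_mult_distrib mult_ac)
    finally have score_le: "norm_F (score r0) \<le> sqrt (noise_const / \<delta>) / sqrt (real n * (\<Prod>k\<in>UNIV. h $ k)) +
        real CARD('d option) * (B * (real CARD('d) * C\<^sub>1)\<^sup>2 * (1 + C\<^sub>1) * ell_hi M0) * \<rho>\<^sup>2" .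
    have "norm_F (diff_F rR ra) \<le> (1 + ell_hi M0 / ell_lo M0)\<^sup>2 * norm_F (score r0) / R"
      by (rule estimators_close[OF R r0]) (use ra rR in \<open>auto simp: Xs_def Ys_def arg_min_if_exists_def\<close>)
    also have "\<dots> \<le> (1 + ell_hi M0 / ell_lo M0)\<^sup>2 *
        (sqrt (noise_const / \<delta>) / sqrt (real n * (\<Prod>k\<in>UNIV. h $ k)) +
         real CARD('d option) * (B * (real CARD('d) * C\<^sub>1)\<^sup>2 * (1 + C\<^sub>1) * ell_hi M0) * \<rho>\<^sup>2) / R"
      using R by (intro divide_right_mono mult_left_mono score_le) auto
    finally show "norm_F (diff_F rR ra) \<le> (1 + ell_hi M0 / ell_lo M0)\<^sup>2 *
        (sqrt (noise_const / \<delta>) / sqrt (real n * (\<Prod>k\<in>UNIV. h $ k)) +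
         real CARD('d option) * (B * (real CARD('d) * C\<^sub>1)\<^sup>2 * (1 + C\<^sub>1) * ell_hi M0) * \<rho>\<^sup>2) / R" .
  qed
qed

end

subsection \<open>Asymptotics\<close>

lemma mean_bw_power:
  fixes h :: "real ^ 'd::finite"
  assumes "\<And>k. h $ k > 0"
  shows "mean_bw h > 0" "mean_bw h ^ CARD('d) = (\<Prod>k\<in>UNIV. h $ k)"
proof -
  have P: "(\<Prod>k\<in>UNIV. h $ k) > 0" using assms by (intro prod_pos) simp
  then show pos: "mean_bw h > 0" unfolding mean_bw_def powr_gt_zero by linarith
  have "mean_bw h ^ CARD('d) = mean_bw h powr real CARD('d)" using pos by (simp add: powr_realpow)
  also have "\<dots> = (\<Prod>k\<in>UNIV. h $ k)" using P by (simp add: mean_bw_def powr_powr)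
  finally show "mean_bw h ^ CARD('d) = (\<Prod>k\<in>UNIV. h $ k)" .
qed

text \<open>\<open>mean_bw h\<close> is a geometric mean: every factor of the product is compared
  with the one bandwidth \<open>h $ k\<close>, and a d-th root is taken.\<close>

lemma mean_bw_bounds:
  fixes h :: "real ^ 'd::finite"
  assumes h: "\<And>k. h $ k > 0" and ratio: "\<And>k l. a \<le> h $ k / h $ l \<and> h $ k / h $ l \<le> b" and a: "0 < a"
  shows "a * mean_bw h \<le> h $ k" "h $ k \<le> b * mean_bw h"
proof -
  note H = mean_bw_power[OF h]
  have b: "b \<ge> 1" using ratio[of k k] h[of k] by simp
  have "(a * mean_bw h) ^ CARD('d) = (\<Prod>l\<in>UNIV. a * h $ l)"
    by (simp add: power_mult_distrib H(2) prod.distrib)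
  also have "\<dots> \<le> (\<Prod>l\<in>(UNIV :: 'd set). h $ k)"
  proof (intro prod_mono conjI)
    show "0 \<le> a * h $ l" for l using a h[of l] by simp
    show "a * h $ l \<le> h $ k" for l using ratio[of k l] h[of l] by (simp add: pos_le_divide_eq)
  qed
  finally have "(a * mean_bw h) ^ CARD('d) \<le> (h $ k) ^ CARD('d)" by simp
  then show "a * mean_bw h \<le> h $ k"
    by (subst (asm) power_mono_iff) (use h[of k] H(1) a in \<open>auto simp: less_imp_le\<close>)
  have "(h $ k) ^ CARD('d) = (\<Prod>l\<in>(UNIV :: 'd set). h $ k)" by simp
  also have "\<dots> \<le> (\<Prod>l\<in>UNIV. b * h $ l)"
  proof (intro prod_mono conjI)
    show "0 \<le> h $ k" using h[of k] by simp
    show "h $ k \<le> b * h $ l" for l using ratio[of k l] h[of l] by (simp add: pos_divide_le_eq)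
  qed
  also have "\<dots> = (b * mean_bw h) ^ CARD('d)" by (simp add: power_mult_distrib H(2) prod.distrib)
  finally show "h $ k \<le> b * mean_bw h"
    by (subst (asm) power_mono_iff) (use h[of k] H(1) b in \<open>auto simp: less_imp_le\<close>)
qed

text \<open>Squared, this is n H^(4+d) <= C^(4+d): at the upper end of the bandwidth range the
  squared bias H^4 and the variance 1 / (n H^d) balance.\<close>

lemma bandwidth_upper_rate:
  assumes H: "0 < H" "H \<le> C * real n powr (- 1 / (4 + real d))" and n: "n > 0" and C: "C > 0"
  shows "H\<^sup>2 \<le> sqrt (C ^ (4 + d)) / sqrt (real n * H ^ d)"
proof -
  have "real n * H ^ (4 + d) \<le> real n * (C * real n powr (- 1 / (4 + real d))) ^ (4 + d)"
    using H by (intro mult_left_mono power_mono) auto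
  also have "\<dots> = real n * (C ^ (4 + d) * ((real n powr (- 1 / (4 + real d))) powr real (4 + d)))"
  proof -
    have "(real n powr (- 1 / (4 + real d))) ^ (4 + d) = (real n powr (- 1 / (4 + real d))) powr real (4 + d)"
      by (rule powr_realpow[symmetric]) (use n in simp)
    then show ?thesis unfolding power_mult_distrib by simp
  qed
  also have "(real n powr (- 1 / (4 + real d))) powr real (4 + d) = real n powr (- 1)"
    by (simp add: powr_powr)
  also have "real n * (C ^ (4 + d) * real n powr (- 1)) = C ^ (4 + d)"
    using n by (simp add: powr_minus field_simps)
  finally have *: "real n * H ^ (4 + d) \<le> C ^ (4 + d)" .
  have "H\<^sup>2 * sqrt (real n * H ^ d) = sqrt (H ^ 4) * sqrt (real n * H ^ d)"
  proof -
    have "sqrt (H ^ 4) = H\<^sup>2" by (rule real_sqrt_unique) (simp_all flip: power_mult)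
    then show ?thesis by simp
  qed
  also have "\<dots> = sqrt (real n * H ^ (4 + d))" 
  proof -
    have "H ^ 4 * (real n * H ^ d) = real n * H ^ (4 + d)" by (simp add: power_add mult_ac)
    then show ?thesis unfolding real_sqrt_mult[symmetric] by simp
  qed
  also have "\<dots> \<le> sqrt (C ^ (4 + d))" using * by simp
  finally show ?thesis using H n by (simp add: pos_le_divide_eq)
qed

text \<open>In terms of u = k n^(1/5) this is a multiple of u^4 exp(-u).\<close>

lemma exp_tail_tendsto_0:
  assumes "k > 0"
  shows "(\<lambda>n. B * (real n powr (4/5) * exp (- (k * real n powr (1/5))))) \<longlonglongrightarrow> 0"
proof -
  have "filterlim (\<lambda>n. exp (1/5 * ln (real n))) at_top sequentially"
    by (intro filterlim_compose[OF exp_at_top] filterlim_tendsto_pos_mult_at_top[OF tendsto_const]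
        filterlim_compose[OF ln_at_top filterlim_real_sequentially]) simp
  then have powr_lim: "filterlim (\<lambda>n. real n powr (1/5)) at_top sequentially"
    by (rule filterlim_mono_eventually[OF _ order_refl order_refl])
      (use eventually_gt_at_top[of 0] in \<open>rule eventually_mono, simp add: powr_def\<close>)
  have lim: "filterlim (\<lambda>n. k * real n powr (1/5)) at_top sequentially"
    by (rule filterlim_tendsto_pos_mult_at_top[OF tendsto_const assms powr_lim])
  have "(\<lambda>n. (k * real n powr (1/5)) ^ 4 / exp (k * real n powr (1/5))) \<longlonglongrightarrow> 0"
    by (rule filterlim_compose[OF tendsto_power_div_exp_0 lim])
  then have "(\<lambda>n. B / k ^ 4 * ((k * real n powr (1/5)) ^ 4 / exp (k * real n powr (1/5)))) \<longlonglongrightarrow> B / k ^ 4 * 0"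
    by (intro tendsto_mult tendsto_const)
  moreover have "B / k ^ 4 * ((k * real n powr (1/5)) ^ 4 / exp (k * real n powr (1/5))) =
      B * (real n powr (4/5) * exp (- (k * real n powr (1/5))))" for n
  proof -
    have "(real n powr (1/5)) ^ 4 = real n powr (4/5)"
    proof (cases "n = 0")
      case False
      then have "(real n powr (1/5)) ^ 4 = (real n powr (1/5)) powr real 4" by (intro powr_realpow[symmetric]) simp
      then show ?thesis unfolding powr_powr by simp
    qed simp
    then show ?thesis using assms by (simp add: power_mult_distrib exp_minus field_simps)
  qed
  ultimately show ?thesis by simp
qed

text \<open>The bound on the failure probability increases with the number \<open>x\<close> of
  cells, so an upper bound for that number suffices.\<close>

lemma exp_tail_mono:
  assumes "0 < x" "x \<le> y" "0 \<le> (c :: real)"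
  shows "x * (2 * exp (- (c / (10 * x)))) \<le> y * (2 * exp (- (c / (10 * y))))"
proof -
  have "c / (10 * y) \<le> c / (10 * x)" using assms by (intro divide_left_mono mult_pos_pos) auto
  then show ?thesis using assms by (intro mult_mono) auto
qed

theorem theorem2:
  fixes M :: "'w measure"
    and X :: "nat \<Rightarrow> 'w \<Rightarrow> real ^ 'd::finite"
    and \<epsilon> Y :: "nat \<Rightarrow> 'w \<Rightarrow> real"
    and f r_true :: "real ^ 'd \<Rightarrow> real"
    and r_add0 :: real and r_addc :: "'d \<Rightarrow> real \<Rightarrow> real"
    and \<sigma> \<theta> C\<^sub>1 :: real
    and K :: "real \<Rightarrow> real"
    and h :: "nat \<Rightarrow> real ^ 'd"
    and R :: "nat \<Rightarrow> real"
    and rhat_add rhat_R :: "nat \<Rightarrow> 'w \<Rightarrow> 'd field"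
  assumes prob: "prob_space M"
    \<comment> \<open>data\<close>
    and iid_indep: "prob_space.indep_vars M (\<lambda>_. borel) (\<lambda>i \<omega>. (X i \<omega>, \<epsilon> i \<omega>)) UNIV"
    and iid_distr: "\<And>i. distr M borel (\<lambda>\<omega>. (X i \<omega>, \<epsilon> i \<omega>)) = distr M borel (\<lambda>\<omega>. (X 0 \<omega>, \<epsilon> 0 \<omega>))"
    and density: "\<And>i. distributed M lborel (X i) (\<lambda>x. ennreal (f x))"
    and X_\<epsilon>_indep: "\<And>i. prob_space.indep_set M (sets (vimage_algebra (space M) (X i) borel))
                                                (sets (vimage_algebra (space M) (\<epsilon> i) borel))"
    and \<epsilon>_int: "\<And>i. integrable M (\<epsilon> i)" "\<And>i. integrable M (\<lambda>\<omega>. (\<epsilon> i \<omega>)\<^sup>2)"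
    and \<epsilon>_mean: "\<And>i. prob_space.expectation M (\<epsilon> i) = 0"
    and \<epsilon>_var: "\<And>i. prob_space.variance M (\<epsilon> i) = \<sigma>\<^sup>2"
    and Y_eq: "\<And>i \<omega>. Y i \<omega> = r_true (X i \<omega>) + \<epsilon> i \<omega>"
    \<comment> \<open>(B1)\<close>
    and K_bounded: "bounded (range K)"
    and K_nonneg: "\<And>u. K u \<ge> 0"
    and K_support: "C\<^sub>1 > 0" "closure {u. K u \<noteq> 0} = {- C\<^sub>1..C\<^sub>1}"
    and K_sym: "\<And>u. K (- u) = K u"
    and K_lipschitz: "\<exists>L. L-lipschitz_on UNIV K"
    \<comment> \<open>(B2')\<close>
    and f_support: "\<And>x. x \<notin> cbox 0 1 \<Longrightarrow> f x = 0"
    and f_bounds: "\<exists>a b. 0 < a \<and> (\<forall>x \<in> cbox 0 1. a \<le> f x \<and> f x \<le> b)"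
    \<comment> \<open>(B3')\<close>
    and Y_moment: "\<theta> > 5/2" "\<And>i. integrable M (\<lambda>\<omega>. \<bar>Y i \<omega>\<bar> powr \<theta>)"
    \<comment> \<open>(B4')\<close>
    and r_C2: "C2_on (cbox 0 1) r_true"
    and f_C1: "C1_on (cbox 0 1) f"
    \<comment> \<open>dimension, bandwidths, additivity, penalties\<close>
    and dim: "CARD('d) \<le> 4"
    and h_pos: "\<And>n k. h n $ k > 0"
    and h_same_order: "\<exists>a b. 0 < a \<and> (\<forall>\<^sub>F n in sequentially. \<forall>k l. a \<le> h n $ k / h n $ l \<and> h n $ k / h n $ l \<le> b)"
    and h_range: "\<exists>c C. 0 < c \<and> 0 < C \<and> (\<forall>\<^sub>F n in sequentially.
          c * real n powr (- 1 / 5) \<le> mean_bw (h n) \<and>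
          mean_bw (h n) \<le> C * real n powr (- 1 / (4 + real CARD('d))))"
    and additive: "\<And>x. x \<in> cbox 0 1 \<Longrightarrow> r_true x = r_add0 + (\<Sum>k\<in>UNIV. r_addc k (x $ k))"
    and R_pos: "\<And>n. R n > 0"
    \<comment> \<open>the estimators: minimizers whenever minimizers exist, arbitrary otherwise\<close>
    and rhat_add: "\<And>n \<omega>. \<omega> \<in> space M \<Longrightarrow>
          \<exists>r. is_arg_min (Q K (h n) n (\<lambda>i. X i \<omega>) (\<lambda>i. Y i \<omega>)) (\<lambda>r. r \<in> F_add) r \<Longrightarrow>
          is_arg_min (Q K (h n) n (\<lambda>i. X i \<omega>) (\<lambda>i. Y i \<omega>)) (\<lambda>r. r \<in> F_add) (rhat_add n \<omega>)"
    and rhat_R: "\<And>n \<omega>. \<omega> \<in> space M \<Longrightarrow>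
          \<exists>r. is_arg_min (Q_pen K (h n) n (\<lambda>i. X i \<omega>) (\<lambda>i. Y i \<omega>) (R n)) (\<lambda>r. r \<in> F_full) r \<Longrightarrow>
          is_arg_min (Q_pen K (h n) n (\<lambda>i. X i \<omega>) (\<lambda>i. Y i \<omega>) (R n)) (\<lambda>r. r \<in> F_full) (rhat_R n \<omega>)"
  shows "prob_space.bigO_P M (\<lambda>n \<omega>. norm_F (diff_F (rhat_R n \<omega>) (rhat_add n \<omega>)))
           (\<lambda>n. 1 / (R n * sqrt (real n * mean_bw (h n) ^ CARD('d))))"
proof -
  interpret prob_space M by (rule prob)
  obtain Km \<kappa> \<alpha> \<beta> where kern: "kernel K C\<^sub>1 Km \<kappa> \<alpha> \<beta>"
    using kernel_exists[OF K_bounded K_nonneg K_support K_sym K_lipschitz] by blast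
  obtain a b where ab: "0 < a" "\<forall>x \<in> cbox 0 1. a \<le> f x \<and> f x \<le> b" using f_bounds by blast
  obtain g B where B: "B \<ge> 0" and g_cont: "continuous_on (cbox 0 1) g"
    and deriv: "\<And>x. x \<in> cbox 0 1 \<Longrightarrow> (r_true has_derivative (\<lambda>v. g x \<bullet> v)) (at x within cbox 0 1)"
    and Taylor: "\<And>x y. x \<in> cbox 0 1 \<Longrightarrow> y \<in> cbox 0 1 \<Longrightarrow> \<bar>r_true y - r_true x - g x \<bullet> (y - x)\<bar> \<le> B * (norm (y - x))\<^sup>2"
    by (rule C2_on_Taylor[OF r_C2 compact_cbox convex_box(1)]) (rule that)
  obtain a1 b1 where a1: "0 < a1"
    and ratio: "\<forall>\<^sub>F n in sequentially. \<forall>k l. a1 \<le> h n $ k / h n $ l \<and> h n $ k / h n $ l \<le> b1"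
    using h_same_order by blast
  obtain c C where c: "0 < c" and C: "0 < C" and range: "\<forall>\<^sub>F n in sequentially.
      c * real n powr (- 1 / 5) \<le> mean_bw (h n) \<and> mean_bw (h n) \<le> C * real n powr (- 1 / (4 + real CARD('d)))"
    using h_range by blast
  have \<epsilon>_sq: "expectation (\<lambda>\<omega>. (\<epsilon> i \<omega>)\<^sup>2) = \<sigma>\<^sup>2" for i
    using \<epsilon>_var[of i] \<epsilon>_mean[of i] by simp
  interpret noisy_sample M X \<epsilon> f a b "\<sigma>\<^sup>2" K C\<^sub>1 Km \<kappa> \<alpha> \<beta>
  proof (rule noisy_sample.intro[OF _ kern], unfold_locales)
    show "x \<in> cbox 0 1 \<Longrightarrow> a \<le> f x \<and> f x \<le> b" for x using ab by blast
  qed (use iid_indep density f_support ab X_\<epsilon>_indep \<epsilon>_int \<epsilon>_mean \<epsilon>_sq in auto)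
  have r_oracle: "oracle_F r_true g (h n) \<in> F_add" for n
    by (rule oracle_F_add[OF additive deriv g_cont])
  define d where "d = CARD('d)"
  define H where "H n = mean_bw (h n)" for n
  define \<eta> where "\<eta> = (\<beta> - \<alpha>) / (2 * (real CARD('d) + 2))"
  have \<eta>: "\<eta> > 0" using \<alpha>_less by (simp add: \<eta>_def)
  \<comment> \<open>\<open>A / H n\<close> will bound \<open>m n\<close>: rounding up adds at most
    1, and 1 <= 1 / H once H <= 1.\<close>
  define A where "A = 2 / (\<eta> * a1) + 1"
  have A: "A > 0" unfolding A_def using \<eta> a1 by (intro add_pos_pos divide_pos_pos mult_pos_pos) auto
  define A2 where "A2 = (A / c) ^ d"
  have A2: "A2 > 0" using A c by (simp add: A2_def)
  \<comment> \<open>The least m with 2 / m <= \<open>\<eta> * a1 * H n\<close>, where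
    \<open>a1 * H n\<close> is a lower bound for every bandwidth.\<close>
  define m where "m n = nat \<lceil>2 / (\<eta> * a1 * H n)\<rceil>" for n
  note H = mean_bw_power[OF h_pos, folded H_def]
  have b1: "b1 > 0"
  proof -
    obtain n where "\<forall>k l. a1 \<le> h n $ k / h n $ l \<and> h n $ k / h n $ l \<le> b1"
      using eventually_happens[OF ratio] by auto
    then have "a1 \<le> b1" by (meson order_trans)
    then show ?thesis using a1 by linarith
  qed
  define M0 where "M0 = A * b1"
  have M0: "M0 > 0" using A b1 by (simp add: M0_def)
  have H_lim: "(\<lambda>n. C * real n powr (- 1 / (4 + real CARD('d)))) \<longlonglongrightarrow> C * 0"
    by (intro tendsto_mult tendsto_const tendsto_neg_powr filterlim_real_sequentially) (simp add: divide_neg_pos)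
  \<comment> \<open>The bound 1 is used in rounding \<open>m\<close>; the other gives
    \<open>\<beta> * h n $ k \<le> \<beta> * b1 * H n \<le> 1/2\<close>.\<close>
  define \<tau> where "\<tau> = min 1 (1 / (2 * \<beta> * b1))"
  have \<tau>: "\<tau> > 0" using \<beta>_pos b1 by (simp add: \<tau>_def)
  have small: "\<forall>\<^sub>F n in sequentially. C * real n powr (- 1 / (4 + real CARD('d))) < \<tau>"
    using order_tendstoD(2)[OF H_lim, of \<tau>] \<tau> by simp
  show ?thesis
    unfolding bigO_P_def
  proof (intro allI impI)
    fix e :: real assume e: "e > 0"
    define D where "D = real CARD('d option) * (B * (real CARD('d) * C\<^sub>1)\<^sup>2 * (1 + C\<^sub>1) * ell_hi M0)"
    have D: "D \<ge> 0" unfolding D_def using B C\<^sub>1_pos ell_hi_nonneg[OF M0] by (intro mult_nonneg_nonneg) auto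
    \<comment> \<open>The bias of order H^2 is traded for a multiple of 1 / sqrt (n H^d), so that
      one constant covers both terms. Half of the allowed probability \<open>e\<close> goes to the
      noise, the other half to the cell counts.\<close>
    define G where "G = (1 + ell_hi M0 / ell_lo M0)\<^sup>2 * (sqrt (noise_const / (e / 2)) + D * b1\<^sup>2 * sqrt (C ^ (4 + d)))"
    have tail: "\<forall>\<^sub>F n in sequentially. (2 * A2) * (real n powr (4/5) * exp (- (a / (10 * A2) * real n powr (1/5)))) < e / 2"
      using order_tendstoD(2)[OF exp_tail_tendsto_0[of "a / (10 * A2)" "2 * A2"], of "e / 2"] e ab(1) A2 by simp
    have "\<forall>\<^sub>F n in sequentially. \<exists>A\<in>events. 1 - e \<le> prob A \<and>
        (\<forall>\<omega>\<in>A. \<bar>norm_F (diff_F (rhat_R n \<omega>) (rhat_add n \<omega>))\<bar> \<le> G * (1 / (R n * sqrt (real n * mean_bw (h n) ^ CARD('d)))))"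
      using eventually_gt_at_top[of 0] ratio range small tail
    proof eventually_elim
      case (elim n)
      then have n: "n > 0" by blast
      from elim(2) have ratio_n: "\<And>k l. a1 \<le> h n $ k / h n $ l \<and> h n $ k / h n $ l \<le> b1" by blast
      from elim(3) have H_lo: "c * real n powr (- 1 / 5) \<le> H n"
        and H_hi: "H n \<le> C * real n powr (- 1 / (4 + real CARD('d)))" by (simp_all add: H_def)
      have H_small: "H n \<le> 1" "H n \<le> 1 / (2 * \<beta> * b1)" using H_hi elim(4) by (auto simp: \<tau>_def)
      have hk: "a1 * H n \<le> h n $ k" "h n $ k \<le> b1 * H n" for k
        unfolding H_def by (rule mean_bw_bounds[OF h_pos ratio_n a1])+
      have q_pos: "0 < \<eta> * a1 * H n" using \<eta> a1 H(1) by simp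
      have m_ge: "2 / (\<eta> * a1 * H n) \<le> real (m n)" unfolding m_def by (rule real_nat_ceiling_ge)
      have "0 < 2 / (\<eta> * a1 * H n)" using q_pos by simp
      then have m: "m n > 0" using m_ge by (metis less_le_trans of_nat_0_less_iff)
      have "real (m n) \<le> 2 / (\<eta> * a1 * H n) + 1"
        unfolding m_def using \<open>0 < 2 / (\<eta> * a1 * H n)\<close> by linarith
      also have "\<dots> \<le> 2 / (\<eta> * a1 * H n) + 1 / H n" using H_small(1) H(1)[of n] by simp
      also have "\<dots> = A / H n" using H(1)[of n] by (simp add: A_def add_divide_distrib)
      finally have m_le: "real (m n) \<le> A / H n" .
      have cond1: "2 / real (m n) \<le> \<eta> * h n $ k" for k
      proof -
        have "2 / real (m n) \<le> \<eta> * a1 * H n" using m_ge m q_pos by (simp add: field_simps)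
        also have "\<dots> \<le> \<eta> * h n $ k" using hk(1)[of k] \<eta> by (simp add: mult.assoc)
        finally show ?thesis .
      qed
      have cond2: "real (m n) * h n $ k \<le> M0" for k
      proof -
        have "real (m n) * h n $ k \<le> A / H n * (b1 * H n)"
          using m_le hk(2)[of k] h_pos[of n k] A H(1)[of n] by (intro mult_mono) auto
        then show ?thesis using H(1)[of n] by (simp add: M0_def)
      qed
      have cond3: "\<beta> * h n $ k \<le> 1/2" for k
      proof -
        have "\<beta> * h n $ k \<le> \<beta> * (b1 * (1 / (2 * \<beta> * b1)))"
          using hk(2)[of k] H_small(2) \<beta>_pos b1 by (intro mult_left_mono order_trans[OF hk(2)]) auto
        then show ?thesis using \<beta>_pos b1 by simp
      qed
      \<comment> \<open>The number of cells. The lower bound on the bandwidth enters here, and d <=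
        4 turns n^(d/5) into at most n^(4/5), which leaves n^(1/5) for the exponent below.\<close>
      have md: "real (m n) ^ CARD('d) \<le> A2 * real n powr (4/5)"
      proof -
        have pos: "0 < c * real n powr (- 1 / 5)" using c n by simp
        have "real (m n) \<le> A / (c * real n powr (- 1 / 5))"
          using m_le divide_left_mono[OF H_lo, of A] A pos H(1)[of n] by simp
        also have "\<dots> = A / c * real n powr (1/5)" using n by (simp add: powr_minus field_simps)
        finally have "real (m n) ^ d \<le> (A / c * real n powr (1/5)) ^ d" by (intro power_mono) auto
        also have "\<dots> = A2 * (real n powr (1/5)) powr real d"
          unfolding power_mult_distrib A2_def using n by (subst powr_realpow) auto
        also have "\<dots> = A2 * real n powr (real d / 5)" unfolding powr_powr by simp
        also have "\<dots> \<le> A2 * real n powr (4/5)"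
          using n dim A2 by (intro mult_left_mono powr_mono) (auto simp: d_def)
        finally show ?thesis by (simp add: d_def)
      qed
      have "real (m n) ^ CARD('d) * (2 * exp (- (real n * a / (10 * real (m n) ^ CARD('d)))))
          \<le> A2 * real n powr (4/5) * (2 * exp (- (real n * a / (10 * (A2 * real n powr (4/5))))))"
        using m md ab(1) by (intro exp_tail_mono) auto
      also have "real n * a / (10 * (A2 * real n powr (4/5))) = a / (10 * A2) * real n powr (1/5)"
      proof -
        have "real n powr 1 = real n powr (1/5) * real n powr (4/5)" by (simp flip: powr_add)
        then have "real n = real n powr (1/5) * real n powr (4/5)" by simp
        then show ?thesis using n A2 by (simp add: field_simps)
      qed
      finally have tail_n: "real (m n) ^ CARD('d) * (2 * exp (- (real n * a / (10 * real (m n) ^ CARD('d))))) \<le> e / 2"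
        using elim(5) by (simp add: mult_ac)
      have e2: "e / 2 > 0" using e by simp
      obtain E where E: "E \<in> events"
        "prob E \<ge> 1 - e / 2 - real (m n) ^ CARD('d) * (2 * exp (- (real n * a / (10 * real (m n) ^ CARD('d)))))"
        "\<And>\<omega>. \<omega> \<in> E \<Longrightarrow> \<omega> \<in> space M"
        and close: "\<And>\<omega> R ra rR. \<omega> \<in> E \<Longrightarrow> R > 0 \<Longrightarrow>
          arg_min_if_exists (Q K (h n) n (\<lambda>i. X i \<omega>) (\<lambda>i. r_true (X i \<omega>) + \<epsilon> i \<omega>)) (\<lambda>r. r \<in> F_add) ra \<Longrightarrow>
          arg_min_if_exists (Q_pen K (h n) n (\<lambda>i. X i \<omega>) (\<lambda>i. r_true (X i \<omega>) + \<epsilon> i \<omega>) R) (\<lambda>r. r \<in> F_full) rR \<Longrightarrow>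
          norm_F (diff_F rR ra) \<le> (1 + ell_hi M0 / ell_lo M0)\<^sup>2 *
            (sqrt (noise_const / (e / 2)) / sqrt (real n * (\<Prod>k\<in>UNIV. h n $ k)) + D * (b1 * H n)\<^sup>2) / R"
        by (rule estimators_event[OF n m e2 M0 h_pos cond3 hk(2) cond1[unfolded \<eta>_def] cond2 B Taylor r_oracle, folded D_def], assumption, assumption)
          (rule that)
      show ?case
      proof (intro bexI[of _ E] conjI ballI)
        show "E \<in> events" by (rule E(1))
        show "1 - e \<le> prob E" using E(2) tail_n by linarith
        fix \<omega> assume \<omega>: "\<omega> \<in> E"
        note sp = E(3)[OF \<omega>]
        define S where "S = sqrt (real n * H n ^ d)"
        have S: "S > 0" using n H(1)[of n] by (simp add: S_def)
        have Y: "(\<lambda>i. Y i \<omega>) = (\<lambda>i. r_true (X i \<omega>) + \<epsilon> i \<omega>)" by (simp add: Y_eq)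
        have "norm_F (diff_F (rhat_R n \<omega>) (rhat_add n \<omega>)) \<le> (1 + ell_hi M0 / ell_lo M0)\<^sup>2 *
            (sqrt (noise_const / (e / 2)) / sqrt (real n * (\<Prod>k\<in>UNIV. h n $ k)) + D * (b1 * H n)\<^sup>2) / R n"
          by (rule close[OF \<omega> R_pos])
            (simp_all only: arg_min_if_exists_def Y[symmetric], (rule impI, rule rhat_add[OF sp], assumption),
              rule impI, rule rhat_R[OF sp], assumption)
        also have "\<dots> \<le> (1 + ell_hi M0 / ell_lo M0)\<^sup>2 *
            (sqrt (noise_const / (e / 2)) / S + D * (b1\<^sup>2 * (sqrt (C ^ (4 + d)) / S))) / R n"
        proof (intro divide_right_mono mult_left_mono add_mono)
          show "sqrt (noise_const / (e / 2)) / sqrt (real n * (\<Prod>k\<in>UNIV. h n $ k)) \<le> sqrt (noise_const / (e / 2)) / S"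
            unfolding S_def d_def H(2) ..
          have "(H n)\<^sup>2 \<le> sqrt (C ^ (4 + d)) / S"
            unfolding S_def by (rule bandwidth_upper_rate[OF H(1) _ n C]) (use H_hi in \<open>simp add: d_def\<close>)
          then show "(b1 * H n)\<^sup>2 \<le> b1\<^sup>2 * (sqrt (C ^ (4 + d)) / S)"
            unfolding power_mult_distrib by (intro mult_left_mono) auto
        qed (use D R_pos[of n] in auto)
        also have "\<dots> = G * (1 / (R n * S))"
          using S R_pos[of n] by (simp add: G_def field_simps)
        finally show "\<bar>norm_F (diff_F (rhat_R n \<omega>) (rhat_add n \<omega>))\<bar> \<le> G * (1 / (R n * sqrt (real n * mean_bw (h n) ^ CARD('d))))"
          by (simp add: S_def H_def d_def)
      qed
    qed
    then show "\<exists>C. \<forall>\<^sub>F n in sequentially. \<exists>A\<in>events. 1 - e \<le> prob A \<and>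
        (\<forall>\<omega>\<in>A. \<bar>norm_F (diff_F (rhat_R n \<omega>) (rhat_add n \<omega>))\<bar> \<le> C * (1 / (R n * sqrt (real n * mean_bw (h n) ^ CARD('d)))))"
      by blast
  qed
qed

end
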